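(* Let $d\ge 2$ and let $(\boldsymbol{x}_n)_{n\ge1}$, $\boldsymbol{x}_n=(x_n^{(1)},\dots,x_n^{(d)})$, be a sequence in $\mathbb{R}^d$ with positive components. Assume that there exists $c>0$ such that $x^{(l)}_{n+1}-x^{(l)}_n\ge c$ for all $1\le l\le d$ and all $n\ge 1$. Suppose that for every $D'\subseteq D=\{1,\dots,d\}$, with $d'$ denoting the number of elements of $D'$, there is some $\lambda_{D'}>0$ such that $$E(\boldsymbol{X}_N^{D'})\ll N^{4-\frac1d\left(2d'-\frac{31}{76}\right)-\lambda_{D'}}\qquad (N\to\infty).$$ Then $(\boldsymbol{x}_n)$ has $\infty$-MPPC.
   Context: Joint additive energy: for $D'\subseteq D=\{1,\dots,d\}$, $$E(\boldsymbol{X}_N^{D'}):=\#\{(n_1,n_2,n_3,n_4)\in\{1,\dots,N\}^4:\ |x^{(l)}_{n_1}+x^{(l)}_{n_2}-x^{(l)}_{n_3}-x^{(l)}_{n_4}|<1\ \text{ for all } l\in D'\}.$$ $\infty$-PPC (Poissonian pair correlation with respect to the sup-norm): for a sequence $(\boldsymbol{y}_n)$ in $[0,1)^d$, $s>0$ and $N\in\mathbb{N}$ let $$R^{(d)}_{2,\infty}(s,(\boldsymbol{y}_n),N):=\frac1N\#\Big\{1\le n\ne m\le N:\ \min_{\boldsymbol{k}\in\mathbb{Z}^d}\|\boldsymbol{y}_n-\boldsymbol{y}_m+\boldsymbol{k}\|_\infty\le \frac{s}{N^{1/d}}\Big\},$$ where ordered pairs $(n,m)$ are counted. The sequence $(\boldsymbol{y}_n)$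 has $\infty$-PPC if for every $s>0$, $R^{(d)}_{2,\infty}(s,(\boldsymbol{y}_n),N)\to(2s)^d$ as $N\to\infty$. $\infty$-MPPC (metric Poissonian pair correlation): $(\boldsymbol{x}_n)$ has $\infty$-MPPC if for Lebesgue-almost all $\boldsymbol{\alpha}=(\alpha_1,\dots,\alpha_d)\in\mathbb{R}^d$ the sequence $\big(\{x_n^{(1)}\alpha_1\},\dots,\{x_n^{(d)}\alpha_d\}\big)_{n\ge1}$ has $\infty$-PPC, where $\{\cdot\}$ denotes the fractional part. *)

theory Defs
  imports "HOL-Analysis.Analysis" "HOL-Library.Landau_Symbols"
begin

text \<open>
  The index set \<open>{1,\<dots>,d}\<close> is the finite type \<open>'d\<close>, so that \<open>d = CARD('d)\<close>.
  Sequences are indexed by the positive integers; the value at index 0 is irrelevant.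
\<close>

definition joint_additive_energy :: "(nat \<Rightarrow> real^'d) \<Rightarrow> 'd set \<Rightarrow> nat \<Rightarrow> nat" where
  "joint_additive_energy x D' N =
     card {(n1, n2, n3, n4).
       n1 \<in> {1..N} \<and> n2 \<in> {1..N} \<and> n3 \<in> {1..N} \<and> n4 \<in> {1..N} \<and>
       (\<forall>l\<in>D'. \<bar>x n1 $ l + x n2 $ l - x n3 $ l - x n4 $ l\<bar> < 1)}"

text \<open>The infimum is over a nonempty set of nonnegative reals and is attained, because
  only finitely many integer vectors \<open>k\<close> give a value below any given bound.\<close>

definition torus_sup_norm :: "real^'d \<Rightarrow> real" where
  "torus_sup_norm v = (INF k\<in>{k. \<forall>l. k $ l \<in> \<int>}. infnorm (v + k))"

definition pair_correlation :: "real \<Rightarrow> (nat \<Rightarrow> real^'d) \<Rightarrow> nat \<Rightarrow> real" where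
  "pair_correlation s y N =
     1 / real N * real (card {(n, m). n \<in> {1..N} \<and> m \<in> {1..N} \<and> n \<noteq> m \<and>
       torus_sup_norm (y n - y m) \<le> s / real N powr (1 / real CARD('d))})"

definition infinity_PPC :: "(nat \<Rightarrow> real^'d) \<Rightarrow> bool" where
  "infinity_PPC y \<longleftrightarrow>
     (\<forall>s>0. (\<lambda>N. pair_correlation s y N) \<longlonglongrightarrow> (2 * s) ^ CARD('d))"

definition infinity_MPPC :: "(nat \<Rightarrow> real^'d) \<Rightarrow> bool" where
  "infinity_MPPC x \<longleftrightarrow>
     (AE \<alpha> in lebesgue. infinity_PPC (\<lambda>n. \<chi> l. frac (x n $ l * \<alpha> $ l)))"

end

theory Submission
  imports Defs "HOL-Probability.Probability" "HOL-Real_Asymp.Real_Asymp"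
begin

text \<open>
  The indicator of \<open>dist(t, \<int>) \<le> s / N\<^bsup>1/d\<^esup>\<close> is sandwiched between polynomials without
  constant term in \<open>cos(\<pi> t)\<^bsup>2 w\<^esup>\<close>, \<open>w = \<lfloor>N\<^bsup>2/d\<^esup>\<rfloor>\<close>; these are finite trigonometric polynomials with
  nonnegative binomial Fourier coefficients.  The second moment of their pair sums with respect to a
  wide Gaussian weight counts the solutions of \<open>\<bar>k\<^sub>l z\<^sub>l - k'\<^sub>l w\<^sub>l\<bar> < \<eta>\<close> (\<open>l \<in> D'\<close>), where \<open>z\<close>, \<open>w\<close> are
  differences of the sequence and \<open>k\<^sub>l, k'\<^sub>l \<le> K = N\<^bsup>1/d + \<epsilon>\<^esup>\<close>; convergence along \<open>N = i\<^bsup>A\<^esup>\<close>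
  follows from summability of the second moments, and monotonicity fills the gaps.

  After a dyadic decomposition and taking logarithms the count becomes \<open>a\<^sub>1 = \<langle>F, D\<^sup>*D F\<rangle>\<close> with \<open>D\<close> a sum of
  translations by \<open>log k\<close>, and \<open>a\<^sub>i = \<langle>F, (D\<^sup>*D)\<^sup>i F\<rangle>\<close> is log-convex in \<open>i\<close>.  Here \<open>a\<^sub>0\<close> is bounded by the joint
  additive energy and \<open>a\<^sub>3\<close>, the sixth moment, by the divisor bound.  As \<open>d \<ge> 2\<close>, the differences with small
  index gap are so few that this elementary estimate gains more than the required power \<open>31/76\<close> of \<open>K\<close>,
  without any input on the zeta function.
\<close>

section \<open>The divisor bound\<close>

text \<open>A frequency vector k matters only through its support D', which is nonempty unless k =
  0; coordinates outside D' impose no condition, so the energies of all subsets enter. The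
  amplitudes are of order at most N^(-2), so a collision count smaller than N^4 by a power of N
  makes the second moment tend to zero with a power. With the weight \<theta> = N^g, g = (2d' -
  31/76)/d, the hypothesis turns the energy term into N^(4 - lam), while the sixth moment, about
  N^(4 + 3d'/d), becomes N^(4 - (d' - 62/76)/d); d' \<ge> 1 leaves the margin (14/76)/d for all
  losses N^\<epsilon>.

  The obstacle is that the components may grow arbitrarily fast: the gaps can fall into far more
  than logarithmically many dyadic classes, and Cauchy-Schwarz over all classes would lose a power
  of N. But near a fixed point y the product k z has a known size, so the class of k determines the
  class of z up to boundedly many choices. Hence only a power of log N of classes is visible at any
  one point, and the energies of all classes together never exceed the full energy.\<close>

lemma card_divisors_prime_power_mult:
  fixes p m e :: nat
  assumes "prime p" "m > 0"
  shows "card {d. d dvd p ^ e * m} \<le> (e + 1) * card {d. d dvd m}"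
proof -
  have "{d. d dvd p ^ e * m} \<subseteq> (\<lambda>(i, d). p ^ i * d) ` ({..e} \<times> {d. d dvd m})"
  proof
    fix d assume "d \<in> {d. d dvd p ^ e * m}"
    then obtain a b where ab: "d = a * b" "a dvd p ^ e" "b dvd m"
      using division_decomp[of d "p ^ e" m] by auto
    then obtain i where "i \<le> e" "a = p ^ i"
      using divides_primepow_nat[OF assms(1)] by auto
    then show "d \<in> (\<lambda>(i, d). p ^ i * d) ` ({..e} \<times> {d. d dvd m})"
      using ab by force
  qed
  then have "card {d. d dvd p ^ e * m} \<le> card ({..e} \<times> {d. d dvd m})"
    using assms by (intro surj_card_le) auto
  then show ?thesis by (simp add: card_cartesian_product)
qed

text \<open>A prime above 2^(1/\<epsilon>) has p^\<epsilon> \<ge> 2, and e + 1 \<le> 2^e; such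
  primes therefore contribute no constant to the divisor bound.\<close>

lemma Suc_le_powr_of_large_base:
  fixes p e :: nat and \<epsilon> :: real
  assumes "\<epsilon> > 0" "real p \<ge> 2 powr (1 / \<epsilon>)"
  shows "real (e + 1) \<le> (real p ^ e) powr \<epsilon>"
proof -
  have pp: "real p > 0" using assms(2) by (smt (verit) powr_gt_zero)
  have "2 = (2 powr (1 / \<epsilon>)) powr \<epsilon>" using assms(1) by (simp add: powr_powr)
  also have "\<dots> \<le> real p powr \<epsilon>" using assms by (intro powr_mono2) auto
  finally have "2 ^ e \<le> (real p powr \<epsilon>) ^ e" by (intro power_mono) auto
  also have "\<dots> = (real p ^ e) powr \<epsilon>"
    using pp by (simp add: powr_powr powr_realpow [symmetric] mult.commute)
  finally have "2 ^ e \<le> (real p ^ e) powr \<epsilon>" .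
  moreover have "real (e + 1) \<le> 2 ^ e"
    by (metis Suc_eq_plus1 Suc_leI less_exp of_nat_le_iff of_nat_numeral of_nat_power)
  ultimately show ?thesis by linarith
qed

lemma Suc_le_const_mult_powr:
  fixes \<epsilon> :: real
  assumes "\<epsilon> > 0"
  obtains C where "C \<ge> 1" "\<And>p e :: nat. p \<ge> 2 \<Longrightarrow> real (e + 1) \<le> C * (real p ^ e) powr \<epsilon>"
proof
  \<comment> \<open>In 1 + x \<le> exp x with x = e \<epsilon> ln 2 the slope in e is \<epsilon> ln
    2, which may be below 1; the second summand of \<open>C\<close> restores it.\<close>
  define C where "C = 1 + 1 / (\<epsilon> * ln 2)"
  show "C \<ge> 1" using assms by (simp add: C_def)
  fix p e :: nat assume p: "p \<ge> 2"
  have l: "\<epsilon> * ln 2 > 0" using assms by simp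
  have "1 + real e * (\<epsilon> * ln 2) \<le> exp (real e * (\<epsilon> * ln 2))"
    using exp_ge_add_one_self by blast
  also have "\<dots> = (2 ^ e) powr \<epsilon>" by (simp add: powr_def ln_realpow mult_ac)
  also have "\<dots> \<le> (real p ^ e) powr \<epsilon>"
    using p assms by (intro powr_mono2 power_mono) auto
  finally have a: "1 + real e * (\<epsilon> * ln 2) \<le> (real p ^ e) powr \<epsilon>" .
  have "real (e + 1) \<le> C * (1 + real e * (\<epsilon> * ln 2))"
    proof -
      have "C * (1 + real e * (\<epsilon> * ln 2)) = 1 + real e * (\<epsilon> * ln 2) + 1 / (\<epsilon> * ln 2) + real e"
        using l assms by (simp add: C_def field_simps)
      moreover have "1 / (\<epsilon> * ln 2) > 0" using l by simp
      ultimately show ?thesis using l by (smt (verit) mult_nonneg_nonneg of_nat_0_le_iff of_nat_1 of_nat_add)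
    qed
  also have "\<dots> \<le> C * (real p ^ e) powr \<epsilon>"
    using a \<open>C \<ge> 1\<close> by (intro mult_left_mono) auto
  finally show "real (e + 1) \<le> C * (real p ^ e) powr \<epsilon>" .
qed

text \<open>Only the finitely many primes below 2^(1/\<epsilon>) pay a factor \<open>C\<close>, each
  at most once, so \<open>C ^ card P\<close> serves for every n.\<close>

lemma divisor_bound:
  fixes \<epsilon> :: real
  assumes "\<epsilon> > 0"
  obtains C where "C > 0" "\<And>n :: nat. n > 0 \<Longrightarrow> real (card {d. d dvd n}) \<le> C * real n powr \<epsilon>"
proof -
  obtain C where C: "C \<ge> 1"
    "\<And>p e :: nat. p \<ge> 2 \<Longrightarrow> real (e + 1) \<le> C * (real p ^ e) powr \<epsilon>"
    using Suc_le_const_mult_powr[OF assms] by blast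
  define P where "P = {p :: nat. prime p \<and> real p < 2 powr (1 / \<epsilon>)}"
  have finP: "finite P"
  proof (rule finite_subset)
    show "P \<subseteq> {..nat \<lceil>2 powr (1 / \<epsilon>)\<rceil>}"
      by (auto simp: P_def le_nat_iff) (smt (verit) le_of_int_ceiling of_int_of_nat_eq of_int_le_iff)
  qed auto
  \<comment> \<open>The exponent of \<open>C\<close> counts just the small primes dividing
    \<open>n\<close>, so that removing the full power of one prime uses up at most one factor
    \<open>C\<close>.\<close>
  have main: "real (card {d. d dvd n}) \<le> C ^ card {p \<in> P. p dvd n} * real n powr \<epsilon>"
    if "n > 0" for n :: nat
    using that
  proof (induction n rule: less_induct)
    case (less n)
    show ?case
    proof (cases "n = 1")
      case True
      then show ?thesis using C(1) by simp
    next
      case False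
      then obtain p where p: "prime p" "p dvd n" using prime_factor_nat by blast
      obtain m where m: "n = p ^ multiplicity p n * m" "\<not> p dvd m"
        using multiplicity_decompose'[of n p] less.prems p by (metis not_prime_unit not_gr_zero)
      define e where "e = multiplicity p n"
      have e0: "e > 0" using p less.prems unfolding e_def by (simp add: prime_multiplicity_gt_zero_iff)
      have m0: "m > 0" using m less.prems by (metis mult_0_right neq0_conv)
      have p2: "p \<ge> 2" using p prime_ge_2_nat by auto
      have "p ^ e \<ge> 2" using e0 p2 by (metis One_nat_def Suc_leI numeral_2_eq_2 one_le_power order_trans power_increasing power_one_right prime_ge_1_nat p(1))
      then have "m < p ^ e * m" using m0 by simp
      then have "m < n" using m(1) e_def by simp
      then have IH: "real (card {d. d dvd m}) \<le> C ^ card {p \<in> P. p dvd m} * real m powr \<epsilon>"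
        using less.IH m0 by blast
      have n_eq: "n = p ^ e * m" using m e_def by simp
      have nn: "real n powr \<epsilon> = (real p ^ e) powr \<epsilon> * real m powr \<epsilon>"
        using n_eq by (simp add: powr_mult)
      have step: "real (card {d. d dvd n}) \<le> real (e + 1) * real (card {d. d dvd m})"
        using card_divisors_prime_power_mult[OF p(1) m0, of e] n_eq
        by (metis of_nat_le_iff of_nat_mult)
      show ?thesis
      proof (cases "p \<in> P")
        case True
        have "{p \<in> P. p dvd n} \<supseteq> insert p {p \<in> P. p dvd m}" using True p n_eq by auto
        then have "card (insert p {p \<in> P. p dvd m}) \<le> card {p \<in> P. p dvd n}"
          using finP by (intro card_mono) auto
        then have c: "Suc (card {p \<in> P. p dvd m}) \<le> card {p \<in> P. p dvd n}"
          using m(2) finP by simp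
        have "real (card {d. d dvd n})
            \<le> (C * (real p ^ e) powr \<epsilon>) * (C ^ card {p \<in> P. p dvd m} * real m powr \<epsilon>)"
          using step IH C(2)[OF p2, of e] by (smt (verit) mult_mono of_nat_0_le_iff)
        also have "\<dots> = C ^ Suc (card {p \<in> P. p dvd m}) * real n powr \<epsilon>" by (simp add: nn)
        also have "\<dots> \<le> C ^ card {p \<in> P. p dvd n} * real n powr \<epsilon>"
          using c C(1) by (intro mult_right_mono power_increasing) auto
        finally show ?thesis .
      next
        case False
        then have "real p \<ge> 2 powr (1 / \<epsilon>)" using p(1) by (auto simp: P_def)
        then have l: "real (e + 1) \<le> (real p ^ e) powr \<epsilon>"
          using Suc_le_powr_of_large_base assms by blast
        have c: "card {p \<in> P. p dvd m} \<le> card {p \<in> P. p dvd n}"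
          using finP n_eq by (intro card_mono) auto
        have "real (card {d. d dvd n})
            \<le> ((real p ^ e) powr \<epsilon>) * (C ^ card {p \<in> P. p dvd m} * real m powr \<epsilon>)"
          using step IH l by (smt (verit) mult_mono of_nat_0_le_iff)
        also have "\<dots> = C ^ card {p \<in> P. p dvd m} * real n powr \<epsilon>" by (simp add: nn)
        also have "\<dots> \<le> C ^ card {p \<in> P. p dvd n} * real n powr \<epsilon>"
          using c C(1) by (intro mult_right_mono power_increasing) auto
        finally show ?thesis .
      qed
    qed
  qed
  show ?thesis
  proof
    show "C ^ card P > 0" using C(1) by simp
    fix n :: nat assume n: "n > 0"
    have "C ^ card {p \<in> P. p dvd n} \<le> C ^ card P"
      using finP C(1) by (intro power_increasing card_mono) auto
    then have "C ^ card {p \<in> P. p dvd n} * real n powr \<epsilon> \<le> C ^ card P * real n powr \<epsilon>"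
      by (intro mult_right_mono) auto
    then show "real (card {d. d dvd n}) \<le> C ^ card P * real n powr \<epsilon>"
      using main[OF n] by linarith
  qed
qed

section \<open>Representations of an integer as a product of three factors\<close>

abbreviation triple_factorizations :: "nat \<Rightarrow> (nat \<times> nat \<times> nat) set" where
  "triple_factorizations a \<equiv> {(k1, k2, k3). k1 * k2 * k3 = a}"

text \<open>The first two factors are divisors of \<open>a\<close> and determine the third.\<close>

lemma card_triple_factorizations_le:
  fixes a :: nat
  assumes "a > 0"
  shows "finite (triple_factorizations a)"
    and "card (triple_factorizations a) \<le> (card {d. d dvd a})\<^sup>2"
proof -
  let ?D = "{d. d dvd a}"
  have sub: "(triple_factorizations a) \<subseteq> (\<lambda>(k1, k2). (k1, k2, a div (k1 * k2))) ` (?D \<times> ?D)"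
  proof (clarify)
    fix k1 k2 k3 assume "a = k1 * k2 * k3"
    with assms show "(k1, k2, k3) \<in> (\<lambda>(x, y). (x, y, k1 * k2 * k3 div (x * y))) `
        ({d. d dvd k1 * k2 * k3} \<times> {d. d dvd k1 * k2 * k3})"
      by (intro image_eqI[of _ _ "(k1, k2)"]) (auto simp: mult_ac)
  qed
  have fin: "finite (?D \<times> ?D)" using assms by auto
  show "finite (triple_factorizations a)" using finite_subset[OF sub] fin by blast
  have "card (triple_factorizations a) \<le> card (?D \<times> ?D)"
    using surj_card_le[OF fin sub] .
  then show "card (triple_factorizations a) \<le> (card ?D)\<^sup>2"
    by (simp add: card_cartesian_product power2_eq_square)
qed

lemma triple_factorization_bound:
  fixes \<epsilon> :: real
  assumes "\<epsilon> > 0"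
  obtains C where "C > 0"
    "\<And>a :: nat. a > 0 \<Longrightarrow> real (card (triple_factorizations a)) \<le> C * real a powr \<epsilon>"
proof -
  obtain C where C: "C > 0" "\<And>n :: nat. n > 0 \<Longrightarrow> real (card {d. d dvd n}) \<le> C * real n powr (\<epsilon> / 2)"
    using divisor_bound[of "\<epsilon> / 2"] assms by auto
  show ?thesis
  proof
    show "C\<^sup>2 > 0" using C(1) by simp
    fix a :: nat assume a: "a > 0"
    have "real (card (triple_factorizations a)) \<le> (real (card {d. d dvd a}))\<^sup>2"
      using card_triple_factorizations_le(2)[OF a] by (metis of_nat_le_iff of_nat_power)
    also have "\<dots> \<le> (C * real a powr (\<epsilon> / 2))\<^sup>2" using C(2)[OF a] by (intro power_mono) auto
    also have "\<dots> = C\<^sup>2 * real a powr \<epsilon>"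
      using a by (simp add: power_mult_distrib power2_eq_square powr_add [symmetric])
    finally show "real (card (triple_factorizations a)) \<le> C\<^sup>2 * real a powr \<epsilon>" .
  qed
qed

section \<open>Log-convexity for sums of overlapping boxes\<close>

text \<open>The inner product in L^2 of the indicators of two translates of one box. It depends only
  on p - q and is a soft form of the condition that p and q differ by at most t; unlike the sharp
  condition it obeys Cauchy-Schwarz.\<close>

definition box_overlap :: "real^'d \<Rightarrow> real^'d \<Rightarrow> real^'d \<Rightarrow> real" where
  "box_overlap t p q = measure lebesgue (cbox p (p + t) \<inter> cbox q (q + t))"

definition overlap_sum ::
    "real^'d \<Rightarrow> 'i set \<Rightarrow> ('i \<Rightarrow> real^'d) \<Rightarrow> 'j set \<Rightarrow> ('j \<Rightarrow> real^'d) \<Rightarrow> real" where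
  "overlap_sum t I p J q = (\<Sum>i\<in>I. \<Sum>j\<in>J. box_overlap t (p i) (q j))"

lemma overlap_sum_cartesian:
  "overlap_sum t I p J q = (\<Sum>(i, j)\<in>I \<times> J. box_overlap t (p i) (q j))"
  by (simp add: overlap_sum_def sum.cartesian_product)

lemma box_overlap_shift: "box_overlap t (p + v) (q + v) = box_overlap t p q"
proof -
  have "cbox (p + v) (p + v + t) \<inter> cbox (q + v) (q + v + t)
      = (+) v ` (cbox p (p + t) \<inter> cbox q (q + t))"
    using cbox_translation[of v p "p + t"] cbox_translation[of v q "q + t"]
    by (simp add: image_Int add_ac)
  then show ?thesis unfolding box_overlap_def by (simp add: measure_translation)
qed

lemma box_overlap_eqI: "p - q = p' - q' \<Longrightarrow> box_overlap t p q = box_overlap t p' q'"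
proof -
  assume "p - q = p' - q'"
  then have "p + (p' - p) = p'" "q + (p' - p) = q'" by (auto simp: algebra_simps)
  then show ?thesis using box_overlap_shift[of t p "p' - p" q] by simp
qed

lemma fmeasurable_box_overlap: "cbox p q \<inter> cbox p' q' \<in> lmeasurable"
  for p q p' q' :: "real^'d"
  by (simp add: Int_interval)

lemma box_overlap_integral:
  "integrable lebesgue (\<lambda>y. indicator (cbox p (p + t)) y * indicator (cbox q (q + t)) y :: real)"
  "(\<integral>y. indicator (cbox p (p + t)) y * indicator (cbox q (q + t)) y \<partial>lebesgue) = box_overlap t p q"
  using fmeasurable_box_overlap[of p "p + t" q "q + t"]
  unfolding indicator_inter_arith [symmetric] box_overlap_def
  by (auto simp: fmeasurable_def)

lemma overlap_sum_integral:
  assumes "finite I" "finite J"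
  shows "integrable lebesgue (\<lambda>y. (\<Sum>i\<in>I. indicator (cbox (p i) (p i + t)) y) *
      (\<Sum>j\<in>J. indicator (cbox (q j) (q j + t)) y) :: real)"
    and "(\<integral>y. (\<Sum>i\<in>I. indicator (cbox (p i) (p i + t)) y) *
      (\<Sum>j\<in>J. indicator (cbox (q j) (q j + t)) y) \<partial>lebesgue) = overlap_sum t I p J q"
  by (simp_all add: sum_product overlap_sum_def box_overlap_integral)

text \<open>The integral of (\<theta> F - G)^2 is nonnegative. Keeping \<theta> free avoids square
  roots and postpones the balancing to the moment when all sizes are powers of N.\<close>

lemma overlap_sum_Cauchy_Schwarz:
  fixes \<theta> :: real
  assumes "finite I" "finite J"
  shows "2 * \<theta> * overlap_sum t I p J q \<le> \<theta>\<^sup>2 * overlap_sum t I p I p + overlap_sum t J q J q"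
proof -
  let ?F = "\<lambda>y. \<Sum>i\<in>I. indicator (cbox (p i) (p i + t)) y :: real"
  let ?G = "\<lambda>y. \<Sum>j\<in>J. indicator (cbox (q j) (q j + t)) y :: real"
  note ints = overlap_sum_integral[OF assms(1) assms(1), of p t p]
    overlap_sum_integral[OF assms(1) assms(2), of p t q]
    overlap_sum_integral[OF assms(2) assms(2), of q t q]
  have sq: "(\<theta> * a - b)\<^sup>2 = \<theta>\<^sup>2 * (a * a) - 2 * \<theta> * (a * b) + b * b" for a b :: real
    by (simp add: power2_eq_square algebra_simps)
  have "0 \<le> (\<integral>y. (\<theta> * ?F y - ?G y)\<^sup>2 \<partial>lebesgue)" by simp
  also have "\<dots> = \<theta>\<^sup>2 * overlap_sum t I p I p - 2 * \<theta> * overlap_sum t I p J q + overlap_sum t J q J q"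
    unfolding sq using ints
    by (simp only: Bochner_Integration.integral_add Bochner_Integration.integral_diff
        Bochner_Integration.integral_mult_right Bochner_Integration.integrable_diff
        Bochner_Integration.integrable_mult_right)
  finally show ?thesis by linarith
qed

text \<open>With \<open>D\<close> the operator that translates by all \<open>v k\<close> and \<open>F\<close> the sum of the indicators of the
  boxes at \<open>u s\<close>, the four sums are \<open>a\<^sub>i = \<langle>F, (D\<^sup>*D)\<^sup>i F\<rangle>\<close>; the bound is the weighted
  AM-GM form of the log-convexity estimate \<open>a\<^sub>1\<^sup>3 \<le> a\<^sub>0\<^sup>2 a\<^sub>3\<close>.\<close>

lemma overlap_sum_log_convex:
  fixes u :: "'s \<Rightarrow> real^'d" and v :: "'k \<Rightarrow> real^'d" and \<theta> :: real
  assumes fin: "finite S" "finite K" and \<theta>: "\<theta> > 0"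
  defines "p1 \<equiv> \<lambda>(s, k). u s + v k"
  defines "p3 \<equiv> \<lambda>(s, k1, k2, k3). u s + v k1 - v k2 + v k3"
  shows "3 * overlap_sum t (S \<times> K) p1 (S \<times> K) p1
    \<le> 2 * \<theta> * overlap_sum t S u S u
      + overlap_sum t (S \<times> K \<times> K \<times> K) p3 (S \<times> K \<times> K \<times> K) p3 / \<theta>\<^sup>2"
proof -
  define p2 where "p2 = (\<lambda>(s, k1, k2). u s + v k1 - v k2)"
  let ?a0 = "overlap_sum t S u S u"
  let ?a1 = "overlap_sum t (S \<times> K) p1 (S \<times> K) p1"
  let ?a2 = "overlap_sum t (S \<times> K \<times> K) p2 (S \<times> K \<times> K) p2"
  let ?a3 = "overlap_sum t (S \<times> K \<times> K \<times> K) p3 (S \<times> K \<times> K \<times> K) p3"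
  \<comment> \<open>The identity <F, D*D F> = <D F, D F>: since an overlap depends only on the
    difference of the corners, a translation on one side is the opposite translation on the other.
    \<open>c2\<close> is the same with one more application.\<close>
  have c1: "overlap_sum t S u (S \<times> K \<times> K) p2 = ?a1"
    unfolding overlap_sum_cartesian
    by (rule sum.reindex_bij_witness[of _ "\<lambda>((s, k), (s', k')). (s, (s', k', k))"
          "\<lambda>(s, (s', k', k)). ((s, k), (s', k'))"])
      (auto simp: p1_def p2_def intro!: box_overlap_eqI)
  have c2: "overlap_sum t (S \<times> K) p1 (S \<times> K \<times> K \<times> K) p3 = ?a2"
    unfolding overlap_sum_cartesian
    by (rule sum.reindex_bij_witness[of _ "\<lambda>((s, k, k3), (s', k1, k2)). ((s, k), (s', k1, k2, k3))"
          "\<lambda>((s, k), (s', k1, k2, k3)). ((s, k, k3), (s', k1, k2))"])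
      (auto simp: p1_def p2_def p3_def intro!: box_overlap_eqI)
  have "2 * \<theta> * ?a1 \<le> \<theta>\<^sup>2 * ?a0 + ?a2"
    using overlap_sum_Cauchy_Schwarz[of S "S \<times> K \<times> K" \<theta> t u p2] fin c1 by simp
  moreover have "2 * \<theta> * ?a2 \<le> \<theta>\<^sup>2 * ?a1 + ?a3"
    using overlap_sum_Cauchy_Schwarz[of "S \<times> K" "S \<times> K \<times> K \<times> K" \<theta> t p1 p3] fin c2 by simp
  \<comment> \<open>Eliminates a_2: the estimate of a_1 is multiplied by 2\<theta> and the estimate
    of 2\<theta> a_2 inserted; 4 - 1 is the origin of the factor 3.\<close>
  ultimately have "2 * \<theta> * (2 * \<theta> * ?a1) \<le> 2 * \<theta> * (\<theta>\<^sup>2 * ?a0) + (\<theta>\<^sup>2 * ?a1 + ?a3)"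
    using \<theta> by (smt (verit, best) distrib_left mult_left_mono)
  then have "\<theta>\<^sup>2 * (3 * ?a1) \<le> \<theta>\<^sup>2 * (2 * \<theta> * ?a0) + ?a3"
    by (simp add: power2_eq_square algebra_simps)
  then have "3 * ?a1 \<le> (\<theta>\<^sup>2 * (2 * \<theta> * ?a0) + ?a3) / \<theta>\<^sup>2"
    using \<theta> by (simp add: field_simps)
  then show ?thesis using \<theta> by (simp add: field_simps)
qed

section \<open>From overlap integrals to numbers of close pairs\<close>

definition close_points :: "real^'d \<Rightarrow> real^'d \<Rightarrow> real^'d \<Rightarrow> bool" where
  "close_points t p q \<longleftrightarrow> (\<forall>l. \<bar>p $ l - q $ l\<bar> \<le> t $ l)"

definition close_pairs :: "real^'d \<Rightarrow> 'i set \<Rightarrow> ('i \<Rightarrow> real^'d) \<Rightarrow> ('i \<times> 'i) set" where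
  "close_pairs t I p = {(i, j). i \<in> I \<and> j \<in> I \<and> close_points t (p i) (p j)}"

lemma finite_close_pairs [simp]: "finite I \<Longrightarrow> finite (close_pairs t I p)"
  by (rule finite_subset[of _ "I \<times> I"]) (auto simp: close_pairs_def)

lemma measure_cbox_cart:
  fixes a b :: "real^'d"
  assumes "\<And>l. a $ l \<le> b $ l"
  shows "measure lebesgue (cbox a b) = (\<Prod>l\<in>UNIV. b $ l - a $ l)"
  using assms content_cbox_cart[of a b] by (simp add: interval_ne_empty_cart)

lemma box_overlap_le:
  assumes "\<And>l. t $ l > 0"
  shows "box_overlap t p q \<le> (if close_points t p q then \<Prod>l\<in>UNIV. t $ l else 0)"
proof (cases "close_points t p q")
  case True
  have "box_overlap t p q \<le> measure lebesgue (cbox p (p + t))"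
    unfolding box_overlap_def by (intro measure_mono_fmeasurable) auto
  also have "\<dots> = (\<Prod>l\<in>UNIV. t $ l)"
    using less_imp_le[OF assms] by (subst measure_cbox_cart) simp_all
  finally show ?thesis using True by simp
next
  case False
  then obtain l where l: "\<bar>p $ l - q $ l\<bar> > t $ l" by (auto simp: close_points_def not_le)
  have "cbox p (p + t) \<inter> cbox q (q + t) = {}"
  proof (rule ccontr)
    assume "cbox p (p + t) \<inter> cbox q (q + t) \<noteq> {}"
    then obtain y where "p $ l \<le> y $ l" "y $ l \<le> p $ l + t $ l" "q $ l \<le> y $ l" "y $ l \<le> q $ l + t $ l"
      unfolding mem_box_cart disjoint_iff by (metis (no_types, lifting) IntD1 IntD2 ex_in_conv mem_box_cart vector_add_component)
    with l show False by linarith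
  qed
  then show ?thesis using False by (simp add: box_overlap_def)
qed

text \<open>The box of half the side length placed at the coordinatewise maximum of the two corners
  lies in both boxes.\<close>

lemma box_overlap_ge:
  fixes t p q :: "real^'d"
  assumes "\<And>l. t $ l > 0" "close_points (t /\<^sub>R 2) p q"
  shows "box_overlap t p q \<ge> (\<Prod>l\<in>UNIV. t $ l) / 2 ^ CARD('d)"
proof -
  define m where "m = (\<chi> l. max (p $ l) (q $ l))"
  have "(\<Prod>l\<in>UNIV. t $ l) / 2 ^ CARD('d) = (\<Prod>l\<in>UNIV. t $ l / 2)"
    by (simp add: prod_dividef)
  also have "\<dots> = measure lebesgue (cbox m (m + t /\<^sub>R 2))"
    using less_imp_le[OF assms(1)] by (subst measure_cbox_cart) (simp_all add: field_simps)
  also have "\<dots> \<le> box_overlap t p q"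
    unfolding box_overlap_def
  proof (intro measure_mono_fmeasurable fmeasurable_box_overlap)
    show "cbox m (m + t /\<^sub>R 2) \<subseteq> cbox p (p + t) \<inter> cbox q (q + t)"
    proof
      fix y assume y: "y \<in> cbox m (m + t /\<^sub>R 2)"
      have "p $ l \<le> y $ l \<and> y $ l \<le> p $ l + t $ l \<and> q $ l \<le> y $ l \<and> y $ l \<le> q $ l + t $ l" for l
      proof -
        have "max (p $ l) (q $ l) \<le> y $ l" "y $ l \<le> max (p $ l) (q $ l) + t $ l / 2"
          using y by (auto simp: mem_box_cart m_def dest: spec[of _ l])
        moreover have "\<bar>p $ l - q $ l\<bar> \<le> t $ l / 2"
          using assms(2) by (auto simp: close_points_def dest: spec[of _ l])
        moreover have "t $ l > 0" by fact
        ultimately show ?thesis by linarith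
      qed
      then show "y \<in> cbox p (p + t) \<inter> cbox q (q + t)" by (auto simp: mem_box_cart)
    qed
  qed auto
  finally show ?thesis .
qed

lemma overlap_sum_le_close_pairs:
  assumes "\<And>l. t $ l > 0" "finite I"
  shows "overlap_sum t I p I p \<le> (\<Prod>l\<in>UNIV. t $ l) * card (close_pairs t I p)"
proof -
  have "overlap_sum t I p I p \<le> (\<Sum>(i, j)\<in>I \<times> I. if (i, j) \<in> close_pairs t I p then \<Prod>l\<in>UNIV. t $ l else 0)"
    unfolding overlap_sum_cartesian
    using box_overlap_le[OF assms(1)] by (intro sum_mono) (auto simp: close_pairs_def)
  also have "\<dots> = (\<Sum>x\<in>I \<times> I \<inter> close_pairs t I p. \<Prod>l\<in>UNIV. t $ l)"
    using assms(2) by (subst sum.inter_restrict) (auto intro!: sum.cong)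
  also have "I \<times> I \<inter> close_pairs t I p = close_pairs t I p" by (auto simp: close_pairs_def)
  finally show ?thesis by (simp add: mult.commute)
qed

lemma overlap_sum_ge_close_pairs:
  fixes t :: "real^'d"
  assumes "\<And>l. t $ l > 0" "finite I"
  shows "(\<Prod>l\<in>UNIV. t $ l) / 2 ^ CARD('d) * card (close_pairs (t /\<^sub>R 2) I p) \<le> overlap_sum t I p I p"
proof -
  have "(\<Prod>l\<in>UNIV. t $ l) / 2 ^ CARD('d) * card (close_pairs (t /\<^sub>R 2) I p)
      = (\<Sum>x\<in>close_pairs (t /\<^sub>R 2) I p. (\<Prod>l\<in>UNIV. t $ l) / 2 ^ CARD('d))" by simp
  also have "\<dots> \<le> (\<Sum>(i, j)\<in>close_pairs (t /\<^sub>R 2) I p. box_overlap t (p i) (p j))"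
    by (intro sum_mono) (auto simp: close_pairs_def intro!: box_overlap_ge assms)
  also have "\<dots> \<le> (\<Sum>(i, j)\<in>I \<times> I. box_overlap t (p i) (p j))"
    using assms(2) by (intro sum_mono2) (auto simp: close_pairs_def box_overlap_def)
  finally show ?thesis by (simp add: overlap_sum_cartesian)
qed

text \<open>The log-convexity estimate for sharp counts. Replacing overlaps by counts costs the
  factor 2^d and a halved window on the left; the volume of the box cancels.\<close>

lemma close_pairs_log_convex:
  fixes u :: "'s \<Rightarrow> real^'d" and v :: "'k \<Rightarrow> real^'d" and \<theta> :: real
  assumes fin: "finite S" "finite K" and \<theta>: "\<theta> > 0" and t: "\<And>l. t $ l > 0"
  shows "3 * real (card (close_pairs (t /\<^sub>R 2) (S \<times> K) (\<lambda>(s, k). u s + v k)))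
    \<le> 2 ^ CARD('d) * (2 * \<theta> * card (close_pairs t S u)
      + card (close_pairs t (S \<times> K \<times> K \<times> K) (\<lambda>(s, k1, k2, k3). u s + v k1 - v k2 + v k3)) / \<theta>\<^sup>2)"
proof -
  define T where "T = (\<Prod>l\<in>UNIV. t $ l)"
  have T: "T > 0" unfolding T_def by (rule prod_pos) (rule t)
  let ?a0 = "overlap_sum t S u S u"
  let ?p1 = "\<lambda>(s, k). u s + v k" and ?p3 = "\<lambda>(s, k1, k2, k3). u s + v k1 - v k2 + v k3"
  have "3 * (T / 2 ^ CARD('d) * card (close_pairs (t /\<^sub>R 2) (S \<times> K) ?p1))
      \<le> 3 * overlap_sum t (S \<times> K) ?p1 (S \<times> K) ?p1"
    using overlap_sum_ge_close_pairs[OF t, of "S \<times> K" ?p1] fin by (simp add: T_def)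
  also have "\<dots> \<le> 2 * \<theta> * overlap_sum t S u S u
      + overlap_sum t (S \<times> K \<times> K \<times> K) ?p3 (S \<times> K \<times> K \<times> K) ?p3 / \<theta>\<^sup>2"
    using overlap_sum_log_convex[OF fin \<theta>] .
  also have "\<dots> \<le> 2 * \<theta> * (T * card (close_pairs t S u))
      + (T * card (close_pairs t (S \<times> K \<times> K \<times> K) ?p3)) / \<theta>\<^sup>2"
    using overlap_sum_le_close_pairs[OF t, of S u] fin \<theta>
      overlap_sum_le_close_pairs[OF t, of "S \<times> K \<times> K \<times> K" ?p3]
    by (intro add_mono mult_left_mono divide_right_mono) (auto simp: T_def)
  finally have "T * (3 * card (close_pairs (t /\<^sub>R 2) (S \<times> K) ?p1))
      \<le> T * (2 ^ CARD('d) * (2 * \<theta> * card (close_pairs t S u)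
        + card (close_pairs t (S \<times> K \<times> K \<times> K) ?p3) / \<theta>\<^sup>2))"
    by (simp add: field_simps)
  then show ?thesis using T by (simp only: mult_le_cancel_left_pos)
qed

text \<open>At each point \<open>y\<close>, by Cauchy--Schwarz, the square of a sum over at most \<open>L\<close> colours is at most
  \<open>L\<close> times the sum of the squares.\<close>

lemma close_pairs_le_colour_classes:
  fixes p :: "'i \<Rightarrow> real^'d" and col :: "'i \<Rightarrow> 'c" and L :: real
  assumes fin: "finite I" and t: "\<And>l. t $ l > 0"
    and L: "\<And>y. card (col ` {i \<in> I. close_points t y (p i)}) \<le> L"
  shows "real (card (close_pairs (t /\<^sub>R 2) I p))
    \<le> 2 ^ CARD('d) * L * (\<Sum>c\<in>col ` I. card (close_pairs t {i \<in> I. col i = c} p))"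
proof -
  define T where "T = (\<Prod>l\<in>UNIV. t $ l)"
  have T: "T > 0" unfolding T_def by (rule prod_pos) (rule t)
  let ?ind = "\<lambda>i y. indicator (cbox (p i) (p i + t)) y :: real"
  let ?I = "\<lambda>c. {i \<in> I. col i = c}"
  have L0: "L \<ge> 0" using L[of 0] by (smt (verit) of_nat_0_le_iff)
  have pt: "(\<Sum>i\<in>I. ?ind i y) * (\<Sum>i\<in>I. ?ind i y)
      \<le> L * (\<Sum>c\<in>col ` I. (\<Sum>i\<in>?I c. ?ind i y) * (\<Sum>i\<in>?I c. ?ind i y))" for y
  proof -
    \<comment> \<open>All points whose box contains y lie within t of y, so the hypothesis on
      colours applies to them.\<close>
    define A where "A = {i \<in> I. y \<in> cbox (p i) (p i + t)}"
    have A: "finite A" "A \<subseteq> I" using fin by (auto simp: A_def)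
    have "A \<subseteq> {i \<in> I. close_points t y (p i)}"
    proof
      fix i assume "i \<in> A"
      then have "i \<in> I" and "\<forall>l. p i $ l \<le> y $ l \<and> y $ l \<le> p i $ l + t $ l"
        by (auto simp: A_def mem_box_cart)
      then show "i \<in> {i \<in> I. close_points t y (p i)}"
        by (auto simp: close_points_def abs_le_iff) (smt (verit) t)+
    qed
    then have "card (col ` A) \<le> card (col ` {i \<in> I. close_points t y (p i)})"
      using fin by (intro card_mono) auto
    then have cA: "real (card (col ` A)) \<le> L" using L[of y] by linarith
    have z: "(\<Sum>i\<in>?I c. ?ind i y) = 0" if "c \<notin> col ` A" for c
      using that by (intro sum.neutral) (auto simp: A_def indicator_def)
    have "(\<Sum>i\<in>I. ?ind i y) = (\<Sum>c\<in>col ` I. \<Sum>i\<in>?I c. ?ind i y)"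
      using fin by (intro sum.image_gen)
    also have "\<dots> = (\<Sum>c\<in>col ` A. \<Sum>i\<in>?I c. ?ind i y)"
      using A fin z by (intro sum.mono_neutral_right) auto
    finally have "(\<Sum>i\<in>I. ?ind i y) * (\<Sum>i\<in>I. ?ind i y) = (\<Sum>c\<in>col ` A. \<Sum>i\<in>?I c. ?ind i y)\<^sup>2"
      by (simp add: power2_eq_square)
    also have "\<dots> \<le> (\<Sum>c\<in>col ` A. (\<Sum>i\<in>?I c. ?ind i y)\<^sup>2) * card (col ` A)"
      by (rule sum_squared_le_sum_of_squares) 
    also have "\<dots> \<le> (\<Sum>c\<in>col ` A. (\<Sum>i\<in>?I c. ?ind i y)\<^sup>2) * L"
      using cA by (intro mult_left_mono sum_nonneg) auto
    \<comment> \<open>Restoring the colours absent at y costs nothing, as squares are nonnegative,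
      and makes the range of summation independent of y, ready for integration.\<close>
    also have "\<dots> \<le> (\<Sum>c\<in>col ` I. (\<Sum>i\<in>?I c. ?ind i y)\<^sup>2) * L"
      using A fin L0 by (intro mult_right_mono sum_mono2) auto
    finally show ?thesis by (simp add: power2_eq_square mult.commute)
  qed
  have "T / 2 ^ CARD('d) * card (close_pairs (t /\<^sub>R 2) I p) \<le> overlap_sum t I p I p"
    using overlap_sum_ge_close_pairs[OF t fin] by (simp add: T_def)
  also have "\<dots> = (\<integral>y. (\<Sum>i\<in>I. ?ind i y) * (\<Sum>i\<in>I. ?ind i y) \<partial>lebesgue)"
    by (rule overlap_sum_integral(2)[OF fin fin, symmetric])
  also have "\<dots> \<le> (\<integral>y. L * (\<Sum>c\<in>col ` I. (\<Sum>i\<in>?I c. ?ind i y) * (\<Sum>i\<in>?I c. ?ind i y)) \<partial>lebesgue)"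
    using pt fin by (intro integral_mono Bochner_Integration.integrable_sum
        Bochner_Integration.integrable_mult_right overlap_sum_integral(1)) auto
  also have "\<dots> = L * (\<Sum>c\<in>col ` I. overlap_sum t (?I c) p (?I c) p)"
    using fin by (simp add: overlap_sum_integral Bochner_Integration.integral_sum)
  also have "\<dots> \<le> L * (\<Sum>c\<in>col ` I. T * card (close_pairs t (?I c) p))"
    unfolding T_def using fin L0
    by (intro mult_left_mono sum_mono overlap_sum_le_close_pairs[OF t]) auto
  finally have "T * card (close_pairs (t /\<^sub>R 2) I p)
      \<le> T * (2 ^ CARD('d) * L * (\<Sum>c\<in>col ` I. card (close_pairs t (?I c) p)))"
    by (simp add: field_simps sum_distrib_left)
  then show ?thesis using T by (simp only: mult_le_cancel_left_pos)
qed

section \<open>Counting in a dyadic class\<close>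

lemma card_le_fibres:
  assumes "finite Y" "f ` X \<subseteq> Y" "\<And>y. y \<in> Y \<Longrightarrow> card {x \<in> X. f x = y} \<le> D"
  shows "card X \<le> D * card Y"
proof -
  have "X = (\<Union>y\<in>Y. {x \<in> X. f x = y})" using assms(2) by auto
  then have "card X \<le> (\<Sum>y\<in>Y. card {x \<in> X. f x = y})"
    using card_UN_le[OF assms(1), of "\<lambda>y. {x \<in> X. f x = y}"] by simp
  also have "\<dots> \<le> (\<Sum>y\<in>Y. D)" using assms(3) by (intro sum_mono)
  finally show ?thesis by (simp add: mult.commute)
qed

lemma card_nat_le_diameter:
  fixes A :: "nat set" and R :: real
  assumes "finite A" "R \<ge> 0" "\<And>a b. a \<in> A \<Longrightarrow> b \<in> A \<Longrightarrow> real b - real a \<le> R"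
  shows "card A \<le> 1 + R"
proof (cases "A = {}")
  case False
  have "A \<subseteq> {Min A..Max A}" using assms(1) by auto
  then have "card A \<le> card {Min A..Max A}" by (intro card_mono) auto
  moreover have "Min A \<le> Max A" using False assms(1) by simp
  ultimately have "real (card A) \<le> 1 + (real (Max A) - real (Min A))" by (simp add: of_nat_diff)
  then show ?thesis using assms(3)[of "Min A" "Max A"] False assms(1) by simp
qed (use assms in auto)

text \<open>Two admissible values of a have logarithms within 2\<tau> of each other, hence differ by
  at most 2M\<tau>.\<close>

lemma card_close_in_ratio:
  fixes b M :: nat and \<rho> \<tau> :: real
  assumes "\<tau> \<ge> 0"
  shows "real (card {a \<in> {1..M}. \<bar>\<rho> + ln (real a) - ln (real b)\<bar> \<le> \<tau>}) \<le> 1 + 2 * real M * \<tau>"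
proof (rule card_nat_le_diameter)
  fix a a' assume "a \<in> {a \<in> {1..M}. \<bar>\<rho> + ln (real a) - ln (real b)\<bar> \<le> \<tau>}"
    "a' \<in> {a \<in> {1..M}. \<bar>\<rho> + ln (real a) - ln (real b)\<bar> \<le> \<tau>}"
  then have a: "a \<ge> 1" "a' \<ge> 1" "a' \<le> M" and l: "ln (real a) - ln (real a') \<ge> - (2 * \<tau>)" by auto
  have "real a / real a' = exp (ln (real a) - ln (real a'))" using a by (simp add: exp_diff)
  also have "\<dots> \<ge> 1 + (ln (real a) - ln (real a'))" by (rule exp_ge_add_one_self)
  finally have "1 - 2 * \<tau> \<le> real a / real a'" using l by linarith
  then have "real a' * (1 - 2 * \<tau>) \<le> real a" using a by (simp add: field_simps)
  then have "real a' - real a \<le> 2 * \<tau> * real a'" by (simp add: algebra_simps)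
  also have "\<dots> \<le> 2 * \<tau> * real M" using a assms by (intro mult_left_mono) auto
  finally show "real a' - real a \<le> 2 * real M * \<tau>" by (simp add: mult_ac)
qed (use assms in auto)

text \<open>One coordinate of the sixth moment; the shift \<open>\<rho>\<close> will be the
  difference of the logarithms of two gaps.\<close>

definition log_close_sextuples :: "nat \<Rightarrow> real \<Rightarrow> real \<Rightarrow> ((nat \<times> nat \<times> nat) \<times> (nat \<times> nat \<times> nat)) set" where
  "log_close_sextuples K \<rho> \<tau> = {((k1, k2, k3), (k1', k2', k3')).
     {k1, k2, k3, k1', k2', k3'} \<subseteq> {K..<2*K} \<and>
     \<bar>\<rho> + (ln (real k1) - ln (real k2) + ln (real k3))
        - (ln (real k1') - ln (real k2') + ln (real k3'))\<bar> \<le> \<tau>}"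

lemma finite_log_close_sextuples: "finite (log_close_sextuples K \<rho> \<tau>)"
proof (rule finite_subset)
  let ?A = "{K..<2*K}"
  show "log_close_sextuples K \<rho> \<tau> \<subseteq> (?A \<times> ?A \<times> ?A) \<times> (?A \<times> ?A \<times> ?A)"
    by (auto simp: log_close_sextuples_def)
qed auto

text \<open>Clearing denominators, the condition compares a = k1 k3 k2' with b = k1' k3' k2, both at
  most 8K^3. For each b few a are close to it, and each pair (a, b) comes from at most D^2
  sextuples, because these six numbers form one factorization of a and one of b.\<close>

lemma card_log_close_sextuples:
  fixes D :: nat
  assumes K: "K \<ge> 1" and \<tau>: "\<tau> \<ge> 0"
    and D: "\<And>a. a \<in> {1..8 * K ^ 3} \<Longrightarrow> card (triple_factorizations a) \<le> D"
  shows "real (card (log_close_sextuples K \<rho> \<tau>))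
    \<le> 8 * real K ^ 3 * real D ^ 2 * (1 + 16 * real K ^ 3 * \<tau>)"
proof -
  let ?M = "8 * K ^ 3"
  define f :: "(nat \<times> nat \<times> nat) \<times> (nat \<times> nat \<times> nat) \<Rightarrow> nat \<times> nat" where
    "f = (\<lambda>((k1, k2, k3), (k1', k2', k3')). (k1 * k3 * k2', k1' * k3' * k2))"
  define A where "A = (\<lambda>b. {a \<in> {1..?M}. \<bar>\<rho> + ln (real a) - ln (real b)\<bar> \<le> \<tau>})"
  define Y where "Y = (SIGMA b:{1..?M}. A b)"
  have finY: "finite Y" by (auto simp: Y_def A_def)
  have prod_in: "x * y * z \<in> {1..?M}" if "x \<in> {K..<2*K}" "y \<in> {K..<2*K}" "z \<in> {K..<2*K}" for x y z
  proof -
    have "x * y * z \<le> (2*K) * (2*K) * (2*K)" using that by (intro mult_mono) auto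
    moreover have "x \<ge> 1" "y \<ge> 1" "z \<ge> 1" using that K by auto
    ultimately show ?thesis by (simp add: power3_eq_cube Suc_le_eq)
  qed
  have img: "(\<lambda>(a, b). (b, a)) ` f ` log_close_sextuples K \<rho> \<tau> \<subseteq> Y"
  proof (clarify)
    fix a b k1 k2 k3 k1' k2' k3'
    assume "((k1, k2, k3), (k1', k2', k3')) \<in> log_close_sextuples K \<rho> \<tau>"
      "(a, b) = f ((k1, k2, k3), (k1', k2', k3'))"
    then have r: "k1 \<in> {K..<2*K}" "k2 \<in> {K..<2*K}" "k3 \<in> {K..<2*K}"
        "k1' \<in> {K..<2*K}" "k2' \<in> {K..<2*K}" "k3' \<in> {K..<2*K}"
      and l: "\<bar>\<rho> + (ln (real k1) - ln (real k2) + ln (real k3))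
        - (ln (real k1') - ln (real k2') + ln (real k3'))\<bar> \<le> \<tau>"
      and ab: "a = k1 * k3 * k2'" "b = k1' * k3' * k2"
      by (auto simp: log_close_sextuples_def f_def)
    have "real k1 > 0" "real k2 > 0" "real k3 > 0" "real k1' > 0" "real k2' > 0" "real k3' > 0"
      using r K by auto
    then have "ln (real a) = ln (real k1) + ln (real k3) + ln (real k2')"
      "ln (real b) = ln (real k1') + ln (real k3') + ln (real k2)"
      unfolding ab by (simp_all add: ln_mult)
    then have "\<bar>\<rho> + ln (real a) - ln (real b)\<bar> \<le> \<tau>" using l by (simp add: algebra_simps)
    then show "(b, a) \<in> Y"
      using prod_in[of k1 k3 k2'] prod_in[of k1' k3' k2] r unfolding Y_def A_def ab by blast
  qed
  have fib: "card {x \<in> log_close_sextuples K \<rho> \<tau>. (\<lambda>(a, b). (b, a)) (f x) = y} \<le> D ^ 2"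
    if "y \<in> Y" for y
  proof -
    obtain a b where y: "y = (b, a)" by (cases y)
    have ab: "a \<in> {1..?M}" "b \<in> {1..?M}" using that y by (auto simp: Y_def A_def)
    let ?T = "\<lambda>a. (triple_factorizations a) :: (nat \<times> nat \<times> nat) set"
    let ?X = "{x \<in> log_close_sextuples K \<rho> \<tau>. (\<lambda>(a, b). (b, a)) (f x) = y}"
    let ?g = "\<lambda>((k1, k2, k3), (k1', k2', k3')). ((k1, k3, k2'), (k1', k3', k2))"
    have fin: "finite (?T a)" "finite (?T b)" using card_triple_factorizations_le(1) ab by auto
    have "card ?X = card (?g ` ?X)" by (intro card_image [symmetric]) (auto simp: inj_on_def)
    also have "\<dots> \<le> card (?T a \<times> ?T b)"
      using fin by (intro card_mono) (auto simp: f_def y)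
    also have "\<dots> \<le> D * D" using D[OF ab(1)] D[OF ab(2)] by (simp add: card_cartesian_product mult_mono)
    finally show ?thesis by (simp add: power2_eq_square)
  qed
  have "card (log_close_sextuples K \<rho> \<tau>) \<le> D ^ 2 * card Y"
    using img by (intro card_le_fibres[where f = "\<lambda>x. (\<lambda>(a, b). (b, a)) (f x)", OF finY _ fib])
      (simp add: image_image)
  then have c: "real (card (log_close_sextuples K \<rho> \<tau>)) \<le> real D ^ 2 * real (card Y)"
    by (metis of_nat_le_iff of_nat_mult of_nat_power)
  have "real (card Y) = (\<Sum>b\<in>{1..?M}. real (card (A b)))" by (simp add: Y_def A_def)
  also have "\<dots> \<le> (\<Sum>b\<in>{1..?M}. 1 + 2 * real ?M * \<tau>)"
    unfolding A_def using \<tau> by (intro sum_mono card_close_in_ratio)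
  also have "\<dots> = 8 * real K ^ 3 * (1 + 16 * real K ^ 3 * \<tau>)" by simp
  finally have "real D ^ 2 * real (card Y) \<le> real D ^ 2 * (8 * real K ^ 3 * (1 + 16 * real K ^ 3 * \<tau>))"
    by (intro mult_left_mono) auto
  with c show ?thesis by (simp add: mult_ac)
qed

lemma ln_close:
  fixes a b m e :: real
  assumes "a \<ge> m" "b \<ge> m" "m > 0" "\<bar>a - b\<bar> \<le> e"
  shows "\<bar>ln a - ln b\<bar> \<le> e / m"
proof -
  have *: "ln x - ln y \<le> e / m" if "x \<ge> m" "y \<ge> m" "x - y \<le> e" for x y :: real
  proof -
    have "ln x - ln y = ln (x / y)" using that assms by (simp add: ln_div)
    also have "\<dots> \<le> x / y - 1" using that assms by (intro ln_le_minus_one) auto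
    also have "\<dots> = (x - y) / y" using that assms by (simp add: field_simps)
    also have "\<dots> \<le> e / y" using that assms by (intro divide_right_mono) auto
    also have "\<dots> \<le> e / m" using that assms by (intro divide_left_mono) (auto intro: mult_pos_pos)
    finally show ?thesis .
  qed
  show ?thesis using *[of a b] *[of b a] assms by (auto simp: abs_le_iff)
qed

lemma close_of_ln_close:
  fixes a b M \<tau> :: real
  assumes "a > 0" "b > 0" "a \<le> M" "b \<le> M" "\<bar>ln a - ln b\<bar> \<le> \<tau>"
  shows "\<bar>a - b\<bar> \<le> M * \<tau>"
proof -
  have *: "x - y \<le> M * \<tau>" if "x > 0" "y > 0" "x \<le> M" "ln x - ln y \<le> \<tau>" "\<tau> \<ge> 0" for x y :: real
  proof -
    have "y / x = exp (ln y - ln x)" using that by (simp add: exp_diff)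
    also have "\<dots> \<ge> 1 + (ln y - ln x)" by (rule exp_ge_add_one_self)
    finally have "1 - \<tau> \<le> y / x" using that by linarith
    then have "x - y \<le> x * \<tau>" using that by (simp add: field_simps)
    also have "\<dots> \<le> M * \<tau>" using that by (intro mult_right_mono) auto
    finally show ?thesis .
  qed
  show ?thesis using *[of a b] *[of b a] assms by (auto simp: abs_le_iff)
qed

text \<open>In one class, taking logarithms turns dilation by k into translation by ln k with
  control of the distances, so \<open>close_pairs_log_convex\<close> applies. The first term is an
  energy because the logarithmic window, carried back to the gaps, stays below 1. The second runs
  over all pairs of gaps and uses nothing about the gaps beyond their size.\<close>

lemma dyadic_class_bound:
  fixes z :: "'s \<Rightarrow> 'd::finite \<Rightarrow> real" and Z :: "'d \<Rightarrow> real" and K :: "'d \<Rightarrow> nat" and \<theta> \<eta> :: real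
    and D :: nat
  assumes S: "finite S" and \<theta>: "\<theta> > 0" and \<eta>: "\<eta> > 0" "\<eta> < 1 / 4"
    and Z: "\<And>l. Z l > 0" "\<And>s l. s \<in> S \<Longrightarrow> Z l \<le> z s l" "\<And>s l. s \<in> S \<Longrightarrow> z s l \<le> 2 * Z l"
    and K: "\<And>l. K l \<ge> 1"
    and D: "\<And>l a. a \<in> {1..8 * K l ^ 3} \<Longrightarrow> card (triple_factorizations a) \<le> D"
  shows "3 * real (card (close_pairs (\<chi> l. \<eta>) (S \<times> PiE UNIV (\<lambda>l. {K l..<2 * K l}))
        (\<lambda>(s, k). \<chi> l. real (k l) * z s l)))
    \<le> 2 ^ CARD('d) * (2 * \<theta> * card {(s, s'). s \<in> S \<and> s' \<in> S \<and> (\<forall>l. \<bar>z s l - z s' l\<bar> < 1)}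
      + (real (card S))\<^sup>2 * (\<Prod>l\<in>UNIV. 8 * real (K l) ^ 3 * real D ^ 2 * (1 + 32 * \<eta> * real (K l) ^ 2 / Z l)) / \<theta>\<^sup>2)"
proof -
  \<comment> \<open>A product k z is at least K_l Z_l, so the absolute window \<eta> becomes \<eta>
    / (K_l Z_l) for the logarithms; the 2 compensates the halved window in
    \<open>close_pairs_log_convex\<close>.\<close>
  define \<tau> where "\<tau> = (\<chi> l. 2 * \<eta> / (real (K l) * Z l))"
  have \<tau>: "\<tau> $ l > 0" for l
    using \<eta> Z(1)[of l] K[of l] by (simp add: \<tau>_def)
  define KK where "KK = PiE (UNIV :: 'd set) (\<lambda>l. {K l..<2 * K l})"
  have finK: "finite KK" unfolding KK_def by (intro finite_PiE) auto
  have KKD: "K l \<le> k l" "k l < 2 * K l" if "k \<in> KK" for k l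
    using that by (auto simp: KK_def PiE_def Pi_def)
  have KKD2: "k l < K l * 2" if "k \<in> KK" for k l using KKD(2)[OF that, of l] by simp
  define u where "u = (\<lambda>s. \<chi> l. ln (z s l))"
  define v where "v = (\<lambda>k :: 'd \<Rightarrow> nat. \<chi> l. ln (real (k l)))"
  let ?p1 = "\<lambda>(s, k). u s + v k" and ?p3 = "\<lambda>(s, k1, k2, k3). u s + v k1 - v k2 + v k3"
  have sub1: "close_pairs (\<chi> l. \<eta>) (S \<times> KK) (\<lambda>(s, k). \<chi> l. real (k l) * z s l)
      \<subseteq> close_pairs (\<tau> /\<^sub>R 2) (S \<times> KK) ?p1"
  proof
    fix x assume "x \<in> close_pairs (\<chi> l. \<eta>) (S \<times> KK) (\<lambda>(s, k). \<chi> l. real (k l) * z s l)"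
    then obtain s k s' k' where x: "x = ((s, k), (s', k'))"
      and s: "s \<in> S" "s' \<in> S" and k: "k \<in> KK" "k' \<in> KK"
      and cl: "\<forall>l. \<bar>real (k l) * z s l - real (k' l) * z s' l\<bar> \<le> \<eta>"
      by (auto simp: close_pairs_def close_points_def)
    have main: "\<bar>ln (z s l) + ln (real (k l)) - (ln (z s' l) + ln (real (k' l)))\<bar> \<le> \<tau> $ l / 2" for l
    proof -
    have kp: "real (k l) \<ge> real (K l)" "real (k' l) \<ge> real (K l)" "real (K l) > 0"
      using KKD[OF k(1), of l] KKD[OF k(2), of l] K[of l] by auto
    have zp: "z s l \<ge> Z l" "z s' l \<ge> Z l" "Z l > 0" using Z s by auto
    have "\<bar>ln (real (k l) * z s l) - ln (real (k' l) * z s' l)\<bar> \<le> \<eta> / (real (K l) * Z l)"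
      using kp zp cl by (intro ln_close mult_mono) auto
    moreover have "ln (real (k l) * z s l) = ln (real (k l)) + ln (z s l)"
      "ln (real (k' l) * z s' l) = ln (real (k' l)) + ln (z s' l)"
      using kp zp by (auto simp: ln_mult)
    ultimately show ?thesis by (simp add: \<tau>_def add.commute)
    qed
    show "x \<in> close_pairs (\<tau> /\<^sub>R 2) (S \<times> KK) ?p1"
      using s k main by (auto simp: x close_pairs_def close_points_def u_def v_def)
  qed
  \<comment> \<open>Gaps are at most 2 Z_l, so logarithms within \<tau> mean gaps within 4\<eta> /
    K_l, which is less than 1 as \<eta> < 1/4.\<close>
  have sub0: "close_pairs \<tau> S u \<subseteq> {(s, s'). s \<in> S \<and> s' \<in> S \<and> (\<forall>l. \<bar>z s l - z s' l\<bar> < 1)}"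
  proof (clarsimp simp: close_pairs_def close_points_def u_def)
    fix s s' l assume s: "s \<in> S" "s' \<in> S" and cl: "\<forall>l. \<bar>ln (z s l) - ln (z s' l)\<bar> \<le> \<tau> $ l"
    have zp: "z s l \<ge> Z l" "z s' l \<ge> Z l" "Z l > 0" "z s l \<le> 2 * Z l" "z s' l \<le> 2 * Z l"
      using Z s by auto
    have "\<bar>z s l - z s' l\<bar> \<le> 2 * Z l * \<tau> $ l"
      using zp cl by (intro close_of_ln_close) auto
    also have "\<dots> = 4 * \<eta> / real (K l)" using zp by (simp add: \<tau>_def)
    also have "\<dots> \<le> 4 * \<eta>" using K[of l] \<eta> by (simp add: field_simps)
    also have "\<dots> < 1" using \<eta> by simp
    finally show "\<bar>z s l - z s' l\<bar> < 1" .
  qed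
  define LS where "LS = (\<lambda>(s, s'). PiE (UNIV :: 'd set) (\<lambda>l. log_close_sextuples (K l) (ln (z s l) - ln (z s' l)) (\<tau> $ l)))"
  define B where "B = (\<Prod>l\<in>UNIV. 8 * real (K l) ^ 3 * real D ^ 2 * (1 + 32 * \<eta> * real (K l) ^ 2 / Z l))"
  have LSfin: "finite (LS x)" for x
    unfolding LS_def by (cases x) (auto intro!: finite_PiE finite_log_close_sextuples)
  have cLS: "real (card (LS x)) \<le> B" for x
  proof -
    obtain s s' where x: "x = (s, s')" by (cases x)
    have "real (card (LS x)) = (\<Prod>l\<in>UNIV. real (card (log_close_sextuples (K l) (ln (z s l) - ln (z s' l)) (\<tau> $ l))))"
      by (simp add: LS_def x card_PiE)
    also have "\<dots> \<le> B"
      unfolding B_def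
    proof (intro prod_mono conjI)
      fix l
      have "real (card (log_close_sextuples (K l) (ln (z s l) - ln (z s' l)) (\<tau> $ l)))
          \<le> 8 * real (K l) ^ 3 * real D ^ 2 * (1 + 16 * real (K l) ^ 3 * \<tau> $ l)"
        using K D \<tau>[of l] by (intro card_log_close_sextuples) auto
      also have "16 * real (K l) ^ 3 * \<tau> $ l = 32 * \<eta> * real (K l) ^ 2 / Z l"
        using K[of l] Z(1)[of l] by (simp add: \<tau>_def field_simps power3_eq_cube power2_eq_square)
      finally show "real (card (log_close_sextuples (K l) (ln (z s l) - ln (z s' l)) (\<tau> $ l)))
          \<le> 8 * real (K l) ^ 3 * real D ^ 2 * (1 + 32 * \<eta> * real (K l) ^ 2 / Z l)" .
    qed auto
    finally show ?thesis .
  qed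
  define g :: "('s \<times> ('d \<Rightarrow> nat) \<times> ('d \<Rightarrow> nat) \<times> ('d \<Rightarrow> nat)) \<times> ('s \<times> ('d \<Rightarrow> nat) \<times> ('d \<Rightarrow> nat) \<times> ('d \<Rightarrow> nat))
      \<Rightarrow> ('s \<times> 's) \<times> ('d \<Rightarrow> (nat \<times> nat \<times> nat) \<times> (nat \<times> nat \<times> nat))" where
    "g = (\<lambda>((s, k1, k2, k3), (s', k1', k2', k3')). ((s, s'), (\<lambda>l. ((k1 l, k2 l, k3 l), (k1' l, k2' l, k3' l)))))"
  have injg: "inj g" by (auto simp: inj_def g_def fun_eq_iff)
  \<comment> \<open>Once the two gap vectors are fixed, the coordinates decouple: transposing three
    frequency vectors into one triple per coordinate gives a product of sextuple counts.\<close>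
  have "g ` close_pairs \<tau> (S \<times> KK \<times> KK \<times> KK) ?p3 \<subseteq> (SIGMA x:S \<times> S. LS x)"
    by (auto simp: g_def close_pairs_def close_points_def LS_def log_close_sextuples_def PiE_def
        extensional_def u_def v_def KKD KKD2 algebra_simps)
  then have "card (g ` close_pairs \<tau> (S \<times> KK \<times> KK \<times> KK) ?p3) \<le> card (SIGMA x:S \<times> S. LS x)"
    using S LSfin by (intro card_mono) auto
  then have "real (card (close_pairs \<tau> (S \<times> KK \<times> KK \<times> KK) ?p3)) \<le> real (card (SIGMA x:S \<times> S. LS x))"
    by (simp add: card_image[OF inj_on_subset[OF injg]])
  also have "\<dots> = (\<Sum>x\<in>S \<times> S. real (card (LS x)))" using S LSfin by simp
  also have "\<dots> \<le> (\<Sum>x\<in>S \<times> S. B)" using cLS by (intro sum_mono)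
  also have "\<dots> = (real (card S))\<^sup>2 * B" by (simp add: card_cartesian_product power2_eq_square)
  finally have c3: "real (card (close_pairs \<tau> (S \<times> KK \<times> KK \<times> KK) ?p3)) \<le> (real (card S))\<^sup>2 * B" .
  have finE: "finite {(s, s'). s \<in> S \<and> s' \<in> S \<and> (\<forall>l. \<bar>z s l - z s' l\<bar> < 1)}"
    by (rule finite_subset[of _ "S \<times> S"]) (use S in auto)
  have "3 * real (card (close_pairs (\<chi> l. \<eta>) (S \<times> KK) (\<lambda>(s, k). \<chi> l. real (k l) * z s l)))
      \<le> 3 * real (card (close_pairs (\<tau> /\<^sub>R 2) (S \<times> KK) ?p1))"
    using card_mono[OF _ sub1] S finK by auto
  also have "\<dots> \<le> 2 ^ CARD('d) * (2 * \<theta> * card (close_pairs \<tau> S u)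
      + card (close_pairs \<tau> (S \<times> KK \<times> KK \<times> KK) ?p3) / \<theta>\<^sup>2)"
    by (rule close_pairs_log_convex[OF S finK \<theta> \<tau>])
  also have "\<dots> \<le> 2 ^ CARD('d) * (2 * \<theta> * card {(s, s'). s \<in> S \<and> s' \<in> S \<and> (\<forall>l. \<bar>z s l - z s' l\<bar> < 1)}
      + (real (card S))\<^sup>2 * B / \<theta>\<^sup>2)"
    using card_mono[OF finE sub0] c3 \<theta> by (intro mult_left_mono add_mono divide_right_mono) auto
  finally show ?thesis unfolding KK_def B_def .
qed

section \<open>Counting over all dyadic classes\<close>

lemma close_pairs_mono: "I \<subseteq> J \<Longrightarrow> close_pairs t I p \<subseteq> close_pairs t J p"
  by (auto simp: close_pairs_def)

lemma sum_card_same_colour_le: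
  assumes "finite X"
  shows "(\<Sum>c\<in>C. card {(s, s'). (s, s') \<in> X \<and> g s = c \<and> g s' = c}) \<le> card X"
proof (cases "finite C")
  case True
  have "(\<Sum>c\<in>C. card {(s, s'). (s, s') \<in> X \<and> g s = c \<and> g s' = c})
      = card (\<Union>c\<in>C. {(s, s'). (s, s') \<in> X \<and> g s = c \<and> g s' = c})"
    using True by (intro card_UN_disjoint [symmetric] ballI impI finite_subset[OF _ assms]) auto
  also have "\<dots> \<le> card X" by (intro card_mono assms) auto
  finally show ?thesis .
qed simp

text \<open>Integer valued, since a gap is bounded below only by c and may be smaller than
  1.\<close>

definition dyad :: "real \<Rightarrow> int" where "dyad y = \<lfloor>log 2 y\<rfloor>"

lemma dyad_bounds:
  assumes "y > 0"
  shows "2 powr dyad y \<le> y" "y < 2 * 2 powr dyad y"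
proof -
  have "real_of_int (dyad y) \<le> log 2 y" "log 2 y < real_of_int (dyad y) + 1"
    unfolding dyad_def by linarith+
  then have "2 powr dyad y \<le> 2 powr log 2 y" "2 powr log 2 y < 2 powr (dyad y + 1)" by auto
  then show "2 powr dyad y \<le> y" "y < 2 * 2 powr dyad y" using assms by (auto simp: powr_add)
qed

lemma dyad_mono: "0 < y \<Longrightarrow> y \<le> y' \<Longrightarrow> dyad y \<le> dyad y'"
  unfolding dyad_def by (intro floor_mono) simp

lemma dyad_mult_bounds:
  assumes "x > 0" "y > 0"
  shows "dyad x + dyad y \<le> dyad (x * y)" "dyad (x * y) \<le> dyad x + dyad y + 1"
  using assms by (simp_all add: dyad_def log_mult) linarith+

lemma dyad_double: "y > 0 \<Longrightarrow> dyad (2 * y) = dyad y + 1"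
  by (simp add: dyad_def log_mult)

lemma dyad_nonneg: "y \<ge> 1 \<Longrightarrow> dyad y \<ge> 0"
  by (simp add: dyad_def)

lemma dyad_nat_bounds:
  assumes "k \<ge> (1::nat)"
  shows "2 ^ nat (dyad k) \<le> k" "k < 2 * 2 ^ nat (dyad k)"
proof -
  have "2 powr dyad k = 2 ^ nat (dyad k)"
    using dyad_nonneg[of k] assms by (simp add: powr_real_of_int)
  then have "real (2 ^ nat (dyad k)) \<le> real k" "real k < real (2 * 2 ^ nat (dyad k))"
    using dyad_bounds[of k] assms by simp_all
  then show "2 ^ nat (dyad k) \<le> k" "k < 2 * 2 ^ nat (dyad k)" by linarith+
qed

section \<open>Gaps of the sequence and their dyadic classes\<close>

lemma separated_difference:
  fixes x :: "nat \<Rightarrow> real^'d"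
  assumes sep: "\<And>l n. n \<ge> 1 \<Longrightarrow> x (n + 1) $ l - x n $ l \<ge> c" and "1 \<le> m" "m \<le> n"
  shows "x n $ l - x m $ l \<ge> c * real (n - m)"
  using assms(3)
proof (induction n rule: dec_induct)
  case (step n)
  then show ?case using sep[of n l] assms(2) by (simp add: Suc_diff_le algebra_simps)
qed simp

text \<open>Only m < n is kept, so that every gap is positive and has a logarithm; a factor 2
  restores the other order later.\<close>

definition index_pairs :: "nat \<Rightarrow> (nat \<times> nat) set" where
  "index_pairs N = {(m, n). 1 \<le> m \<and> m < n \<and> n \<le> N}"

lemma finite_index_pairs [simp]: "finite (index_pairs N)"
  by (rule finite_subset[of _ "{1..N} \<times> {1..N}"]) (auto simp: index_pairs_def)

text \<open>Coordinates outside \<open>D'\<close> are frozen: there the gap and the frequency are both \<open>1\<close>, so that all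
  products may run over the whole index type.\<close>

definition gap_vec :: "(nat \<Rightarrow> real^'d) \<Rightarrow> 'd set \<Rightarrow> nat \<times> nat \<Rightarrow> 'd \<Rightarrow> real" where
  "gap_vec x D' = (\<lambda>(m, n) l. if l \<in> D' then x n $ l - x m $ l else 1)"

definition freq_box :: "'d set \<Rightarrow> nat \<Rightarrow> ('d \<Rightarrow> nat) set" where
  "freq_box D' K = PiE UNIV (\<lambda>l. if l \<in> D' then {1..K} else {1})"

text \<open>The halved window is the one on the left of
  \<open>close_pairs_le_colour_classes\<close>; its right side then has the window
  \<open>\<eta>\<close> of \<open>dyadic_class_bound\<close>.\<close>

abbreviation gap_collisions ::
    "real \<Rightarrow> (nat \<Rightarrow> real^'d) \<Rightarrow> 'd::finite set \<Rightarrow> nat \<Rightarrow> nat \<Rightarrow> (((nat \<times> nat) \<times> ('d \<Rightarrow> nat)) \<times> ((nat \<times> nat) \<times> ('d \<Rightarrow> nat))) set" where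
  "gap_collisions \<eta> x D' N K \<equiv> close_pairs ((\<chi> l. \<eta>) /\<^sub>R 2) (index_pairs N \<times> freq_box D' K)
     (\<lambda>(s, k). \<chi> l. real (k l) * gap_vec x D' s l)"

lemma finite_freq_box [simp]: "finite (freq_box (D' :: 'd::finite set) K)"
  unfolding freq_box_def by (intro finite_PiE) auto

lemma card_index_pairs_dyadic:
  assumes "h \<ge> 0"
  shows "real (card {s \<in> index_pairs N. dyad (real (snd s - fst s)) = h}) \<le> 2 * real N * 2 ^ nat h"
proof -
  let ?A = "{s \<in> index_pairs N. dyad (real (snd s - fst s)) = h}"
  have "(\<lambda>(m, n). (m, n - m)) ` ?A \<subseteq> {1..N} \<times> {1..2 * 2 ^ nat h}"
  proof clarsimp
    fix m n assume a: "(m, n) \<in> index_pairs N" "h = dyad (real (n - m))"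
    then have mn: "m \<ge> 1" "m < n" "n \<le> N" by (auto simp: index_pairs_def)
    then show "Suc 0 \<le> m \<and> m \<le> N \<and> Suc 0 \<le> n - m \<and> n - m \<le> 2 * 2 ^ nat (dyad (real (n - m)))"
      using less_imp_le[OF dyad_nat_bounds(2)[of "n - m"]] by (simp del: of_nat_diff)
  qed
  moreover have "inj_on (\<lambda>(m, n). (m, n - m)) ?A" by (auto simp: inj_on_def index_pairs_def)
  ultimately have "card ?A \<le> card ({1..N} \<times> {1..2 * 2 ^ nat h :: nat})"
    by (intro card_inj_on_le) auto
  then have "card ?A \<le> N * (2 * 2 ^ nat h)" by (simp add: card_cartesian_product)
  then have "real (card ?A) \<le> real (N * (2 * 2 ^ nat h))" by (simp only: of_nat_le_iff)
  then show ?thesis by (simp add: mult_ac)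
qed

lemma card_close_gaps_le_energy:
  fixes x :: "nat \<Rightarrow> real^'d"
  shows "card {(s, s'). s \<in> index_pairs N \<and> s' \<in> index_pairs N \<and>
      (\<forall>l. \<bar>gap_vec x D' s l - gap_vec x D' s' l\<bar> < 1)} \<le> joint_additive_energy x D' N"
    (is "card ?X \<le> _")
proof -
  define E where "E = {(n1, n2, n3, n4).
       n1 \<in> {1..N} \<and> n2 \<in> {1..N} \<and> n3 \<in> {1..N} \<and> n4 \<in> {1..N} \<and>
       (\<forall>l\<in>D'. \<bar>x n1 $ l + x n2 $ l - x n3 $ l - x n4 $ l\<bar> < 1)}"
  have "finite E"
    by (rule finite_subset[of _ "{1..N} \<times> {1..N} \<times> {1..N} \<times> {1..N}"]) (auto simp: E_def)
  moreover have "(\<lambda>((m, n), (m', n')). (n, m', m, n')) ` ?X \<subseteq> E"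
    by (auto simp: E_def index_pairs_def gap_vec_def algebra_simps split: if_splits)
  moreover have "inj_on (\<lambda>((m, n), (m', n')). (n, m', m, n')) ?X" by (auto simp: inj_on_def)
  ultimately show ?thesis unfolding joint_additive_energy_def E_def by (metis (no_types, lifting) card_inj_on_le)
qed

text \<open>All products near y have comparable size, so the sum of the two scales \<kappa> and j is
  confined to four integers in each coordinate. Since \<kappa> and this sum determine j, the number
  of colours is controlled although j itself ranges over an unbounded set.\<close>

lemma card_dyadic_colours:
  fixes p :: "'i \<Rightarrow> 'd::finite \<Rightarrow> real" and \<kappa> j :: "'i \<Rightarrow> 'd \<Rightarrow> int" and h :: "'i \<Rightarrow> int"
  assumes A: "finite A" and m: "m > 0" and \<eta>: "8 * \<eta> \<le> m"
    and p: "\<And>i l. i \<in> A \<Longrightarrow> p i l \<ge> m" "\<And>i l. i \<in> A \<Longrightarrow> \<bar>y l - p i l\<bar> \<le> \<eta>"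
    and \<kappa>: "\<And>i l. i \<in> A \<Longrightarrow> \<kappa> i l \<in> {0..int \<Lambda>}"
    and h: "\<And>i. i \<in> A \<Longrightarrow> h i \<in> {0..int \<Lambda>'}"
    and j: "\<And>i l. i \<in> A \<Longrightarrow> \<kappa> i l + j i l \<le> dyad (p i l) \<and> dyad (p i l) \<le> \<kappa> i l + j i l + 1"
  shows "card ((\<lambda>i. (\<kappa> i, h i, j i)) ` A) \<le> (4 * (\<Lambda> + 1)) ^ CARD('d) * (\<Lambda>' + 1)"
proof (cases "A = {}")
  case False
  then obtain i0 where i0: "i0 \<in> A" by blast
  define q where "q l = dyad (p i0 l)" for l
  have q: "dyad (p i l) \<in> {q l - 1..q l + 1}" if "i \<in> A" for i l
  proof -
    have b: "p i l \<ge> m" "p i0 l \<ge> m" "\<bar>y l - p i l\<bar> \<le> \<eta>" "\<bar>y l - p i0 l\<bar> \<le> \<eta>" using p that i0 by auto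
    then have "p i l \<le> 2 * p i0 l" "p i0 l \<le> 2 * p i l" using \<eta> by linarith+
    then have "dyad (p i l) \<le> dyad (2 * p i0 l)" "dyad (p i0 l) \<le> dyad (2 * p i l)"
      using b m by (auto intro!: dyad_mono)
    then show ?thesis using b m by (simp add: dyad_double q_def)
  qed
  \<comment> \<open>The scale of a product near y is within 1 of \<open>q l\<close>, and it exceeds
    the sum of the scales of its factors by 0 or 1: hence the window from q - 2 to q + 1.\<close>
  define T where "T = PiE (UNIV :: 'd set) (\<lambda>_. {0..int \<Lambda>}) \<times> {0..int \<Lambda>'} \<times> PiE (UNIV :: 'd set) (\<lambda>l. {q l - 2..q l + 1})"
  let ?g = "\<lambda>(k, h :: int, j). (k, h, \<lambda>l. k l + j l :: int)"
  have "?g ` (\<lambda>i. (\<kappa> i, h i, j i)) ` A \<subseteq> T"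
  proof clarsimp
    fix i assume i: "i \<in> A"
    have "\<kappa> i l + j i l \<in> {q l - 2..q l + 1}" for l using q[OF i, of l] j[OF i, of l] by auto
    then show "(\<kappa> i, h i, \<lambda>l. \<kappa> i l + j i l) \<in> T" using \<kappa>[OF i] h[OF i] by (auto simp: T_def)
  qed
  moreover have "finite T" unfolding T_def by (intro finite_cartesian_product finite_PiE) auto
  moreover have "inj_on ?g ((\<lambda>i. (\<kappa> i, h i, j i)) ` A)"
  proof (rule inj_onI)
    fix a b assume eq: "?g a = ?g b"
    obtain k h1 j1 k' h2 j2 where ab: "a = (k, h1, j1)" "b = (k', h2, j2)" by (cases a, cases b)
    have "k = k'" "h1 = h2" "\<And>l. k l + j1 l = k' l + j2 l" using eq by (auto simp: ab dest: fun_cong)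
    then show "a = b" by (auto simp: ab)
  qed
  ultimately have "card ((\<lambda>i. (\<kappa> i, h i, j i)) ` A) \<le> card T"
    by (intro card_inj_on_le[where f = ?g])
  also have "card T = (\<Lambda> + 1) ^ CARD('d) * ((\<Lambda>' + 1) * 4 ^ CARD('d))"
    by (simp add: T_def card_cartesian_product card_PiE nat_add_distrib)
  also have "\<dots> = (4 * (\<Lambda> + 1)) ^ CARD('d) * (\<Lambda>' + 1)"
    unfolding power_mult_distrib by (metis mult.assoc mult.commute)
  finally show ?thesis .
qed simp

text \<open>Colours every pair (gap, frequency) by its dyadic classes, applies
  \<open>dyadic_class_bound\<close> to each colour and adds up. The first terms add up to at most
  the full energy; the second are summed by index scale h, with \<open>W\<close> as a common bound
  for the contribution of one scale.\<close>

lemma dilated_gap_count: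
  fixes x :: "nat \<Rightarrow> real^'d" and D' :: "'d set" and \<theta> \<eta> W c :: real
  assumes c: "c > 0" and sep: "\<And>l n. n \<ge> 1 \<Longrightarrow> x (n + 1) $ l - x n $ l \<ge> c"
    and \<eta>: "\<eta> > 0" "8 * \<eta> \<le> c" "8 * \<eta> \<le> 1" and N: "N \<ge> 1" and K: "K \<ge> 1" and \<theta>: "\<theta> > 0"
    and Dv: "\<And>a. a \<in> {1..8 * K ^ 3} \<Longrightarrow> card (triple_factorizations a) \<le> Dv"
    and \<Lambda>: "dyad (real K) \<le> int \<Lambda>" "dyad (real N) \<le> int \<Lambda>'"
    and W: "\<And>h :: nat. 2 ^ h \<le> N \<Longrightarrow> (2 * real N * 2 ^ h)\<^sup>2 *
        (\<Prod>l\<in>UNIV. if l \<in> D' then 8 * real K ^ 3 * real Dv ^ 2 * (1 + 8 * real K ^ 2 / 2 ^ h) else 40 * real Dv ^ 2) \<le> W"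
  shows "real (card (gap_collisions \<eta> x D' N K))
    \<le> (16 * (real \<Lambda> + 1)\<^sup>2) ^ CARD('d) * (real \<Lambda>' + 1) *
        (2 * \<theta> * joint_additive_energy x D' N + (real \<Lambda>' + 1) * W / \<theta>\<^sup>2)"
proof -
  let ?S = "index_pairs N" and ?z = "gap_vec x D'"
  define I where "I = ?S \<times> freq_box D' K"
  define p where "p = (\<lambda>(s, k). \<chi> l. real (k l) * ?z s l)"
  have finI: "finite I" by (simp add: I_def)
  \<comment> \<open>The index distance is recorded besides the sizes of the gaps: it bounds the
    number of index pairs from above and, through the separation c, the gaps from below. A large gap
    alone says nothing about the index distance from below.\<close>
  define hh where "hh = (\<lambda>s :: nat \<times> nat. dyad (real (snd s - fst s)))"
  define jj where "jj = (\<lambda>s l. dyad (?z s l))"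
  define kk where "kk = (\<lambda>(k :: 'd \<Rightarrow> nat) l. dyad (real (k l)))"
  define col where "col = (\<lambda>(s, k). (kk k, hh s, jj s))"
  define c0 where "c0 = min c 1"
  have c0: "c0 > 0" using c by (simp add: c0_def)
  have gap: "?z s l \<ge> c * real (snd s - fst s)" if "s \<in> ?S" "l \<in> D'" for s l
    using that separated_difference[where x = x and c = c and m = "fst s" and n = "snd s" and l = l] sep
    by (auto simp: gap_vec_def index_pairs_def)
  have zc: "?z s l \<ge> c0" if "s \<in> ?S" for s l
  proof (cases "l \<in> D'")
    case True
    have "real (snd s - fst s) \<ge> 1" using that by (auto simp: index_pairs_def)
    then have "c * 1 \<le> c * real (snd s - fst s)" using c by (intro mult_left_mono) auto
    then show ?thesis using gap[OF that True] by (simp add: c0_def)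
  qed (auto simp: gap_vec_def c0_def split: prod.splits)
  have kb: "1 \<le> k l" "k l \<le> K" "l \<notin> D' \<Longrightarrow> k l = 1" if "k \<in> freq_box D' K" for k l
    using that K unfolding freq_box_def PiE_def Pi_def by (auto dest!: spec[of _ l] split: if_splits)
  have kk0: "kk k l \<in> {0..int \<Lambda>}" if "k \<in> freq_box D' K" for k l
    using kb[OF that, of l] dyad_nonneg[of "real (k l)"] dyad_mono[of "real (k l)" "real K"] \<Lambda>
    by (auto simp: kk_def)
  have hh0: "hh s \<in> {0..int \<Lambda>'}" if "s \<in> ?S" for s
  proof -
    have "1 \<le> real (snd s - fst s)" "real (snd s - fst s) \<le> real N" using that by (auto simp: index_pairs_def)
    then show ?thesis
      using dyad_nonneg[of "real (snd s - fst s)"]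
        order_trans[OF dyad_mono[of "real (snd s - fst s)" "real N"] \<Lambda>(2)]
      unfolding hh_def by (metis atLeastAtMost_iff less_le_trans zero_less_one)
  qed
  define L where "L = (4 * (\<Lambda> + 1)) ^ CARD('d) * (\<Lambda>' + 1)"
  have L: "real (card (col ` {i \<in> I. close_points (\<chi> l. \<eta>) y (p i)})) \<le> real L" for y
  proof -
    let ?A = "{i \<in> I. close_points (\<chi> l. \<eta>) y (p i)}"
    have "card ((\<lambda>i. (kk (snd i), hh (fst i), jj (fst i))) ` ?A) \<le> L"
      unfolding L_def
    proof (rule card_dyadic_colours[where p = "\<lambda>i l. p i $ l" and y = "\<lambda>l. y $ l" and \<eta> = \<eta> and m = c0])
      show "finite ?A" using finI by simp
      show "8 * \<eta> \<le> c0" using \<eta> by (simp add: c0_def)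
      fix i l assume i: "i \<in> ?A"
      then obtain s k where sk: "i = (s, k)" "s \<in> ?S" "k \<in> freq_box D' K" by (auto simp: I_def)
      have "1 * c0 \<le> real (k l) * ?z s l"
        using kb[OF sk(3), of l] zc[OF sk(2), of l] c0 by (intro mult_mono) auto
      then show "c0 \<le> p i $ l" by (simp add: p_def sk)
      show "\<bar>y $ l - p i $ l\<bar> \<le> \<eta>" using i by (auto simp: close_points_def)
      show "kk (snd i) l \<in> {0..int \<Lambda>}" using kk0 sk by simp
      show "kk (snd i) l + jj (fst i) l \<le> dyad (p i $ l) \<and> dyad (p i $ l) \<le> kk (snd i) l + jj (fst i) l + 1"
        using dyad_mult_bounds[of "real (k l)" "?z s l"] kb[OF sk(3), of l] zc[OF sk(2), of l] c0
        by (auto simp: sk p_def kk_def jj_def)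
    next
      fix i assume "i \<in> ?A"
      then show "hh (fst i) \<in> {0..int \<Lambda>'}" using hh0 by (auto simp: I_def)
    qed (rule c0)
    then show ?thesis by (simp add: col_def case_prod_unfold)
  qed
  define g where "g = (\<lambda>s. (hh s, jj s))"
  define E where "E = {(s, s'). s \<in> ?S \<and> s' \<in> ?S \<and> (\<forall>l. \<bar>?z s l - ?z s' l\<bar> < 1)}"
  have finE: "finite E" by (rule finite_subset[of _ "?S \<times> ?S"]) (auto simp: E_def)
  define Sc where "Sc c = {s \<in> ?S. g s = c}" for c
  define e where "e c = card {(s, s'). (s, s') \<in> E \<and> g s = c \<and> g s' = c}" for c
  \<comment> \<open>A bound for the product in \<open>dyadic_class_bound\<close> that depends on the
    colour through h only. In a frozen coordinate K_l = Z_l = 1, and 8 (1 + 32\<eta>) \<le> 40 as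
    8\<eta> \<le> 1.\<close>
  define B where "B h = (\<Prod>l\<in>UNIV. if l \<in> D' then 8 * real K ^ 3 * real Dv ^ 2 * (1 + 8 * real K ^ 2 / 2 ^ nat h) else 40 * real Dv ^ 2)" for h :: int
  have B0: "B h \<ge> 0" for h unfolding B_def by (intro prod_nonneg) auto
  define F where "F c = 2 ^ CARD('d) * (2 * \<theta> * real (e c) + (real (card (Sc c)))\<^sup>2 * B (fst c) / \<theta>\<^sup>2)" for c
  have F0: "F c \<ge> 0" for c unfolding F_def using \<theta> B0 by auto
  define KS where "KS = PiE (UNIV :: 'd set) (\<lambda>_. {0..int \<Lambda>})"
  have finKS: "finite KS" unfolding KS_def by (intro finite_PiE) auto
  have cls: "real (card (close_pairs (\<chi> l. \<eta>) {i \<in> I. col i = (\<kappa>, cl)} p)) \<le> F cl"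
    if mem: "(\<kappa>, cl) \<in> col ` I" for \<kappa> cl
  proof -
    obtain s0 k0 where s0: "s0 \<in> ?S" "k0 \<in> freq_box D' K" and \<kappa>: "\<kappa> = kk k0" and cc: "cl = g s0"
      using mem by (auto simp: I_def col_def g_def)
    define Z where "Z = (\<lambda>l. 2 powr jj s0 l)"
    define Kl where "Kl = (\<lambda>l. 2 ^ nat (\<kappa> l) :: nat)"
    have KlK: "Kl l \<le> K" for l
      using dyad_nat_bounds(1)[of "k0 l"] kb[OF s0(2), of l] by (simp add: Kl_def \<kappa> kk_def)
    have Zb: "Z l \<le> ?z s l" "?z s l \<le> 2 * Z l" if "s \<in> Sc cl" for s l
    proof -
      have "s \<in> ?S" "jj s = jj s0" using that by (auto simp: Sc_def cc g_def)
      then have "Z l = 2 powr dyad (?z s l)" "?z s l > 0" using zc[of s l] c0 by (auto simp: Z_def jj_def fun_eq_iff)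
      then show "Z l \<le> ?z s l" "?z s l \<le> 2 * Z l" using dyad_bounds[of "?z s l"] by auto
    qed
    have sub: "close_pairs (\<chi> l. \<eta>) {i \<in> I. col i = (\<kappa>, cl)} p
        \<subseteq> close_pairs (\<chi> l. \<eta>) (Sc cl \<times> PiE UNIV (\<lambda>l. {Kl l..<2 * Kl l})) (\<lambda>(s, k). \<chi> l. real (k l) * ?z s l)"
    proof -
      have "{i \<in> I. col i = (\<kappa>, cl)} \<subseteq> Sc cl \<times> PiE UNIV (\<lambda>l. {Kl l..<2 * Kl l})"
      proof
        fix i assume "i \<in> {i \<in> I. col i = (\<kappa>, cl)}"
        moreover obtain s k where i: "i = (s, k)" by (cases i)
        ultimately have "s \<in> ?S" "k \<in> freq_box D' K" "kk k = \<kappa>" "g s = cl" by (auto simp: I_def col_def g_def)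
        moreover from this have "Kl l \<le> k l" "k l < 2 * Kl l" for l
          using dyad_nat_bounds[of "k l"] kb[of k l] by (auto simp: Kl_def kk_def)
        ultimately show "i \<in> Sc cl \<times> PiE UNIV (\<lambda>l. {Kl l..<2 * Kl l})"
          unfolding i Sc_def by auto
      qed
      then show ?thesis unfolding p_def by (rule close_pairs_mono)
    qed
    have "finite (close_pairs (\<chi> l. \<eta>) (Sc cl \<times> PiE UNIV (\<lambda>l. {Kl l..<2 * Kl l})) (\<lambda>(s, k). \<chi> l. real (k l) * ?z s l))"
      by (intro finite_close_pairs finite_cartesian_product finite_PiE) (auto simp: Sc_def)
    from card_mono[OF this sub]
    have "3 * real (card (close_pairs (\<chi> l. \<eta>) {i \<in> I. col i = (\<kappa>, cl)} p))
        \<le> 3 * real (card (close_pairs (\<chi> l. \<eta>) (Sc cl \<times> PiE UNIV (\<lambda>l. {Kl l..<2 * Kl l})) (\<lambda>(s, k). \<chi> l. real (k l) * ?z s l)))"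
      by simp
    also have "\<dots> \<le> 2 ^ CARD('d) * (2 * \<theta> * card {(s, s'). s \<in> Sc cl \<and> s' \<in> Sc cl \<and> (\<forall>l. \<bar>?z s l - ?z s' l\<bar> < 1)}
      + (real (card (Sc cl)))\<^sup>2 * (\<Prod>l\<in>UNIV. 8 * real (Kl l) ^ 3 * real Dv ^ 2 * (1 + 32 * \<eta> * real (Kl l) ^ 2 / Z l)) / \<theta>\<^sup>2)"
    proof (rule dyadic_class_bound)
      show "finite (Sc cl)" by (simp add: Sc_def)
      show "\<eta> < 1 / 4" using \<eta> by simp
      show "card (triple_factorizations a) \<le> Dv" if "a \<in> {1..8 * Kl l ^ 3}" for l a
      proof (rule Dv)
        have "8 * Kl l ^ 3 \<le> 8 * K ^ 3" using power_mono[OF KlK[of l], of 3] by linarith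
        then show "a \<in> {1..8 * K ^ 3}" using that by (meson atLeastAtMost_iff order_trans)
      qed
      show "1 \<le> Kl l" for l by (simp add: Kl_def)
      show "Z l > 0" for l by (simp add: Z_def)
    qed (fact Zb \<theta> \<eta>)+
    also have "{(s, s'). s \<in> Sc cl \<and> s' \<in> Sc cl \<and> (\<forall>l. \<bar>?z s l - ?z s' l\<bar> < 1)}
        = {(s, s'). (s, s') \<in> E \<and> g s = cl \<and> g s' = cl}" by (auto simp: Sc_def E_def)
    also have "2 ^ CARD('d) * (2 * \<theta> * card {(s, s'). (s, s') \<in> E \<and> g s = cl \<and> g s' = cl}
      + (real (card (Sc cl)))\<^sup>2 * (\<Prod>l\<in>UNIV. 8 * real (Kl l) ^ 3 * real Dv ^ 2 * (1 + 32 * \<eta> * real (Kl l) ^ 2 / Z l)) / \<theta>\<^sup>2)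
      \<le> F cl"
      unfolding F_def e_def
    proof (intro mult_left_mono add_mono divide_right_mono order_refl)
      show "(\<Prod>l\<in>UNIV. 8 * real (Kl l) ^ 3 * real Dv ^ 2 * (1 + 32 * \<eta> * real (Kl l) ^ 2 / Z l)) \<le> B (fst cl)"
        unfolding B_def
      proof (intro prod_mono conjI)
        fix l
        have Z0: "Z l > 0" by (simp add: Z_def)
        show "0 \<le> 8 * real (Kl l) ^ 3 * real Dv ^ 2 * (1 + 32 * \<eta> * real (Kl l) ^ 2 / Z l)"
          using \<eta> Z0 by (intro mult_nonneg_nonneg add_nonneg_nonneg) auto
        show "8 * real (Kl l) ^ 3 * real Dv ^ 2 * (1 + 32 * \<eta> * real (Kl l) ^ 2 / Z l)
          \<le> (if l \<in> D' then 8 * real K ^ 3 * real Dv ^ 2 * (1 + 8 * real K ^ 2 / 2 ^ nat (fst cl)) else 40 * real Dv ^ 2)"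
        proof (cases "l \<in> D'")
          case True
          have hc: "fst cl = hh s0" by (simp add: cc g_def)
          define H where "H = (2::real) ^ nat (fst cl)"
          have s0': "snd s0 - fst s0 \<ge> 1" using s0 by (auto simp: index_pairs_def)
          have "real (2 ^ nat (hh s0)) \<le> real (snd s0 - fst s0)"
            using dyad_nat_bounds(1)[OF s0'] unfolding hh_def of_nat_le_iff .
          then have "H \<le> real (snd s0 - fst s0)" by (simp add: H_def hc)
          then have "c * H \<le> c * real (snd s0 - fst s0)" using c by (intro mult_left_mono) auto
          also have "\<dots> \<le> 2 * Z l"
            using gap[OF s0(1) True] Zb(2)[of s0 l] s0(1) by (simp add: Sc_def cc)
          finally have cH: "c * H \<le> 2 * Z l" .
          \<comment> \<open>Here 8\<eta> \<le> c is used: the window is proportional to the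
            separation, so c cancels and 32\<eta> / Z_l \<le> 8 / H.\<close>
          have "8 * \<eta> * H \<le> c * H" using \<eta>(2) by (rule mult_right_mono) (simp add: H_def)
          then have "8 * \<eta> * H \<le> 2 * Z l" using cH by linarith
          moreover have "H > 0" by (simp add: H_def)
          ultimately have "32 * \<eta> / Z l \<le> 8 / H" using Z0 by (simp add: field_simps)
          then have "32 * \<eta> / Z l * real (Kl l) ^ 2 \<le> 8 / H * real K ^ 2"
            using KlK[of l] \<eta> Z0 by (intro mult_mono power_mono) (auto simp: H_def)
          then have "1 + 32 * \<eta> * real (Kl l) ^ 2 / Z l \<le> 1 + 8 * real K ^ 2 / H" by (simp add: mult_ac)
          moreover have "8 * real (Kl l) ^ 3 * real Dv ^ 2 \<le> 8 * real K ^ 3 * real Dv ^ 2"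
            using KlK[of l] by (intro mult_right_mono mult_left_mono power_mono) auto
          ultimately have "8 * real (Kl l) ^ 3 * real Dv ^ 2 * (1 + 32 * \<eta> * real (Kl l) ^ 2 / Z l)
              \<le> 8 * real K ^ 3 * real Dv ^ 2 * (1 + 8 * real K ^ 2 / H)"
            using \<eta> Z0 KlK[of l] by (intro mult_mono) auto
          then show ?thesis using True by (simp add: H_def)
        next
          case False
          have "?z s0 l = 1" using False by (simp add: gap_vec_def case_prod_unfold)
          then have Z1: "Z l = 1" by (simp add: Z_def jj_def dyad_def)
          have K1: "Kl l = 1" using kb(3)[OF s0(2) False] by (simp add: Kl_def \<kappa> kk_def dyad_def)
          have "8 * real Dv ^ 2 * (1 + 32 * \<eta>) \<le> 8 * real Dv ^ 2 * 5"
            using \<eta> by (intro mult_left_mono) auto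
          then show ?thesis using False by (simp add: Z1 K1)
        qed
      qed
    qed (use \<theta> in auto)
    finally show ?thesis using F0[of cl] by linarith
  qed
  have Fsum: "(\<Sum>c\<in>g ` ?S. F c) \<le> 2 ^ CARD('d) * (2 * \<theta> * joint_additive_energy x D' N + (real \<Lambda>' + 1) * W / \<theta>\<^sup>2)"
  proof -
    have "(\<Sum>c\<in>g ` ?S. e c) \<le> card E" unfolding e_def by (rule sum_card_same_colour_le[OF finE])
    also have "\<dots> \<le> joint_additive_energy x D' N" unfolding E_def by (rule card_close_gaps_le_energy)
    finally have "real (\<Sum>c\<in>g ` ?S. e c) \<le> real (joint_additive_energy x D' N)"
      by (simp only: of_nat_le_iff)
    then have s1: "(\<Sum>c\<in>g ` ?S. real (e c)) \<le> joint_additive_energy x D' N"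
      by (simp only: of_nat_sum)
    \<comment> \<open>Grouping by index scale: inside one scale the squares of the class sizes add
      up to at most the square of the number of index pairs at that scale, however many gap classes
      there are.\<close>
    have "(\<Sum>c\<in>g ` ?S. (real (card (Sc c)))\<^sup>2 * B (fst c))
        = (\<Sum>h\<in>{0..int \<Lambda>'}. \<Sum>c\<in>{c \<in> g ` ?S. fst c = h}. (real (card (Sc c)))\<^sup>2 * B (fst c))"
      using hh0 by (intro sum.group [symmetric]) (auto simp: g_def)
    also have "\<dots> \<le> (\<Sum>h\<in>{0..int \<Lambda>'}. W)"
    proof (intro sum_mono)
      fix h assume h: "h \<in> {0..int \<Lambda>'}"
      let ?Sh = "{s \<in> ?S. hh s = h}"
      show "(\<Sum>c\<in>{c \<in> g ` ?S. fst c = h}. (real (card (Sc c)))\<^sup>2 * B (fst c)) \<le> W"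
      proof (cases "2 ^ nat h \<le> N")
        case True
        have "(\<Sum>c\<in>{c \<in> g ` ?S. fst c = h}. card {(s, s'). (s, s') \<in> ?Sh \<times> ?Sh \<and> g s = c \<and> g s' = c}) \<le> card (?Sh \<times> ?Sh)"
          by (rule sum_card_same_colour_le) auto
        moreover have "card {(s, s'). (s, s') \<in> ?Sh \<times> ?Sh \<and> g s = c \<and> g s' = c} = (card (Sc c))\<^sup>2"
          if "fst c = h" for c
        proof -
          have "{(s, s'). (s, s') \<in> ?Sh \<times> ?Sh \<and> g s = c \<and> g s' = c} = Sc c \<times> Sc c"
            using that by (auto simp: Sc_def g_def)
          then show ?thesis by (simp add: card_cartesian_product power2_eq_square)
        qed
        ultimately have "(\<Sum>c\<in>{c \<in> g ` ?S. fst c = h}. (card (Sc c))\<^sup>2) \<le> (card ?Sh)\<^sup>2"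
          by (simp add: card_cartesian_product power2_eq_square)
        then have "real (\<Sum>c\<in>{c \<in> g ` ?S. fst c = h}. (card (Sc c))\<^sup>2) \<le> real ((card ?Sh)\<^sup>2)"
          by (simp only: of_nat_le_iff)
        then have "(\<Sum>c\<in>{c \<in> g ` ?S. fst c = h}. (real (card (Sc c)))\<^sup>2) \<le> (real (card ?Sh))\<^sup>2"
          by (simp only: of_nat_sum of_nat_power)
        also have "\<dots> \<le> (2 * real N * 2 ^ nat h)\<^sup>2"
          using card_index_pairs_dyadic[of h N] h by (intro power_mono) (auto simp: hh_def)
        finally have "(\<Sum>c\<in>{c \<in> g ` ?S. fst c = h}. (real (card (Sc c)))\<^sup>2) * B h \<le> (2 * real N * 2 ^ nat h)\<^sup>2 * B h"
          using B0 by (intro mult_right_mono) auto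
        also have "\<dots> \<le> W" using W[OF True] by (simp add: B_def)
        also have "(\<Sum>c\<in>{c \<in> g ` ?S. fst c = h}. (real (card (Sc c)))\<^sup>2) * B h
            = (\<Sum>c\<in>{c \<in> g ` ?S. fst c = h}. (real (card (Sc c)))\<^sup>2 * B (fst c))"
          by (simp add: sum_distrib_right)
        finally show ?thesis .
      next
        case False
        have "{c \<in> g ` ?S. fst c = h} = {}"
        proof (rule ccontr)
          assume "{c \<in> g ` ?S. fst c = h} \<noteq> {}"
          then obtain s where s: "s \<in> ?S" "hh s = h" by (auto simp: g_def)
          then have s': "1 \<le> snd s - fst s" "snd s - fst s \<le> N" by (auto simp: index_pairs_def)
          have "2 ^ nat h \<le> snd s - fst s" using dyad_nat_bounds(1)[OF s'(1)] s(2) by (simp add: hh_def del: of_nat_diff)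
          then show False using s' False by linarith
        qed
        moreover have "W \<ge> 0"
        proof -
          have "0 \<le> (2 * real N * 2 ^ 0)\<^sup>2 * B 0" by (intro mult_nonneg_nonneg B0) simp
          also have "\<dots> \<le> W"
          proof -
            have nz: "nat 0 = 0" by simp
            show ?thesis unfolding B_def nz by (rule W) (use N in simp)
          qed
          finally show ?thesis .
        qed
        ultimately show ?thesis by (simp only: sum.empty)
      qed
    qed
    finally have s2: "(\<Sum>c\<in>g ` ?S. (real (card (Sc c)))\<^sup>2 * B (fst c)) \<le> (real \<Lambda>' + 1) * W" by simp
    have "(\<Sum>c\<in>g ` ?S. F c) = 2 ^ CARD('d) * (2 * \<theta> * (\<Sum>c\<in>g ` ?S. real (e c))
        + (\<Sum>c\<in>g ` ?S. (real (card (Sc c)))\<^sup>2 * B (fst c)) / \<theta>\<^sup>2)"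
      by (simp add: F_def sum_distrib_left sum.distrib sum_divide_distrib distrib_left)
    also have "\<dots> \<le> 2 ^ CARD('d) * (2 * \<theta> * joint_additive_energy x D' N + (real \<Lambda>' + 1) * W / \<theta>\<^sup>2)"
      using s1 s2 \<theta> by (intro mult_left_mono add_mono divide_right_mono) auto
    finally show ?thesis .
  qed
  have "real (card (close_pairs ((\<chi> l. \<eta>) /\<^sub>R 2) I p))
      \<le> 2 ^ CARD('d) * real L * (\<Sum>c\<in>col ` I. card (close_pairs (\<chi> l. \<eta>) {i \<in> I. col i = c} p))"
    using \<eta> by (intro close_pairs_le_colour_classes finI L) auto
  also have "\<dots> \<le> 2 ^ CARD('d) * real L * ((real \<Lambda> + 1) ^ CARD('d) *
        (2 ^ CARD('d) * (2 * \<theta> * joint_additive_energy x D' N + (real \<Lambda>' + 1) * W / \<theta>\<^sup>2)))"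
  proof (rule mult_left_mono)
    have "real (\<Sum>c\<in>col ` I. card (close_pairs (\<chi> l. \<eta>) {i \<in> I. col i = c} p)) \<le> (\<Sum>c\<in>col ` I. F (snd c))"
      unfolding of_nat_sum
    proof (rule sum_mono)
      fix c assume "c \<in> col ` I"
      then show "real (card (close_pairs (\<chi> l. \<eta>) {i \<in> I. col i = c} p)) \<le> F (snd c)"
        using cls[of "fst c" "snd c"] by simp
    qed
    \<comment> \<open>\<open>F\<close> does not see the frequency class, so the frequency classes
      merely contribute the factor \<open>(\<Lambda> + 1) ^ d\<close>.\<close>
    also have "\<dots> \<le> (\<Sum>c\<in>KS \<times> g ` ?S. F (snd c))"
    proof (rule sum_mono2)
      show "finite (KS \<times> g ` ?S)" using finKS by simp
      show "col ` I \<subseteq> KS \<times> g ` ?S" using kk0 by (force simp: I_def col_def g_def KS_def)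
    qed (rule F0)
    also have "\<dots> = (\<Sum>\<kappa>\<in>KS. \<Sum>c\<in>g ` ?S. F c)"
      by (subst sum.cartesian_product) (simp only: case_prod_unfold)
    also have "\<dots> = (real \<Lambda> + 1) ^ CARD('d) * (\<Sum>c\<in>g ` ?S. F c)"
      by (simp add: KS_def card_PiE add.commute)
    also have "\<dots> \<le> (real \<Lambda> + 1) ^ CARD('d) *
        (2 ^ CARD('d) * (2 * \<theta> * joint_additive_energy x D' N + (real \<Lambda>' + 1) * W / \<theta>\<^sup>2))"
      by (rule mult_left_mono[OF Fsum]) simp
    finally show "real (\<Sum>c\<in>col ` I. card (close_pairs (\<chi> l. \<eta>) {i \<in> I. col i = c} p)) \<le> \<dots>" .
  qed simp
  also have "\<dots> = (16 * (real \<Lambda> + 1)\<^sup>2) ^ CARD('d) * (real \<Lambda>' + 1) *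
        (2 * \<theta> * joint_additive_energy x D' N + (real \<Lambda>' + 1) * W / \<theta>\<^sup>2)"
  proof -
    have "(16 * (real \<Lambda> + 1)\<^sup>2) ^ CARD('d) = (2 * (4 * (real \<Lambda> + 1)) * ((real \<Lambda> + 1) * 2)) ^ CARD('d)"
      by (rule arg_cong[where f = "\<lambda>t. t ^ CARD('d)"]) (simp add: power2_eq_square algebra_simps)
    also have "\<dots> = 2 ^ CARD('d) * (4 * (real \<Lambda> + 1)) ^ CARD('d) * ((real \<Lambda> + 1) ^ CARD('d) * 2 ^ CARD('d))"
      by (simp only: power_mult_distrib)
    finally have e1: "(16 * (real \<Lambda> + 1)\<^sup>2) ^ CARD('d) = \<dots>" .
    have e2: "real L = (4 * (real \<Lambda> + 1)) ^ CARD('d) * (real \<Lambda>' + 1)" by (simp add: L_def algebra_simps)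
    have "a * (b * c) * (e * (a * y)) = a * b * (e * a) * c * y" for a b c e y :: real
      by (simp add: mult_ac)
    then show ?thesis unfolding e1 e2 .
  qed
  finally show ?thesis by (simp only: I_def p_def)
qed

text \<open>The finitely many exceptional n are absorbed into the constant, which is possible
  because g is positive there.\<close>

lemma bigo_all_nat:
  fixes f g :: "nat \<Rightarrow> real"
  assumes "f \<in> O(g)" "\<And>n. n \<ge> 1 \<Longrightarrow> g n > 0"
  obtains C where "C > 0" "\<And>n. n \<ge> 1 \<Longrightarrow> f n \<le> C * g n"
proof -
  obtain c where c: "c > 0" "\<forall>\<^sub>F n in sequentially. norm (f n) \<le> c * norm (g n)"
    using assms(1) by (rule landau_o.bigE)
  then obtain N where N: "\<And>n. n \<ge> N \<Longrightarrow> norm (f n) \<le> c * norm (g n)"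
    by (auto simp: eventually_sequentially)
  define C where "C = c + (\<Sum>n\<in>{1..N}. \<bar>f n\<bar> / g n)"
  have s0: "(\<Sum>n\<in>{1..N}. \<bar>f n\<bar> / g n) \<ge> 0"
    using assms(2) by (intro sum_nonneg divide_nonneg_pos) auto
  show ?thesis
  proof
    show "C > 0" using c s0 by (simp add: C_def)
    fix n :: nat assume n: "n \<ge> 1"
    show "f n \<le> C * g n"
    proof (cases "n \<ge> N")
      case True
      then have "f n \<le> c * g n" using N[OF True] assms(2)[OF n] by auto
      also have "\<dots> \<le> C * g n" using s0 assms(2)[OF n] by (intro mult_right_mono) (auto simp: C_def)
      finally show ?thesis .
    next
      case False
      then have "\<bar>f n\<bar> / g n \<le> (\<Sum>n\<in>{1..N}. \<bar>f n\<bar> / g n)"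
        using n assms(2) by (intro member_le_sum) (auto intro: divide_nonneg_pos)
      then have "\<bar>f n\<bar> / g n \<le> C" using c by (simp add: C_def)
      then show ?thesis using assms(2)[OF n] by (simp add: field_simps)
    qed
  qed
qed

text \<open>The competition between the few index pairs at scale H (factor H^2) and the poor spacing
  bound for small gaps (factor K^2/H per coordinate). If K^2 \<le> H the bracket is bounded.
  Otherwise d' = 1 gives H K^2, of exponent 1 + 2/d \<le> 2 because d \<ge> 2, and d' \<ge> 2 gives
  at most K^(2d'), of exponent 2d'/d \<le> 2, up to \<epsilon>.\<close>

lemma dyadic_factor_bound:
  fixes N K H d' d :: nat and \<epsilon> :: real
  assumes H: "H \<ge> 1" "H \<le> N" and d: "d \<ge> 2" "1 \<le> d'" "d' \<le> d" and \<epsilon>: "\<epsilon> > 0"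
    and K: "real K \<le> real N powr (1 / real d + \<epsilon>)"
  shows "real H ^ 2 * (1 + 8 * real K ^ 2 / real H) ^ d' \<le> 9 ^ d * real N powr (2 + 2 * real d * \<epsilon>)"
proof -
  have N1: "real N \<ge> 1" using H by simp
  have K2: "real K ^ 2 \<le> real N powr (2 / real d + 2 * \<epsilon>)"
  proof -
    have "real K ^ 2 \<le> (real N powr (1 / real d + \<epsilon>)) ^ 2" using K by (intro power_mono) auto
    also have "\<dots> = real N powr (2 / real d + 2 * \<epsilon>)"
      using N1 by (simp add: powr_power algebra_simps)
    finally show ?thesis .
  qed
  show ?thesis
  proof (cases "real K ^ 2 \<le> real H")
    case True
    have "8 * real K ^ 2 / real H \<le> 8" using True H by (simp add: field_simps)
    then have "(1 + 8 * real K ^ 2 / real H) ^ d' \<le> 9 ^ d'" by (intro power_mono) auto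
    also have "\<dots> \<le> 9 ^ d" using d by (intro power_increasing) auto
    finally have "real H ^ 2 * (1 + 8 * real K ^ 2 / real H) ^ d' \<le> real N ^ 2 * 9 ^ d"
      using H by (intro mult_mono power_mono) auto
    also have "real N ^ 2 = real N powr 2" using N1 by (simp add: powr_numeral)
    also have "real N powr 2 * 9 ^ d \<le> real N powr (2 + 2 * real d * \<epsilon>) * 9 ^ d"
      using N1 \<epsilon> by (intro mult_right_mono powr_mono) auto
    finally show ?thesis by (simp add: mult.commute)
  next
    case False
    define y where "y = real K ^ 2 / real H"
    have y1: "y \<ge> 1" using False H by (simp add: y_def field_simps)
    have "(1 + 8 * real K ^ 2 / real H) ^ d' \<le> (9 * y) ^ d'"
      using y1 by (intro power_mono) (auto simp: y_def)
    also have "\<dots> \<le> 9 ^ d * y ^ d'"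
      unfolding power_mult_distrib using d y1 by (intro mult_right_mono power_increasing) auto
    finally have "real H ^ 2 * (1 + 8 * real K ^ 2 / real H) ^ d' \<le> real H ^ 2 * (9 ^ d * y ^ d')"
      by (rule mult_left_mono) simp
    then have a: "real H ^ 2 * (1 + 8 * real K ^ 2 / real H) ^ d' \<le> 9 ^ d * (real H ^ 2 * y ^ d')"
      by (simp only: mult.left_commute)
    have "real H ^ 2 * y ^ d' \<le> real N powr (2 + 2 * real d * \<epsilon>)"
    proof (cases "d' = 1")
      case True
      have "real H ^ 2 * y ^ d' = real H * real K ^ 2"
        using True H by (simp add: y_def power2_eq_square)
      also have "\<dots> \<le> real N powr 1 * real N powr (2 / real d + 2 * \<epsilon>)"
        using K2 H by (intro mult_mono) auto
      also have "\<dots> = real N powr (1 + (2 / real d + 2 * \<epsilon>))" by (simp only: powr_add)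
      also have "\<dots> \<le> real N powr (2 + 2 * real d * \<epsilon>)"
      proof (intro powr_mono N1)
        have "2 / real d \<le> 1" using d by (simp add: field_simps)
        moreover have "2 * \<epsilon> \<le> 2 * real d * \<epsilon>" using d \<epsilon> by simp
        ultimately show "1 + (2 / real d + 2 * \<epsilon>) \<le> 2 + 2 * real d * \<epsilon>" by linarith
      qed
      finally show ?thesis .
    next
      case False
      then obtain e where e: "d' = 2 + e" using d by (metis le_add_diff_inverse le_antisym not_less_eq_eq numeral_2_eq_2 One_nat_def)
      \<comment> \<open>Two factors y = K^2/H absorb H^2 completely; the remaining ones are
        estimated by K^2.\<close>
      have "real H ^ 2 * y ^ d' = (real H * y) ^ 2 * y ^ e" by (simp add: e power_add power_mult_distrib power2_eq_square)
      also have "real H * y = real K ^ 2" using H by (simp add: y_def)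
      also have "(real K ^ 2) ^ 2 * y ^ e \<le> (real K ^ 2) ^ 2 * (real K ^ 2) ^ e"
      proof (intro mult_left_mono power_mono)
        show "y \<le> real K ^ 2" using H divide_left_mono[of 1 "real H" "real K ^ 2"] by (simp add: y_def)
      qed (use y1 in auto)
      also have "\<dots> = (real K ^ 2) ^ d'" by (simp add: e power_add)
      also have "\<dots> \<le> (real N powr (2 / real d + 2 * \<epsilon>)) ^ d'" using K2 by (intro power_mono) auto
      also have "\<dots> = real N powr ((2 / real d + 2 * \<epsilon>) * real d')"
        using N1 by (simp add: powr_power mult.commute)
      also have "\<dots> \<le> real N powr (2 + 2 * real d * \<epsilon>)"
      proof (intro powr_mono N1)
        have "(2 / real d + 2 * \<epsilon>) * real d' \<le> (2 / real d + 2 * \<epsilon>) * real d"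
          using d \<epsilon> by (intro mult_left_mono) auto
        also have "\<dots> = 2 + 2 * real d * \<epsilon>" using d by (simp add: field_simps)
        finally show "(2 / real d + 2 * \<epsilon>) * real d' \<le> 2 + 2 * real d * \<epsilon>" .
      qed
      finally show ?thesis .
    qed
    then have "9 ^ d * (real H ^ 2 * y ^ d') \<le> 9 ^ d * real N powr (2 + 2 * real d * \<epsilon>)"
      by (intro mult_left_mono) auto
    with a show ?thesis by linarith
  qed
qed

text \<open>The minimum records the worse of the two savings, one from the energy and one from the
  sixth moment; the term with \<epsilon> collects divisor bounds, logarithms and the slightly
  enlarged frequency range.\<close>

lemma dilated_gap_count_asymptotic:
  fixes x :: "nat \<Rightarrow> real^'d" and D' :: "'d set" and \<eta> c \<epsilon> lam :: real
  assumes d: "CARD('d) \<ge> 2"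
    and c: "c > 0" and sep: "\<And>l n. n \<ge> 1 \<Longrightarrow> x (n + 1) $ l - x n $ l \<ge> c"
    and \<eta>: "\<eta> > 0" "8 * \<eta> \<le> c" "8 * \<eta> \<le> 1" and D': "D' \<noteq> {}"
    and \<epsilon>: "\<epsilon> > 0" "\<epsilon> \<le> 1 / 2"
    and en: "(\<lambda>N. real (joint_additive_energy x D' N)) \<in>
        O(\<lambda>N. real N powr (4 - 1 / real CARD('d) * (2 * real (card D') - 31 / 76) - lam))"
  shows "\<exists>C>0. \<forall>N\<ge>1. \<forall>K\<ge>1. real K \<le> real N powr (1 / real CARD('d) + \<epsilon>) \<longrightarrow>
    real (card (gap_collisions \<eta> x D' N K))
    \<le> C * real N powr (4 - min lam (14 / 76 / real CARD('d)) + 12 * real CARD('d) * \<epsilon>)"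
proof -
  define d where "d = CARD('d)"
  define d' where "d' = card D'"
  have d': "1 \<le> d'" "d' \<le> d" "d \<ge> 2"
    using D' d card_mono[of UNIV D'] by (auto simp: d'_def d_def Suc_le_eq card_gt_0_iff)
  define g where "g = (2 * real d' - 31 / 76) / real d"
  obtain CE where CE: "CE > 0" "\<And>N. N \<ge> 1 \<Longrightarrow> real (joint_additive_energy x D' N) \<le> CE * real N powr (4 - g - lam)"
    using bigo_all_nat[OF en] by (auto simp: g_def d_def d'_def)
  obtain CT where CT: "CT > 0" "\<And>a :: nat. a > 0 \<Longrightarrow> real (card (triple_factorizations a)) \<le> CT * real a powr \<epsilon>"
    using triple_factorization_bound[OF \<epsilon>(1)] by blast
  \<comment> \<open>The logarithms occur to the power 2d + 2; bounding each by N^b costs b (2d + 2)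
    \<le> 8 d b = d \<epsilon>.\<close>
  define b where "b = \<epsilon> / 8"
  define CL where "CL = 1 + 1 / (b * ln 2)"
  have b: "b > 0" using \<epsilon> by (simp add: b_def)
  have CL: "CL \<ge> 1" using b by (simp add: CL_def)
  define CW where "CW = 4 * 40 ^ d * 9 ^ d * (CT * 8 powr \<epsilon>) ^ (2 * d)"
  define CC where "CC = 16 ^ d * CL ^ (2 * d + 2) * (2 * CE + CW)"
  have CW: "CW > 0" using CT by (simp add: CW_def)
  show ?thesis
  proof (intro exI[of _ CC] conjI allI impI)
    show "CC > 0" using CE CW CL by (simp add: CC_def)
    fix N K :: nat assume N: "1 \<le> N" and K: "1 \<le> K" "real K \<le> real N powr (1 / real CARD('d) + \<epsilon>)"
    have N1: "real N \<ge> 1" using N by simp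
    \<comment> \<open>Since 1/d + \<epsilon> \<le> 1, one number \<Lambda> of dyadic scales serves
      both frequencies and index distances.\<close>
    have KN: "K \<le> N"
    proof -
      have "1 / real d \<le> 1 / 2" using d' by (simp add: field_simps)
      then have "real N powr (1 / real d + \<epsilon>) \<le> real N powr 1" using N1 \<epsilon> by (intro powr_mono) auto
      then show ?thesis using K N1 by (simp add: d_def)
    qed
    define \<Lambda> where "\<Lambda> = nat (dyad (real N))"
    have \<Lambda>: "dyad (real N) \<le> int \<Lambda>" "dyad (real K) \<le> int \<Lambda>"
      using dyad_mono[of "real K" "real N"] K KN by (auto simp: \<Lambda>_def)
    have \<Lambda>L: "real \<Lambda> + 1 \<le> CL * real N powr b"
    proof -
      have "real \<Lambda> \<le> log 2 (real N)"
        using dyad_nonneg[OF N1] by (simp add: \<Lambda>_def dyad_def)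
      also have "\<dots> = ln (real N) / ln 2" by (simp add: log_def)
      also have "\<dots> \<le> (real N powr b / b) / ln 2"
        using ln_powr_bound[OF N1 b] by (intro divide_right_mono) auto
      finally have "real \<Lambda> \<le> real N powr b * (1 / (b * ln 2))" by simp
      moreover have "1 \<le> real N powr b" using N1 b by (simp add: ge_one_powr_ge_zero)
      ultimately show ?thesis by (simp add: CL_def algebra_simps)
    qed
    define Dv where "Dv = nat \<lfloor>CT * (8 * real N ^ 3) powr \<epsilon>\<rfloor>"
    have Dv1: "card (triple_factorizations a) \<le> Dv" if "a \<in> {1..8 * K ^ 3}" for a
    proof -
      have "8 * K ^ 3 \<le> 8 * N ^ 3" using power_mono[OF KN, of 3] by simp
      then have "a \<le> 8 * N ^ 3" using that by (meson atLeastAtMost_iff order_trans)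
      then have "real a \<le> real (8 * N ^ 3)" unfolding of_nat_le_iff .
      then have "real a \<le> 8 * real N ^ 3" by simp
      then have "CT * real a powr \<epsilon> \<le> CT * (8 * real N ^ 3) powr \<epsilon>"
        using CT \<epsilon> by (intro mult_left_mono powr_mono2) auto
      then have "real (card (triple_factorizations a)) \<le> CT * (8 * real N ^ 3) powr \<epsilon>"
        using CT(2)[of a] that by auto
      then show ?thesis unfolding Dv_def by (simp add: le_nat_iff le_floor_iff)
    qed
    have Dv2: "real Dv \<le> CT * 8 powr \<epsilon> * real N powr (3 * \<epsilon>)"
    proof -
      have "real Dv \<le> CT * (8 * real N ^ 3) powr \<epsilon>" using CT by (simp add: Dv_def)
      also have "(8 * real N ^ 3) powr \<epsilon> = 8 powr \<epsilon> * real N powr (3 * \<epsilon>)"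
        using N1 by (simp add: powr_mult powr_powr flip: powr_numeral)
      finally show ?thesis by (simp add: mult_ac)
    qed
    have Dv2d: "real Dv ^ (2 * d) \<le> (CT * 8 powr \<epsilon>) ^ (2 * d) * real N powr (6 * real d * \<epsilon>)"
    proof -
      have "real Dv ^ (2 * d) \<le> (CT * 8 powr \<epsilon> * real N powr (3 * \<epsilon>)) ^ (2 * d)"
        using Dv2 by (intro power_mono) auto
      also have "\<dots> = (CT * 8 powr \<epsilon>) ^ (2 * d) * (real N powr (3 * \<epsilon>)) ^ (2 * d)"
        by (rule power_mult_distrib)
      also have "(real N powr (3 * \<epsilon>)) ^ (2 * d) = real N powr (6 * real d * \<epsilon>)"
        using N1 by (simp add: powr_power mult_ac)
      finally show ?thesis .
    qed
    \<comment> \<open>Exactly the saving of the energy hypothesis apart from lam, so the energy term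
      keeps just N^(4 - lam).\<close>
    define \<theta> where "\<theta> = real N powr g"
    have \<theta>: "\<theta> > 0" using N1 by (simp add: \<theta>_def)
    \<comment> \<open>The 4 is 2 from N^2 and 2 from \<open>dyadic_factor_bound\<close>, and 3d'/d
      comes from K^(3d'); the losses are 6d\<epsilon> (divisor bound), 3d\<epsilon> (frequency
      range) and 2d\<epsilon> (dyadic factor).\<close>
    define W where "W = CW * real N powr (4 + 3 * real d' / real d + 11 * real d * \<epsilon>)"
    have K3: "(real K ^ 3) ^ d' \<le> real N powr (3 * real d' / real d + 3 * real d * \<epsilon>)"
    proof -
      have "(real K ^ 3) ^ d' = real K ^ (3 * d')" by (simp add: power_mult)
      also have "\<dots> \<le> (real N powr (1 / real d + \<epsilon>)) ^ (3 * d')"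
        using K by (intro power_mono) (auto simp: d_def)
      also have "\<dots> = real N powr ((1 / real d + \<epsilon>) * (3 * real d'))"
        using N1 by (simp add: powr_power mult_ac)
      also have "\<dots> \<le> real N powr (3 * real d' / real d + 3 * real d * \<epsilon>)"
      proof (intro powr_mono N1)
        have "3 * \<epsilon> * real d' \<le> 3 * \<epsilon> * real d" using d' \<epsilon> by (intro mult_left_mono) auto
        then show "(1 / real d + \<epsilon>) * (3 * real d') \<le> 3 * real d' / real d + 3 * real d * \<epsilon>"
          by (simp add: algebra_simps)
      qed
      finally show ?thesis .
    qed
    have Wb: "(2 * real N * 2 ^ h)\<^sup>2 * (\<Prod>l\<in>(UNIV :: 'd set). if l \<in> D' then 8 * real K ^ 3 * real Dv ^ 2 * (1 + 8 * real K ^ 2 / 2 ^ h) else 40 * real Dv ^ 2) \<le> W"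
      if h: "2 ^ h \<le> N" for h :: nat
    proof -
      define H where "H = (2 :: nat) ^ h"
      have H: "H \<ge> 1" "H \<le> N" "real H = 2 ^ h" using h by (auto simp: H_def)
      define Y where "Y = 1 + 8 * real K ^ 2 / real H"
      have "(\<Prod>l\<in>(UNIV :: 'd set). if l \<in> D' then 8 * real K ^ 3 * real Dv ^ 2 * (1 + 8 * real K ^ 2 / 2 ^ h) else 40 * real Dv ^ 2)
          \<le> (\<Prod>l\<in>(UNIV :: 'd set). (40 * real Dv ^ 2) * (if l \<in> D' then real K ^ 3 * Y else 1))"
      proof (intro prod_mono conjI)
        fix l
        show "(if l \<in> D' then 8 * real K ^ 3 * real Dv ^ 2 * (1 + 8 * real K ^ 2 / 2 ^ h) else 40 * real Dv ^ 2)
          \<le> (40 * real Dv ^ 2) * (if l \<in> D' then real K ^ 3 * Y else 1)"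
        proof (cases "l \<in> D'")
          case True
          have "8 * (real K ^ 3 * real Dv ^ 2 * Y) \<le> 40 * (real K ^ 3 * real Dv ^ 2 * Y)"
            by (intro mult_right_mono) (auto simp: Y_def)
          then show ?thesis using True H by (simp add: Y_def mult_ac)
        qed simp
      qed auto
      also have "\<dots> = (40 * real Dv ^ 2) ^ d * (real K ^ 3 * Y) ^ d'"
        by (simp only: prod.distrib prod_constant d_def d'_def) (simp add: prod.If_cases)
      also have "\<dots> = 40 ^ d * real Dv ^ (2 * d) * ((real K ^ 3) ^ d' * Y ^ d')"
        by (simp add: power_mult_distrib power_mult)
      finally have "(2 * real N * 2 ^ h)\<^sup>2 * (\<Prod>l\<in>(UNIV :: 'd set). if l \<in> D' then 8 * real K ^ 3 * real Dv ^ 2 * (1 + 8 * real K ^ 2 / 2 ^ h) else 40 * real Dv ^ 2)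
          \<le> (2 * real N * 2 ^ h)\<^sup>2 * (40 ^ d * real Dv ^ (2 * d) * ((real K ^ 3) ^ d' * Y ^ d'))"
        by (intro mult_left_mono) auto
      also have "\<dots> = 4 * 40 ^ d * real N ^ 2 * (real Dv ^ (2 * d) * (real K ^ 3) ^ d') * (real H ^ 2 * Y ^ d')"
        by (simp add: H(3) power_mult_distrib)
      also have "\<dots> \<le> 4 * 40 ^ d * real N ^ 2 * (((CT * 8 powr \<epsilon>) ^ (2 * d) * real N powr (6 * real d * \<epsilon>)) *
          real N powr (3 * real d' / real d + 3 * real d * \<epsilon>)) * (9 ^ d * real N powr (2 + 2 * real d * \<epsilon>))"
      proof (rule mult_mono)
        show "real H ^ 2 * Y ^ d' \<le> 9 ^ d * real N powr (2 + 2 * real d * \<epsilon>)"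
          unfolding Y_def by (rule dyadic_factor_bound[OF H(1,2) d'(3,1,2) \<epsilon>(1)]) (use K d_def in simp)
        show "4 * 40 ^ d * real N ^ 2 * (real Dv ^ (2 * d) * (real K ^ 3) ^ d')
          \<le> 4 * 40 ^ d * real N ^ 2 * (((CT * 8 powr \<epsilon>) ^ (2 * d) * real N powr (6 * real d * \<epsilon>)) *
          real N powr (3 * real d' / real d + 3 * real d * \<epsilon>))"
          using CT by (intro mult_left_mono mult_mono Dv2d K3) auto
      qed (use CT in \<open>auto simp: Y_def\<close>)
      also have "\<dots> = CW * (real N powr 2 * real N powr (6 * real d * \<epsilon>) *
          real N powr (3 * real d' / real d + 3 * real d * \<epsilon>) * real N powr (2 + 2 * real d * \<epsilon>))"
        using N1 by (simp add: CW_def powr_numeral)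
      also have "\<dots> = W" unfolding W_def powr_add [symmetric] by (simp add: algebra_simps)
      finally show ?thesis .
    qed
    define ex where "ex = 4 - min lam (14 / 76 / real d)"
    have t1: "2 * \<theta> * joint_additive_energy x D' N \<le> 2 * CE * real N powr (ex + 11 * real d * \<epsilon>)"
    proof -
      have "2 * \<theta> * joint_additive_energy x D' N \<le> 2 * \<theta> * (CE * real N powr (4 - g - lam))"
        using CE(2)[OF N] \<theta> by (intro mult_left_mono) auto
      also have "\<dots> = 2 * CE * (real N powr g * real N powr (4 - g - lam))" by (simp add: \<theta>_def)
      also have "\<dots> = 2 * CE * real N powr (4 - lam)" by (simp flip: powr_add)
      also have "\<dots> \<le> 2 * CE * real N powr (ex + 11 * real d * \<epsilon>)"
      proof (intro mult_left_mono powr_mono N1)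
        have "0 \<le> 11 * real d * \<epsilon>" using \<epsilon> by simp
        then show "4 - lam \<le> ex + 11 * real d * \<epsilon>"
          using min.cobounded1[of lam "14 / 76 / real d"] unfolding ex_def by linarith
      qed (use CE in simp)
      finally show ?thesis .
    qed
    have t2: "W / \<theta>\<^sup>2 \<le> CW * real N powr (ex + 11 * real d * \<epsilon>)"
    proof -
      have "W / \<theta>\<^sup>2 = CW * (real N powr (4 + 3 * real d' / real d + 11 * real d * \<epsilon>) / real N powr (2 * g))"
        using N1 by (simp add: W_def \<theta>_def powr_power mult.commute)
      also have "\<dots> = CW * real N powr (4 + 3 * real d' / real d + 11 * real d * \<epsilon> - 2 * g)"
        by (simp only: powr_diff)
      also have "\<dots> \<le> CW * real N powr (ex + 11 * real d * \<epsilon>)"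
      proof (intro mult_left_mono powr_mono N1)
        \<comment> \<open>Here 62/76 is twice 31/76, and 1 - 62/76 = 14/76 is the saving left in the
          worst case d' = 1.\<close>
        have "3 * real d' / real d - 2 * g = - ((real d' - 62 / 76) / real d)"
          using d' by (simp add: g_def field_simps)
        also have "\<dots> \<le> - ((14 / 76) / real d)"
          using d' by (intro le_imp_neg_le divide_right_mono) auto
        finally show "4 + 3 * real d' / real d + 11 * real d * \<epsilon> - 2 * g \<le> ex + 11 * real d * \<epsilon>"
          unfolding ex_def by linarith
      qed (use CW in auto)
      finally show ?thesis .
    qed
    have W0: "W \<ge> 0" using CW by (simp add: W_def)
    have "real (card (gap_collisions \<eta> x D' N K))
      \<le> (16 * (real \<Lambda> + 1)\<^sup>2) ^ CARD('d) * (real \<Lambda> + 1) *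
        (2 * \<theta> * joint_additive_energy x D' N + (real \<Lambda> + 1) * W / \<theta>\<^sup>2)"
      by (rule dilated_gap_count[where c = c and Dv = Dv]) (fact c sep \<eta> N K(1) \<theta> Dv1 \<Lambda> Wb)+
    also have "\<dots> \<le> (16 * (real \<Lambda> + 1)\<^sup>2) ^ CARD('d) * (real \<Lambda> + 1) *
        ((real \<Lambda> + 1) * (2 * \<theta> * joint_additive_energy x D' N) + (real \<Lambda> + 1) * (W / \<theta>\<^sup>2))"
    proof (intro mult_left_mono add_mono)
      have "1 * (2 * \<theta> * joint_additive_energy x D' N) \<le> (real \<Lambda> + 1) * (2 * \<theta> * joint_additive_energy x D' N)"
        using \<theta> by (intro mult_right_mono) auto
      then show "2 * \<theta> * joint_additive_energy x D' N \<le> (real \<Lambda> + 1) * (2 * \<theta> * joint_additive_energy x D' N)" by simp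
    qed auto
    also have "\<dots> = 16 ^ d * (real \<Lambda> + 1) ^ (2 * d + 2) * (2 * \<theta> * joint_additive_energy x D' N + W / \<theta>\<^sup>2)"
    proof -
      have "(16 * A\<^sup>2) ^ d * A * (A * X + A * Y) = 16 ^ d * A ^ (2 * d + 2) * (X + Y)" for A X Y :: real
      proof -
        have "A ^ (2 * d + 2) = (A\<^sup>2) ^ d * (A * A)"
          unfolding power_add power_mult by (simp add: power2_eq_square)
        then show ?thesis by (simp only: power_mult_distrib) (simp add: algebra_simps)
      qed
      then show ?thesis unfolding d_def .
    qed
    also have "\<dots> \<le> 16 ^ d * (CL ^ (2 * d + 2) * real N powr (real d * \<epsilon>)) *
        (2 * CE * real N powr (ex + 11 * real d * \<epsilon>) + CW * real N powr (ex + 11 * real d * \<epsilon>))"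
    proof (rule mult_mono[OF mult_left_mono add_mono[OF t1 t2]])
      have "(real \<Lambda> + 1) ^ (2 * d + 2) \<le> (CL * real N powr b) ^ (2 * d + 2)"
        using \<Lambda>L by (intro power_mono) auto
      also have "\<dots> = CL ^ (2 * d + 2) * (real N powr b) ^ (2 * d + 2)" by (rule power_mult_distrib)
      finally have a1: "(real \<Lambda> + 1) ^ (2 * d + 2) \<le> \<dots>" .
      have "(real N powr b) ^ (2 * d + 2) = real N powr (b * (2 * real d + 2))"
        using N1 by (simp add: powr_power mult.commute add.commute del: power_Suc power_Suc2)
      also have "\<dots> \<le> real N powr (real d * \<epsilon>)"
      proof (intro powr_mono N1)
        have "b * (2 * real d + 2) \<le> b * (8 * real d)" using b d' by (intro mult_left_mono) auto
        then show "b * (2 * real d + 2) \<le> real d * \<epsilon>" by (simp add: b_def mult_ac)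
      qed
      finally have b1: "(real N powr b) ^ (2 * d + 2) \<le> real N powr (real d * \<epsilon>)" .
      have "CL ^ (2 * d + 2) * (real N powr b) ^ (2 * d + 2) \<le> CL ^ (2 * d + 2) * real N powr (real d * \<epsilon>)"
        using CL by (intro mult_left_mono b1) auto
      with a1 show "(real \<Lambda> + 1) ^ (2 * d + 2) \<le> CL ^ (2 * d + 2) * real N powr (real d * \<epsilon>)"
        by linarith
    qed (use \<theta> W0 CL CE CW in auto)
    also have "\<dots> = CC * (real N powr (real d * \<epsilon>) * real N powr (ex + 11 * real d * \<epsilon>))"
      by (simp add: CC_def algebra_simps)
    also have "\<dots> = CC * real N powr (ex + 12 * real d * \<epsilon>)"
      unfolding powr_add [symmetric] by (simp add: algebra_simps)
    finally show "real (card (gap_collisions \<eta> x D' N K))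
      \<le> CC * real N powr (4 - min lam (14 / 76 / real CARD('d)) + 12 * real CARD('d) * \<epsilon>)"
      by (simp add: ex_def d_def)
  qed
qed

section \<open>Gaussian mean squares\<close>

lemma integral_lborel_prod_Basis:
  fixes f :: "'a::euclidean_space \<Rightarrow> real \<Rightarrow> complex"
  assumes int: "\<And>b. b \<in> Basis \<Longrightarrow> integrable lborel (f b)"
  shows "integrable lborel (\<lambda>x::'a. \<Prod>b\<in>Basis. f b (x \<bullet> b))"
    and "(\<integral>x. (\<Prod>b\<in>Basis. f b (x \<bullet> b)) \<partial>(lborel :: 'a measure)) = (\<Prod>b\<in>Basis. \<integral>x. f b x \<partial>lborel)"
proof -
  interpret product_sigma_finite "\<lambda>_::'a. lborel :: real measure" ..
  have m [measurable]: "f b \<in> borel_measurable borel" if "b \<in> Basis" for b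
    using borel_measurable_integrable[OF int[OF that]] by simp
  have eq: "(\<Prod>b\<in>Basis. f b ((\<Sum>b'\<in>Basis. y b' *\<^sub>R b') \<bullet> b)) = (\<Prod>b\<in>Basis. f b (y b))" for y
    by (intro prod.cong) (auto simp: inner_sum_left_Basis)
  have meas: "(\<lambda>x::'a. \<Prod>b\<in>Basis. f b (x \<bullet> b)) \<in> borel_measurable borel"
  proof (intro borel_measurable_prod)
    fix b :: 'a assume "b \<in> Basis"
    then show "(\<lambda>x. f b (x \<bullet> b)) \<in> borel_measurable borel"
      by (intro measurable_compose[OF _ m]) auto
  qed
  show "integrable lborel (\<lambda>x::'a. \<Prod>b\<in>Basis. f b (x \<bullet> b))"
    by (subst lborel_eq, subst integrable_distr_eq) 
      (use meas in \<open>auto simp: eq intro!: product_integrable_prod int\<close>)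
  show "(\<integral>x. (\<Prod>b\<in>Basis. f b (x \<bullet> b)) \<partial>(lborel :: 'a measure)) = (\<Prod>b\<in>Basis. \<integral>x. f b x \<partial>lborel)"
    by (subst lborel_eq, subst integral_distr)
      (use meas in \<open>auto simp: eq intro!: product_integral_prod int\<close>)
qed

lemma integral_lborel_prod_cart:
  fixes f :: "'d::finite \<Rightarrow> real \<Rightarrow> complex"
  assumes int: "\<And>l. integrable lborel (f l)"
  shows "integrable lborel (\<lambda>x::real^'d. \<Prod>l\<in>UNIV. f l (x $ l))"
    and "(\<integral>x. (\<Prod>l\<in>UNIV. f l (x $ l)) \<partial>(lborel :: (real^'d) measure)) = (\<Prod>l\<in>UNIV. \<integral>x. f l x \<partial>lborel)"
proof -
  \<comment> \<open>Recovers the coordinate from the basis vector, since the product formula is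
    indexed by \<open>Basis\<close>.\<close>
  define g where "g = (\<lambda>b :: real^'d. f (THE l. b = axis l 1))"
  have g: "g (axis l 1) = f l" for l
    unfolding g_def by (rule arg_cong[where f = f]) (auto simp: axis_eq_axis)
  have B: "(Basis :: (real^'d) set) = range (\<lambda>l. axis l 1)" by (auto simp: Basis_vec_def)
  have inj: "inj (\<lambda>l::'d. axis l (1::real))" by (auto simp: inj_def axis_eq_axis)
  have int': "integrable lborel (g b)" if "b \<in> Basis" for b using that int g by (auto simp: B)
  have e: "(\<Prod>b\<in>Basis. g b (x \<bullet> b)) = (\<Prod>l\<in>UNIV. f l (x $ l))" for x :: "real^'d"
    unfolding B by (subst prod.reindex[OF inj]) (simp add: g inner_axis)
  have e2: "(\<Prod>b\<in>Basis. \<integral>x. g b x \<partial>lborel) = (\<Prod>l\<in>UNIV. \<integral>x. f l x \<partial>lborel)"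
    unfolding B by (subst prod.reindex[OF inj]) (simp add: g)
  show "integrable lborel (\<lambda>x::real^'d. \<Prod>l\<in>UNIV. f l (x $ l))"
    using integral_lborel_prod_Basis(1)[of g] int' by (simp add: e)
  show "(\<integral>x. (\<Prod>l\<in>UNIV. f l (x $ l)) \<partial>(lborel :: (real^'d) measure)) = (\<Prod>l\<in>UNIV. \<integral>x. f l x \<partial>lborel)"
    using integral_lborel_prod_Basis(2)[of g] int' by (simp add: e e2)
qed

lemma normal_density_scale: "B > 0 \<Longrightarrow> normal_density 0 B (B * x) = std_normal_density x / B"
  by (simp add: normal_density_def power_mult_distrib real_sqrt_mult)

text \<open>Rescaling by B reduces the integral to the characteristic function of the standard
  normal distribution.\<close>

lemma normal_density_Fourier:
  assumes B: "B > 0"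
  shows "integrable lborel (\<lambda>x. complex_of_real (normal_density 0 B x) * cis (\<psi> * x))"
    and "(\<integral>x. complex_of_real (normal_density 0 B x) * cis (\<psi> * x) \<partial>lborel) = exp (- (B\<^sup>2 * \<psi>\<^sup>2 / 2))"
proof -
  have i: "integrable lborel (normal_density 0 B)" using B by simp
  show "integrable lborel (\<lambda>x. complex_of_real (normal_density 0 B x) * cis (\<psi> * x))"
  proof (rule Bochner_Integration.integrable_bound[OF i])
    show "(\<lambda>x. complex_of_real (normal_density 0 B x) * cis (\<psi> * x)) \<in> borel_measurable lborel"
      unfolding cis_conv_exp by measurable
  qed (auto simp: norm_mult)
  have "(\<integral>x. complex_of_real (normal_density 0 B x) * cis (\<psi> * x) \<partial>lborel)
      = \<bar>B\<bar> *\<^sub>R (\<integral>x. complex_of_real (normal_density 0 B (0 + B * x)) * cis (\<psi> * (0 + B * x)) \<partial>lborel)"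
    using B by (intro lborel_integral_real_affine) auto
  also have "\<dots> = (\<integral>x. std_normal_density x *\<^sub>R iexp (\<psi> * B * x) \<partial>lborel)"
    unfolding integral_scaleR_right [symmetric] add_0 normal_density_scale[OF B]
    using B by (intro Bochner_Integration.integral_cong refl)
      (simp add: cis_conv_exp scaleR_conv_of_real mult_ac)
  also have "\<dots> = char std_normal_distribution (\<psi> * B)"
    unfolding char_def by (subst integral_density) auto
  also have "\<dots> = exp (- (B\<^sup>2 * \<psi>\<^sup>2 / 2))"
    by (simp add: char_std_normal_distribution power_mult_distrib mult.commute)
  finally show "(\<integral>x. complex_of_real (normal_density 0 B x) * cis (\<psi> * x) \<partial>lborel) = exp (- (B\<^sup>2 * \<psi>\<^sup>2 / 2))" .
qed

text \<open>A Gaussian is positive with a positive and rapidly decaying Fourier transform, so a mean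
  square becomes a sum of nonnegative terms in which distant phases hardly count.\<close>

definition gauss_weight :: "real \<Rightarrow> real^'d \<Rightarrow> real" where
  "gauss_weight B \<alpha> = (\<Prod>l\<in>UNIV. normal_density 0 B (\<alpha> $ l))"

lemma gauss_weight_nonneg: "gauss_weight B \<alpha> \<ge> 0"
  unfolding gauss_weight_def by (intro prod_nonneg) auto

lemma gauss_weight_measurable [measurable]: "gauss_weight B \<in> borel_measurable borel"
  unfolding gauss_weight_def [abs_def] by measurable

lemma cis_inner: "cis (v \<bullet> \<alpha>) = (\<Prod>l\<in>UNIV. cis (v $ l * \<alpha> $ l))" for v \<alpha> :: "real^'d"
  by (simp add: inner_vec_def cis_conv_exp exp_sum sum_distrib_left)

lemma gauss_weight_Fourier:
  fixes v :: "real^'d"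
  assumes B: "B > 0"
  shows "integrable lborel (\<lambda>\<alpha>. complex_of_real (gauss_weight B \<alpha>) * cis (v \<bullet> \<alpha>))"
    and "(\<integral>\<alpha>. complex_of_real (gauss_weight B \<alpha>) * cis (v \<bullet> \<alpha>) \<partial>lborel)
      = complex_of_real (\<Prod>l\<in>UNIV. exp (- (B\<^sup>2 * (v $ l)\<^sup>2 / 2)))"
proof -
  have e: "complex_of_real (gauss_weight B \<alpha>) * cis (v \<bullet> \<alpha>)
      = (\<Prod>l\<in>UNIV. complex_of_real (normal_density 0 B (\<alpha> $ l)) * cis (v $ l * \<alpha> $ l))" for \<alpha>
    by (simp add: gauss_weight_def cis_inner prod.distrib)
  show "integrable lborel (\<lambda>\<alpha>. complex_of_real (gauss_weight B \<alpha>) * cis (v \<bullet> \<alpha>))"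
    unfolding e by (intro integral_lborel_prod_cart normal_density_Fourier B)
  show "(\<integral>\<alpha>. complex_of_real (gauss_weight B \<alpha>) * cis (v \<bullet> \<alpha>) \<partial>lborel)
      = complex_of_real (\<Prod>l\<in>UNIV. exp (- (B\<^sup>2 * (v $ l)\<^sup>2 / 2)))"
    unfolding e by (subst integral_lborel_prod_cart) (simp_all add: normal_density_Fourier B)
qed

lemma gaussian_mean_square:
  fixes a :: "'i \<Rightarrow> real" and \<phi> :: "'i \<Rightarrow> real^'d"
  assumes fin: "finite I" and B: "B > 0"
  shows "has_bochner_integral lborel (\<lambda>\<alpha>. gauss_weight B \<alpha> * (cmod (\<Sum>i\<in>I. a i *\<^sub>R cis (\<phi> i \<bullet> \<alpha>)))\<^sup>2)
    (\<Sum>i\<in>I. \<Sum>j\<in>I. a i * a j * (\<Prod>l\<in>UNIV. exp (- (B\<^sup>2 * (\<phi> i $ l - \<phi> j $ l)\<^sup>2 / 2))))"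
proof -
  let ?f = "\<lambda>\<alpha>. gauss_weight B \<alpha> * (cmod (\<Sum>i\<in>I. a i *\<^sub>R cis (\<phi> i \<bullet> \<alpha>)))\<^sup>2"
  let ?J = "\<lambda>i j. \<Prod>l\<in>UNIV. exp (- (B\<^sup>2 * (\<phi> i $ l - \<phi> j $ l)\<^sup>2 / 2))"
  have e: "complex_of_real (?f \<alpha>) = (\<Sum>i\<in>I. \<Sum>j\<in>I. complex_of_real (a i * a j) *
      (complex_of_real (gauss_weight B \<alpha>) * cis ((\<phi> i - \<phi> j) \<bullet> \<alpha>)))" for \<alpha>
  proof -
    have "complex_of_real ((cmod (\<Sum>i\<in>I. a i *\<^sub>R cis (\<phi> i \<bullet> \<alpha>)))\<^sup>2)
        = (\<Sum>i\<in>I. a i *\<^sub>R cis (\<phi> i \<bullet> \<alpha>)) * cnj (\<Sum>i\<in>I. a i *\<^sub>R cis (\<phi> i \<bullet> \<alpha>))"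
      by (rule complex_norm_square)
    also have "\<dots> = (\<Sum>i\<in>I. \<Sum>j\<in>I. complex_of_real (a i * a j) * (cis (\<phi> i \<bullet> \<alpha>) * cis (- (\<phi> j \<bullet> \<alpha>))))"
      by (simp add: sum_product scaleR_conv_of_real cis_cnj mult_ac)
    also have "\<dots> = (\<Sum>i\<in>I. \<Sum>j\<in>I. complex_of_real (a i * a j) * cis ((\<phi> i - \<phi> j) \<bullet> \<alpha>))"
      by (simp add: cis_mult inner_diff_left)
    finally show ?thesis by (simp add: sum_distrib_left mult_ac)
  qed
  have "has_bochner_integral lborel (\<lambda>\<alpha>. complex_of_real (?f \<alpha>))
      (\<Sum>i\<in>I. \<Sum>j\<in>I. complex_of_real (a i * a j) * complex_of_real (?J i j))"
    unfolding e
    by (intro has_bochner_integral_sum has_bochner_integral_mult_right)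
      (auto simp: has_bochner_integral_iff gauss_weight_Fourier[OF B])
  then have "has_bochner_integral lborel (\<lambda>\<alpha>. Re (complex_of_real (?f \<alpha>)))
      (Re (\<Sum>i\<in>I. \<Sum>j\<in>I. complex_of_real (a i * a j) * complex_of_real (?J i j)))"
    by (intro has_bochner_integral_Re)
  also have "Re (\<Sum>i\<in>I. \<Sum>j\<in>I. complex_of_real (a i * a j) * complex_of_real (?J i j))
      = (\<Sum>i\<in>I. \<Sum>j\<in>I. a i * a j * ?J i j)"
    by (simp only: Re_sum flip: of_real_mult) (simp only: Re_complex_of_real)
  finally show ?thesis by (simp only: Re_complex_of_real)
qed

text \<open>A close pair has weight at most 1. For any other pair one coordinate already differs by
  more than \<eta>, and its factor alone gives the exponential.\<close>

lemma gaussian_mean_square_le: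
  fixes a :: "'i \<Rightarrow> real" and \<phi> :: "'i \<Rightarrow> real^'d"
  assumes fin: "finite I" and B: "B > 0" and a: "\<And>i. i \<in> I \<Longrightarrow> a i \<ge> 0" and \<eta>: "\<eta> > 0"
  shows "(\<integral>\<^sup>+\<alpha>. ennreal (gauss_weight B \<alpha> * (cmod (\<Sum>i\<in>I. a i *\<^sub>R cis (\<phi> i \<bullet> \<alpha>)))\<^sup>2) \<partial>lborel)
    \<le> ennreal ((\<Sum>(i, j)\<in>close_pairs (\<chi> l. \<eta>) I \<phi>. a i * a j) + (\<Sum>i\<in>I. a i)\<^sup>2 * exp (- (B\<^sup>2 * \<eta>\<^sup>2 / 2)))"
proof -
  let ?J = "\<lambda>i j. \<Prod>l\<in>UNIV. exp (- (B\<^sup>2 * (\<phi> i $ l - \<phi> j $ l)\<^sup>2 / 2))"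
  let ?C = "close_pairs (\<chi> l. \<eta>) I \<phi>"
  note h = gaussian_mean_square[OF fin B, of a \<phi>, unfolded has_bochner_integral_iff]
  have "(\<integral>\<^sup>+\<alpha>. ennreal (gauss_weight B \<alpha> * (cmod (\<Sum>i\<in>I. a i *\<^sub>R cis (\<phi> i \<bullet> \<alpha>)))\<^sup>2) \<partial>lborel)
      = ennreal (\<Sum>i\<in>I. \<Sum>j\<in>I. a i * a j * ?J i j)"
    using h by (subst nn_integral_eq_integral) (auto simp: gauss_weight_nonneg)
  also have "(\<Sum>i\<in>I. \<Sum>j\<in>I. a i * a j * ?J i j) = (\<Sum>(i, j)\<in>I \<times> I. a i * a j * ?J i j)"
    by (simp add: sum.cartesian_product)
  also have "\<dots> \<le> (\<Sum>(i, j)\<in>I \<times> I. (if (i, j) \<in> ?C then a i * a j else 0) + a i * a j * exp (- (B\<^sup>2 * \<eta>\<^sup>2 / 2)))"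
  proof (rule sum_mono, clarify)
    fix i j assume ij: "i \<in> I" "j \<in> I"
    have aa: "a i * a j \<ge> 0" using a ij by simp
    have J1: "?J i j \<le> 1" by (intro prod_le_1) auto
    show "a i * a j * ?J i j \<le> (if (i, j) \<in> ?C then a i * a j else 0) + a i * a j * exp (- (B\<^sup>2 * \<eta>\<^sup>2 / 2))"
    proof (cases "(i, j) \<in> ?C")
      case True
      have "a i * a j * ?J i j \<le> a i * a j * 1" by (intro mult_left_mono J1 aa)
      moreover have "0 \<le> a i * a j * exp (- (B\<^sup>2 * \<eta>\<^sup>2 / 2))" using aa by simp
      ultimately show ?thesis using True by simp
    next
      case False
      then obtain l where l: "\<bar>\<phi> i $ l - \<phi> j $ l\<bar> > \<eta>"
        using ij by (auto simp: close_pairs_def close_points_def not_le)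
      have "?J i j = exp (- (B\<^sup>2 * (\<phi> i $ l - \<phi> j $ l)\<^sup>2 / 2)) * (\<Prod>l\<in>UNIV - {l}. exp (- (B\<^sup>2 * (\<phi> i $ l - \<phi> j $ l)\<^sup>2 / 2)))"
        by (subst prod.remove[of _ l]) auto
      also have "\<dots> \<le> exp (- (B\<^sup>2 * (\<phi> i $ l - \<phi> j $ l)\<^sup>2 / 2)) * 1"
        by (intro mult_left_mono prod_le_1) auto
      also have "\<dots> \<le> exp (- (B\<^sup>2 * \<eta>\<^sup>2 / 2))"
      proof -
        have "\<eta>\<^sup>2 \<le> (\<phi> i $ l - \<phi> j $ l)\<^sup>2" using l \<eta> by (subst abs_le_square_iff [symmetric]) auto
        then have "B\<^sup>2 * \<eta>\<^sup>2 \<le> B\<^sup>2 * (\<phi> i $ l - \<phi> j $ l)\<^sup>2" by (intro mult_left_mono) auto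
        then show ?thesis by simp
      qed
      finally have "a i * a j * ?J i j \<le> a i * a j * exp (- (B\<^sup>2 * \<eta>\<^sup>2 / 2))"
        by (intro mult_left_mono aa)
      then show ?thesis using False by simp
    qed
  qed
  also have "\<dots> = (\<Sum>(i, j)\<in>I \<times> I. if (i, j) \<in> ?C then a i * a j else 0)
      + (\<Sum>(i, j)\<in>I \<times> I. a i * a j * exp (- (B\<^sup>2 * \<eta>\<^sup>2 / 2)))"
    by (simp add: case_prod_unfold sum.distrib)
  also have "(\<Sum>(i, j)\<in>I \<times> I. a i * a j * exp (- (B\<^sup>2 * \<eta>\<^sup>2 / 2))) = (\<Sum>i\<in>I. a i)\<^sup>2 * exp (- (B\<^sup>2 * \<eta>\<^sup>2 / 2))"
  proof -
    have "(\<Sum>i\<in>I. a i)\<^sup>2 = (\<Sum>(i, j)\<in>I \<times> I. a i * a j)"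
      by (simp add: power2_eq_square sum_product sum.cartesian_product)
    then show ?thesis by (simp add: sum_distrib_right case_prod_unfold)
  qed
  also have "(\<Sum>(i, j)\<in>I \<times> I. if (i, j) \<in> ?C then a i * a j else 0) = (\<Sum>(i, j)\<in>?C. a i * a j)"
  proof -
    have "?C = {x \<in> I \<times> I. x \<in> ?C}" by (auto simp: close_pairs_def)
    then show ?thesis using fin
      by (subst (2) \<open>?C = _\<close>, subst sum.inter_filter) (auto intro!: sum.cong)
  qed
  finally show ?thesis by (simp add: ennreal_leI)
qed

section \<open>Fourier coefficients of even powers of the cosine\<close>

text \<open>The Fourier coefficient of cos(pi t)^(2M) at frequency k, a centred binomial
  probability. It has this meaning for |k| \<le> M only: below -M the truncation in
  \<open>nat\<close> yields 1/4^M, so sums are always restricted to |k| \<le> M.\<close>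

definition cos_coeff :: "nat \<Rightarrow> int \<Rightarrow> real" where
  "cos_coeff M k = real ((2 * M) choose nat (int M + k)) / 4 ^ M"

lemma cos_coeff_nonneg: "cos_coeff M k \<ge> 0"
  by (simp add: cos_coeff_def)

lemma cos_coeff_le: "cos_coeff M k \<le> cos_coeff M 0"
  unfolding cos_coeff_def using binomial_maximum'[of M "nat (int M + k)"]
  by (intro divide_right_mono) auto

lemma sum_cos_coeff_reindex:
  "(\<Sum>k\<in>{- int M..int M}. f (cos_coeff M k) k) = (\<Sum>i\<le>2 * M. f (real ((2 * M) choose i) / 4 ^ M) (int i - int M))"
  by (rule sum.reindex_bij_witness[of _ "\<lambda>i. int i - int M" "\<lambda>k. nat (int M + k)"])
    (auto simp: cos_coeff_def)

text \<open>The binomial theorem, with negative powers of z written as powers of w = 1/z. The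
  generality in the field pays off three times: z on the unit circle gives the Fourier expansion, z
  = 1 the total mass, z = exp y the exponential moments.\<close>

lemma exp_sum_cos_coeff:
  fixes z w :: "'a :: {real_normed_field, banach}"
  assumes "z * w = 1"
  shows "(\<Sum>k\<in>{- int M..int M}. of_real (cos_coeff M k) * (if k \<ge> 0 then z ^ (2 * nat k) else w ^ (2 * nat (- k))))
    = ((z + w) / 2) ^ (2 * M)"
proof -
  have "z ^ i * w ^ (2 * M - i) = (if i \<ge> M then z ^ (2 * (i - M)) else w ^ (2 * (M - i)))" if "i \<le> 2 * M" for i
  proof (cases "i \<ge> M")
    case True
    have "i = 2 * (i - M) + (2 * M - i)" using True that by linarith
    then have "z ^ i = z ^ (2 * (i - M)) * z ^ (2 * M - i)" by (metis power_add)
    then have "z ^ i * w ^ (2 * M - i) = (z ^ (2 * (i - M)) * z ^ (2 * M - i)) * w ^ (2 * M - i)"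
      by (rule arg_cong)
    also have "\<dots> = z ^ (2 * (i - M)) * (z * w) ^ (2 * M - i)" by (simp add: power_mult_distrib)
    finally show ?thesis using True assms by simp
  next
    case False
    have "2 * M - i = i + 2 * (M - i)" using False by linarith
    then have "w ^ (2 * M - i) = w ^ i * w ^ (2 * (M - i))" by (metis power_add)
    then have "z ^ i * w ^ (2 * M - i) = z ^ i * (w ^ i * w ^ (2 * (M - i)))" by (rule arg_cong)
    also have "\<dots> = (z * w) ^ i * w ^ (2 * (M - i))" by (simp add: power_mult_distrib)
    finally show ?thesis using False assms by simp
  qed
  note zw = this
  have "((z + w) / 2) ^ (2 * M) = (z + w) ^ (2 * M) / 4 ^ M"
    by (simp add: power_divide power_mult)
  also have "\<dots> = (\<Sum>i\<le>2 * M. of_real (real ((2 * M) choose i) / 4 ^ M) * (z ^ i * w ^ (2 * M - i)))"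
    by (simp add: binomial_ring sum_divide_distrib mult_ac)
  also have "\<dots> = (\<Sum>i\<le>2 * M. of_real (real ((2 * M) choose i) / 4 ^ M) *
      (if int i - int M \<ge> 0 then z ^ (2 * nat (int i - int M)) else w ^ (2 * nat (- (int i - int M)))))"
    by (intro sum.cong refl) (auto simp: zw nat_diff_distrib)
  also have "\<dots> = (\<Sum>k\<in>{- int M..int M}. of_real (cos_coeff M k) * (if k \<ge> 0 then z ^ (2 * nat k) else w ^ (2 * nat (- k))))"
    by (rule sum_cos_coeff_reindex[of "\<lambda>a k. of_real a * (if k \<ge> 0 then z ^ (2 * nat k) else w ^ (2 * nat (- k)))", symmetric])
  finally show ?thesis by simp
qed

lemma cos_power_expansion:
  "complex_of_real (cos (pi * t) ^ (2 * M))
    = (\<Sum>k\<in>{- int M..int M}. cos_coeff M k *\<^sub>R cis (2 * pi * (real_of_int k * t)))"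
proof -
  have "complex_of_real (cos (pi * t) ^ (2 * M)) = ((cis (pi * t) + cis (- (pi * t))) / 2) ^ (2 * M)"
  proof -
    have "complex_of_real (cos (pi * t)) = (cis (pi * t) + cis (- (pi * t))) / 2"
      by (simp add: complex_eq_iff)
    then show ?thesis by (simp only: of_real_power)
  qed
  also have "\<dots> = (\<Sum>k\<in>{- int M..int M}. complex_of_real (cos_coeff M k) *
      (if k \<ge> 0 then cis (pi * t) ^ (2 * nat k) else cis (- (pi * t)) ^ (2 * nat (- k))))"
    by (rule exp_sum_cos_coeff [symmetric]) (simp add: cis_mult)
  also have "\<dots> = (\<Sum>k\<in>{- int M..int M}. cos_coeff M k *\<^sub>R cis (2 * pi * (real_of_int k * t)))"
  proof (intro sum.cong refl)
    fix k :: int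
    have "(if k \<ge> 0 then cis (pi * t) ^ (2 * nat k) else cis (- (pi * t)) ^ (2 * nat (- k))) = cis (2 * pi * (real_of_int k * t))"
    proof (cases "k \<ge> 0")
      case True
      have "cis (pi * t) ^ (2 * nat k) = cis (real (2 * nat k) * (pi * t))" by (rule Complex.DeMoivre)
      also have "real (2 * nat k) * (pi * t) = 2 * pi * (real_of_int k * t)" using True by simp
      finally show ?thesis using True by simp
    next
      case False
      have "cis (- (pi * t)) ^ (2 * nat (- k)) = cis (real (2 * nat (- k)) * (- (pi * t)))" by (rule Complex.DeMoivre)
      also have "real (2 * nat (- k)) * (- (pi * t)) = 2 * pi * (real_of_int k * t)" using False by simp
      finally show ?thesis using False by simp
    qed
    then show "complex_of_real (cos_coeff M k) * (if k \<ge> 0 then cis (pi * t) ^ (2 * nat k) else cis (- (pi * t)) ^ (2 * nat (- k)))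
        = cos_coeff M k *\<^sub>R cis (2 * pi * (real_of_int k * t))"
      by (simp only: scaleR_conv_of_real)
  qed
  finally show ?thesis .
qed

lemma sum_cos_coeff: "(\<Sum>k\<in>{- int M..int M}. cos_coeff M k) = 1"
  using exp_sum_cos_coeff[of "1::real" 1 M, unfolded power_one if_cancel] by simp

lemma cosh_le_one_plus_square:
  assumes "0 \<le> y" "y \<le> (1::real)"
  shows "(exp y + exp (- y)) / 2 \<le> 1 + y\<^sup>2"
proof -
  have 1: "exp y \<le> 1 + y + y\<^sup>2" by (rule exp_bound[OF assms])
  have "(1 - y + y\<^sup>2) * exp y \<ge> (1 - y + y\<^sup>2) * (1 + y)"
    using exp_ge_add_one_self[of y] assms
    by (intro mult_left_mono) (auto simp: power2_eq_square intro: add_nonneg_nonneg)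
  also have "(1 - y + y\<^sup>2) * (1 + y) = 1 + y ^ 3" by (simp add: power2_eq_square power3_eq_cube algebra_simps)
  finally have "(1 - y + y\<^sup>2) * exp y \<ge> 1" using assms by (smt (verit) zero_le_power)
  then have "exp (- y) \<le> 1 - y + y\<^sup>2" by (simp add: exp_minus field_simps)
  with 1 show ?thesis by simp
qed

text \<open>A Chernoff bound: the coefficients are the distribution of a centred binomial variable
  with standard deviation of order sqrt M, whose exponential moments at parameter 1/sqrt M are at
  most 2 on either side.\<close>

lemma cos_coeff_tail:
  assumes M: "M \<ge> 1"
  shows "(\<Sum>k\<in>{k \<in> {- int M..int M}. real_of_int \<bar>k\<bar> > R}. cos_coeff M k) \<le> 4 * exp (- R / sqrt (real M))"
proof -
  define y where "y = 1 / (2 * sqrt (real M))"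
  have "1 / (2 * r) \<le> 1" if "r \<ge> 1" for r :: real using that by simp
  from this[of "sqrt (real M)"] have y: "0 \<le> y" "y \<le> 1" using M by (simp_all add: y_def)
  have y2: "y\<^sup>2 = 1 / (4 * real M)" using M by (simp add: y_def power_divide power_mult_distrib)
  have "((exp y + exp (- y)) / 2) ^ (2 * M) \<le> (1 + y\<^sup>2) ^ (2 * M)"
    using cosh_le_one_plus_square[OF y] by (intro power_mono) auto
  also have "\<dots> \<le> exp (y\<^sup>2) ^ (2 * M)" using exp_ge_add_one_self[of "y\<^sup>2"] by (intro power_mono) auto
  also have "\<dots> = exp (real (2 * M) * y\<^sup>2)" by (simp only: exp_of_nat_mult)
  also have "\<dots> = exp (1 / 2)" using M by (simp add: y2)
  also have "\<dots> \<le> 2" using exp_bound[of "1/2::real"] by (simp add: power2_eq_square)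
  finally have c: "((exp y + exp (- y)) / 2) ^ (2 * M) \<le> 2" .
  have e: "(if k \<ge> 0 then exp y ^ (2 * nat k) else exp (- y) ^ (2 * nat (- k))) = exp (2 * y * real_of_int k)" for k :: int
    by (cases "k \<ge> 0") (simp_all only: if_True if_False not_le exp_of_nat_mult [symmetric], simp_all)
  have e': "(if k \<ge> 0 then exp (- y) ^ (2 * nat k) else exp y ^ (2 * nat (- k))) = exp (- (2 * y * real_of_int k))" for k :: int
    by (cases "k \<ge> 0") (simp_all only: if_True if_False not_le exp_of_nat_mult [symmetric], simp_all)
  have s1: "(\<Sum>k\<in>{- int M..int M}. cos_coeff M k * exp (2 * y * real_of_int k)) \<le> 2"
    using exp_sum_cos_coeff[of "exp y" "exp (- y)" M] c by (simp add: e exp_minus_inverse)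
  have s2: "(\<Sum>k\<in>{- int M..int M}. cos_coeff M k * exp (- (2 * y * real_of_int k))) \<le> 2"
    using exp_sum_cos_coeff[of "exp (- y)" "exp y" M] c
    by (simp add: e' exp_minus_inverse mult.commute add.commute)
  have "(\<Sum>k\<in>{k \<in> {- int M..int M}. real_of_int \<bar>k\<bar> > R}. cos_coeff M k)
      \<le> (\<Sum>k\<in>{k \<in> {- int M..int M}. real_of_int \<bar>k\<bar> > R}. cos_coeff M k *
        ((exp (2 * y * real_of_int k) + exp (- (2 * y * real_of_int k))) * exp (- (2 * y * R))))"
  proof (rule sum_mono)
    fix k assume k: "k \<in> {k \<in> {- int M..int M}. real_of_int \<bar>k\<bar> > R}"
    have "1 \<le> exp (2 * y * real_of_int \<bar>k\<bar>) * exp (- (2 * y * R))"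
      using k y by (auto simp: exp_add [symmetric] intro!: mult_left_mono)
    also have "\<dots> \<le> (exp (2 * y * real_of_int k) + exp (- (2 * y * real_of_int k))) * exp (- (2 * y * R))"
      by (intro mult_right_mono) (auto simp: abs_if)
    finally have "cos_coeff M k * 1 \<le> cos_coeff M k * ((exp (2 * y * real_of_int k) + exp (- (2 * y * real_of_int k))) * exp (- (2 * y * R)))"
      by (intro mult_left_mono cos_coeff_nonneg)
    then show "cos_coeff M k \<le> cos_coeff M k * ((exp (2 * y * real_of_int k) + exp (- (2 * y * real_of_int k))) * exp (- (2 * y * R)))"
      by simp
  qed
  also have "\<dots> \<le> (\<Sum>k\<in>{- int M..int M}. cos_coeff M k *
        ((exp (2 * y * real_of_int k) + exp (- (2 * y * real_of_int k))) * exp (- (2 * y * R))))"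
    by (intro sum_mono2) (auto intro!: mult_nonneg_nonneg cos_coeff_nonneg)
  also have "\<dots> = ((\<Sum>k\<in>{- int M..int M}. cos_coeff M k * exp (2 * y * real_of_int k))
      + (\<Sum>k\<in>{- int M..int M}. cos_coeff M k * exp (- (2 * y * real_of_int k)))) * exp (- (2 * y * R))"
    unfolding sum.distrib [symmetric] sum_distrib_right
    by (intro sum.cong refl) (simp add: distrib_left distrib_right mult_ac)
  also have "\<dots> \<le> 4 * exp (- (2 * y * R))" using s1 s2 by (intro mult_right_mono) auto
  also have "- (2 * y * R) = - R / sqrt (real M)" by (simp add: y_def)
  finally show ?thesis .
qed

lemma cos_coeff_0_Suc: "cos_coeff (Suc n) 0 = cos_coeff n 0 * ((2 * real n + 1) / (2 * real n + 2))"
proof -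
  have "Suc n * (Suc (2 * n) choose Suc n) = Suc (2 * n) * ((2 * n) choose n)"
    by (rule Suc_times_binomial)
  then have a: "real (Suc (2 * n) choose Suc n) = (2 * real n + 1) * real ((2 * n) choose n) / (real n + 1)"
    by (simp add: field_simps flip: of_nat_mult of_nat_Suc)
  have "(2 * Suc n) choose Suc n = (Suc (2 * n) choose n) + (Suc (2 * n) choose Suc n)" by simp
  also have "Suc (2 * n) choose n = Suc (2 * n) choose Suc n"
    by (subst binomial_symmetric) auto
  finally have "real ((2 * Suc n) choose Suc n) = 2 * ((2 * real n + 1) * real ((2 * n) choose n) / (real n + 1))"
    using a by simp
  then have "cos_coeff (Suc n) 0 = 2 * ((2 * real n + 1) * real ((2 * n) choose n) / (real n + 1)) / 4 ^ Suc n"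
    by (simp only: cos_coeff_def) (simp add: nat_add_distrib)
  then show ?thesis by (simp add: cos_coeff_def divide_simps)
qed

text \<open>The recursion for the central coefficient makes the Wallis product telescope; its limit
  then yields the exact asymptotics of the mean.\<close>

lemma cos_coeff_0_Wallis:
  "(\<Prod>k=1..n. (4 * real k^2) / (4 * real k^2 - 1)) = 1 / ((cos_coeff n 0)\<^sup>2 * (2 * real n + 1))"
proof (induction n)
  case 0
  then show ?case by (simp add: cos_coeff_def)
next
  case (Suc n)
  have p: "cos_coeff n 0 > 0" by (simp add: cos_coeff_def)
  have gen: "1 / (c\<^sup>2 * A) * (B\<^sup>2 / (A * E)) = 1 / ((c * (A / B))\<^sup>2 * E)"
    if "c > 0" "A > 0" "B > 0" "E > 0" for c A B E :: real
    using that by (simp add: divide_simps power2_eq_square)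
  have "(\<Prod>k=1..Suc n. (4 * real k^2) / (4 * real k^2 - 1))
      = 1 / ((cos_coeff n 0)\<^sup>2 * (2 * real n + 1)) * ((4 * (real (Suc n))^2) / (4 * (real (Suc n))^2 - 1))"
    using Suc by simp
  also have "4 * (real (Suc n))^2 = (2 * real n + 2)\<^sup>2"
    by (simp add: power2_eq_square algebra_simps)
  also have "(2 * real n + 2)\<^sup>2 - 1 = (2 * real n + 1) * (2 * real (Suc n) + 1)"
    by (simp add: power2_eq_square algebra_simps)
  also have "1 / ((cos_coeff n 0)\<^sup>2 * (2 * real n + 1)) * ((2 * real n + 2)\<^sup>2 / ((2 * real n + 1) * (2 * real (Suc n) + 1)))
      = 1 / ((cos_coeff (Suc n) 0)\<^sup>2 * (2 * real (Suc n) + 1))"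
    unfolding cos_coeff_0_Suc using p by (intro gen) auto
  finally show ?case .
qed

lemma cos_coeff_0_asymp: "(\<lambda>n. cos_coeff n 0 * sqrt (real n)) \<longlonglongrightarrow> 1 / sqrt pi"
proof -
  have p: "cos_coeff n 0 > 0" for n by (simp add: cos_coeff_def)
  have "(\<lambda>n. 1 / ((cos_coeff n 0)\<^sup>2 * (2 * real n + 1))) \<longlonglongrightarrow> pi / 2"
    using wallis unfolding cos_coeff_0_Wallis .
  then have "(\<lambda>n. inverse (1 / ((cos_coeff n 0)\<^sup>2 * (2 * real n + 1)))) \<longlonglongrightarrow> inverse (pi / 2)"
    by (intro tendsto_inverse) auto
  moreover have "(\<lambda>n. real n / (2 * real n + 1)) \<longlonglongrightarrow> 1 / 2" by real_asymp
  ultimately have "(\<lambda>n. inverse (1 / ((cos_coeff n 0)\<^sup>2 * (2 * real n + 1))) * (real n / (2 * real n + 1)))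
      \<longlonglongrightarrow> inverse (pi / 2) * (1 / 2)" by (intro tendsto_mult)
  moreover have "inverse (1 / ((cos_coeff n 0)\<^sup>2 * (2 * real n + 1))) * (real n / (2 * real n + 1)) = (cos_coeff n 0)\<^sup>2 * real n" for n
    by (simp add: field_simps)
  ultimately have "(\<lambda>n. (cos_coeff n 0)\<^sup>2 * real n) \<longlonglongrightarrow> 1 / pi" by simp
  then have "(\<lambda>n. sqrt ((cos_coeff n 0)\<^sup>2 * real n)) \<longlonglongrightarrow> sqrt (1 / pi)" by (rule tendsto_real_sqrt)
  then show ?thesis using p by (simp add: real_sqrt_mult real_sqrt_divide less_imp_le)
qed

section \<open>Almost sure convergence of smoothed pair sums\<close>

text \<open>Borel-Cantelli in integral form: on each box the sum of |f_i|^2 over i \<ge> i0 has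
  finite integral, so it is finite almost everywhere and its terms vanish in the limit. Here i0 may
  depend on the box, as the Gaussian has to be wider than the box; countably many boxes cover the
  space.\<close>

lemma AE_tendsto_zero_of_box_integrals:
  fixes f :: "nat \<Rightarrow> real^'d \<Rightarrow> complex"
  assumes meas [measurable]: "\<And>i. f i \<in> borel_measurable borel"
    and bound: "\<And>A :: nat. \<exists>i0 C. \<forall>i\<ge>i0. (\<integral>\<^sup>+\<alpha>. ennreal (indicator {\<alpha>. \<forall>l. \<bar>\<alpha> $ l\<bar> \<le> real A} \<alpha> * (cmod (f i \<alpha>))\<^sup>2) \<partial>lborel)
      \<le> ennreal (C / real (Suc i) ^ 2)"
  shows "AE \<alpha> in lborel. (\<lambda>i. f i \<alpha>) \<longlonglongrightarrow> 0"
proof -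
  have "AE \<alpha> in lborel. (\<forall>l. \<bar>\<alpha> $ l\<bar> \<le> real A) \<longrightarrow> (\<lambda>i. f i \<alpha>) \<longlonglongrightarrow> 0" for A :: nat
  proof -
    obtain i0 C where C: "\<And>i. i \<ge> i0 \<Longrightarrow> (\<integral>\<^sup>+\<alpha>. ennreal (indicator {\<alpha>. \<forall>l. \<bar>\<alpha> $ l\<bar> \<le> real A} \<alpha> * (cmod (f i \<alpha>))\<^sup>2) \<partial>lborel)
      \<le> ennreal (C / real (Suc i) ^ 2)" using bound[of A] by blast
    define h where "h = (\<lambda>i \<alpha>. indicator {\<alpha>. \<forall>l. \<bar>\<alpha> $ l\<bar> \<le> real A} \<alpha> * (cmod (f (i + i0) \<alpha>))\<^sup>2 :: real)"
    have [measurable]: "{\<alpha> :: real^'d. \<forall>l. \<bar>\<alpha> $ l\<bar> \<le> real A} \<in> sets borel"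
    proof -
      have "{\<alpha> :: real^'d. \<forall>l. \<bar>\<alpha> $ l\<bar> \<le> real A} = cbox (\<chi> l. - real A) (\<chi> l. real A)"
        by (auto simp: mem_box_cart abs_le_iff) (metis minus_le_iff)+
      then show ?thesis by simp
    qed
    have h_meas [measurable]: "h i \<in> borel_measurable lborel" for i
      unfolding h_def by measurable
    have h0: "h i \<alpha> \<ge> 0" for i \<alpha> by (simp add: h_def)
    have sm: "summable (\<lambda>i. \<bar>C\<bar> / real (Suc i) ^ 2)"
    proof -
      have "summable (\<lambda>n. inverse (real n ^ 2))" by (rule inverse_power_summable) simp
      then have "summable (\<lambda>n. inverse (real (Suc n) ^ 2))" by (subst summable_Suc_iff)
      then show ?thesis using summable_mult[of _ "\<bar>C\<bar>"] by (simp add: divide_inverse)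
    qed
    have "(\<integral>\<^sup>+\<alpha>. (\<Sum>i. ennreal (h i \<alpha>)) \<partial>lborel) = (\<Sum>i. \<integral>\<^sup>+\<alpha>. ennreal (h i \<alpha>) \<partial>lborel)"
      by (rule nn_integral_suminf) measurable
    also have "\<dots> \<le> (\<Sum>i. ennreal (\<bar>C\<bar> / real (Suc i) ^ 2))"
    proof (rule suminf_le)
      fix i
      have "(\<integral>\<^sup>+\<alpha>. ennreal (h i \<alpha>) \<partial>lborel) \<le> ennreal (C / real (Suc (i + i0)) ^ 2)"
        unfolding h_def by (rule C) simp
      also have "\<dots> \<le> ennreal (\<bar>C\<bar> / real (Suc i) ^ 2)"
        by (intro ennreal_leI frac_le power_mono) auto
      finally show "(\<integral>\<^sup>+\<alpha>. ennreal (h i \<alpha>) \<partial>lborel) \<le> ennreal (\<bar>C\<bar> / real (Suc i) ^ 2)" .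
    qed auto
    also have "\<dots> = ennreal (\<Sum>i. \<bar>C\<bar> / real (Suc i) ^ 2)"
      using sm by (intro suminf_ennreal2) auto
    also have "\<dots> < \<infinity>" by simp
    finally have "AE \<alpha> in lborel. (\<Sum>i. ennreal (h i \<alpha>)) \<noteq> \<infinity>"
      by (intro nn_integral_PInf_AE) auto
    then show ?thesis
    proof (rule AE_mp, intro AE_I2 impI)
      fix \<alpha> :: "real^'d"
      assume fin: "(\<Sum>i. ennreal (h i \<alpha>)) \<noteq> \<infinity>" and box: "\<forall>l. \<bar>\<alpha> $ l\<bar> \<le> real A"
      have "summable (\<lambda>i. h i \<alpha>)"
        using fin h0 by (intro summable_suminf_not_top) auto
      then have "(\<lambda>i. h i \<alpha>) \<longlonglongrightarrow> 0" by (rule summable_LIMSEQ_zero)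
      then have "(\<lambda>i. (cmod (f (i + i0) \<alpha>))\<^sup>2) \<longlonglongrightarrow> 0" using box by (simp add: h_def)
      then have "(\<lambda>i. sqrt ((cmod (f (i + i0) \<alpha>))\<^sup>2)) \<longlonglongrightarrow> sqrt 0" by (rule tendsto_real_sqrt)
      then have "(\<lambda>i. f (i + i0) \<alpha>) \<longlonglongrightarrow> 0" by (simp add: tendsto_norm_zero_iff)
      then show "(\<lambda>i. f i \<alpha>) \<longlonglongrightarrow> 0" by (rule LIMSEQ_offset)
    qed
  qed
  then have "AE \<alpha> in lborel. \<forall>A :: nat. (\<forall>l. \<bar>\<alpha> $ l\<bar> \<le> real A) \<longrightarrow> (\<lambda>i. f i \<alpha>) \<longlonglongrightarrow> 0"
    unfolding AE_all_countable by blast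
  then show ?thesis
  proof (rule AE_mp, intro AE_I2 impI)
    fix \<alpha> :: "real^'d"
    assume a: "\<forall>A :: nat. (\<forall>l. \<bar>\<alpha> $ l\<bar> \<le> real A) \<longrightarrow> (\<lambda>i. f i \<alpha>) \<longlonglongrightarrow> 0"
    have "\<bar>\<alpha> $ l\<bar> \<le> real (nat \<lceil>norm \<alpha>\<rceil>)" for l
      using component_le_norm_cart[of \<alpha> l] by linarith
    then show "(\<lambda>i. f i \<alpha>) \<longlonglongrightarrow> 0" using a by blast
  qed
qed

section \<open>The truncated frequency sum and its collisions\<close>

definition freqs :: "('d \<Rightarrow> nat) \<Rightarrow> nat \<Rightarrow> ('d \<Rightarrow> int) set" where
  "freqs M K = {k \<in> PiE UNIV (\<lambda>l. {- int (M l)..int (M l)}). k \<noteq> (\<lambda>_. 0) \<and> (\<forall>l. \<bar>k l\<bar> \<le> int K)}"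

lemma finite_freqs [simp]: "finite (freqs (M :: 'd::finite \<Rightarrow> nat) K)"
proof (rule finite_subset)
  show "freqs M K \<subseteq> PiE UNIV (\<lambda>l. {- int (M l)..int (M l)})" by (auto simp: freqs_def)
qed (intro finite_PiE, auto)

definition dilated_gap :: "(nat \<Rightarrow> real^'d) \<Rightarrow> (nat \<times> nat) \<times> ('d \<Rightarrow> int) \<Rightarrow> real^'d" where
  "dilated_gap x = (\<lambda>(s, k). \<chi> l. real_of_int (k l) * gap_vec x UNIV s l)"

text \<open>The 2 accounts for both orders of an index pair.\<close>

definition amplitude :: "('d \<Rightarrow> nat) \<Rightarrow> nat \<Rightarrow> (nat \<times> nat) \<times> ('d::finite \<Rightarrow> int) \<Rightarrow> real" where
  "amplitude M N = (\<lambda>(s, k). 2 / real N * (\<Prod>l\<in>UNIV. cos_coeff (M l) (k l)))"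

lemma amplitude_nonneg: "amplitude M N i \<ge> 0"
  by (cases i) (auto simp: amplitude_def intro!: divide_nonneg_nonneg mult_nonneg_nonneg prod_nonneg cos_coeff_nonneg)

text \<open>The sign patterns of nonzero frequency vectors; the support of such a pattern is the set
  D' of the energy hypothesis.\<close>

definition sign_vectors :: "('d \<Rightarrow> int) set" where
  "sign_vectors = PiE UNIV (\<lambda>_. {-1, 0, 1}) - {\<lambda>_. 0}"

lemma finite_sign_vectors [simp]: "finite (sign_vectors :: ('d::finite \<Rightarrow> int) set)"
  unfolding sign_vectors_def by (intro finite_Diff finite_PiE) auto

text \<open>A nonzero integer multiple of a number at least c has absolute value at least c and the
  sign of the integer, so different signs force a distance of at least c > e.\<close>

lemma sgn_eq_of_close:
  fixes k k' :: int and z w :: real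
  assumes "z \<ge> c" "w \<ge> c" "c > 0" "e < c" "\<bar>real_of_int k * z - real_of_int k' * w\<bar> \<le> e"
  shows "sgn k = sgn k'"
proof -
  have pos: "real_of_int i * y \<ge> c" if "i > 0" "y \<ge> c" for i :: int and y
  proof -
    have "1 * c \<le> real_of_int i * y" using that assms by (intro mult_mono) auto
    then show ?thesis by simp
  qed
  have neg: "real_of_int i * y \<le> - c" if "i < 0" "y \<ge> c" for i :: int and y
    using pos[of "- i" y] that by simp
  show ?thesis
  proof (cases k "0 :: int" rule: linorder_cases)
    case less
    then show ?thesis using neg[OF less assms(1)] pos[of k' w] assms
      by (cases k' "0 :: int" rule: linorder_cases) auto
  next
    case equal
    then show ?thesis using neg[of k' w] pos[of k' w] assms
      by (cases k' "0 :: int" rule: linorder_cases) auto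
  next
    case greater
    then show ?thesis using pos[OF greater assms(1)] neg[of k' w] assms
      by (cases k' "0 :: int" rule: linorder_cases) auto
  qed
qed

lemma gap_vec_ge:
  fixes x :: "nat \<Rightarrow> real^'d"
  assumes c: "c > 0" and sep: "\<And>l n. n \<ge> 1 \<Longrightarrow> x (n + 1) $ l - x n $ l \<ge> c" and s: "s \<in> index_pairs N"
  shows "gap_vec x UNIV s l \<ge> c"
proof -
  have "real (snd s - fst s) \<ge> 1" using s by (auto simp: index_pairs_def)
  then have "c * 1 \<le> c * real (snd s - fst s)" using c by (intro mult_left_mono) auto
  moreover have "gap_vec x UNIV s l \<ge> c * real (snd s - fst s)"
    using s separated_difference[where x = x and c = c and m = "fst s" and n = "snd s" and l = l] sep
    by (auto simp: gap_vec_def index_pairs_def)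
  ultimately show ?thesis by simp
qed

text \<open>Close pairs share their sign pattern, because all gaps are at least c. Removing the
  signs and freezing the coordinates with k_l = 0 produces a collision for the support of the
  pattern, and the pattern makes this reversible.\<close>

lemma card_close_signed_le:
  fixes x :: "nat \<Rightarrow> real^'d" and M :: "'d \<Rightarrow> nat"
  assumes c: "c > 0" and sep: "\<And>l n. n \<ge> 1 \<Longrightarrow> x (n + 1) $ l - x n $ l \<ge> c" and \<eta>: "\<eta> > 0" "8 * \<eta> \<le> c"
  shows "card (close_pairs ((\<chi> l. \<eta>) /\<^sub>R 2) (index_pairs N \<times> freqs M K) (dilated_gap x))
    \<le> (\<Sum>\<sigma>\<in>sign_vectors. card (gap_collisions \<eta> x {l. \<sigma> l \<noteq> 0} N K))"
proof -
  let ?CP = "close_pairs ((\<chi> l. \<eta>) /\<^sub>R 2) (index_pairs N \<times> freqs M K) (dilated_gap x)"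
  let ?CQ = "\<lambda>\<sigma>. gap_collisions \<eta> x {l. \<sigma> l \<noteq> 0} N K"
  define ab :: "('d \<Rightarrow> int) \<Rightarrow> 'd \<Rightarrow> nat" where "ab = (\<lambda>k l. if k l = 0 then 1 else nat \<bar>k l\<bar>)"
  define sg :: "('d \<Rightarrow> int) \<Rightarrow> 'd \<Rightarrow> int" where "sg = (\<lambda>k l. sgn (k l))"
  define g where "g = (\<lambda>((s :: nat \<times> nat, k), (s' :: nat \<times> nat, k')). (sg k, ((s, ab k), (s', ab k'))))"
  have gv: "gap_vec x UNIV s l \<ge> c" if "s \<in> index_pairs N" for s l
    using c sep that by (intro gap_vec_ge) auto
  have rec: "k = k'" if "sg k = sg k'" "ab k = ab k'" for k k'
  proof
    fix l
    have "sgn (k l) = sgn (k' l)" "(if k l = 0 then 1 else nat \<bar>k l\<bar>) = (if k' l = 0 then 1 else nat \<bar>k' l\<bar>)"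
      using fun_cong[OF that(1), of l] fun_cong[OF that(2), of l] by (simp_all add: sg_def ab_def)
    then show "k l = k' l" by (auto simp: sgn_if split: if_splits)
  qed
  have P: "s \<in> index_pairs N \<and> s' \<in> index_pairs N \<and> k \<in> freqs M K \<and> k' \<in> freqs M K \<and> sg k = sg k' \<and>
      (\<forall>l. \<bar>real_of_int (k l) * gap_vec x UNIV s l - real_of_int (k' l) * gap_vec x UNIV s' l\<bar> \<le> \<eta> / 2)"
    if "((s, k), (s', k')) \<in> ?CP" for s k s' k'
  proof -
    have m: "s \<in> index_pairs N" "s' \<in> index_pairs N" "k \<in> freqs M K" "k' \<in> freqs M K"
      and cl: "\<And>l. \<bar>real_of_int (k l) * gap_vec x UNIV s l - real_of_int (k' l) * gap_vec x UNIV s' l\<bar> \<le> \<eta> / 2"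
      using that by (auto simp: close_pairs_def close_points_def dilated_gap_def)
    have "sgn (k l) = sgn (k' l)" for l
      using gv[OF m(1), of l] gv[OF m(2), of l] cl[of l] c \<eta>
      by (intro sgn_eq_of_close[where c = c and e = "\<eta> / 2"]) auto
    then show ?thesis using m cl by (simp add: sg_def)
  qed
  have inj: "inj_on g ?CP"
  proof (rule inj_onI)
    fix a b assume a: "a \<in> ?CP" and b: "b \<in> ?CP" and eq: "g a = g b"
    obtain s1 k1 s1' k1' where a': "a = ((s1, k1), (s1', k1'))" by (metis surj_pair)
    obtain s2 k2 s2' k2' where b': "b = ((s2, k2), (s2', k2'))" by (metis surj_pair)
    have "sg k1 = sg k1'" "sg k2 = sg k2'" using P a b a' b' by blast+
    moreover have "sg k1 = sg k2" "ab k1 = ab k2" "ab k1' = ab k2'" "s1 = s2" "s1' = s2'"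
      using eq by (auto simp: g_def a' b')
    ultimately show "a = b" unfolding a' b' using rec by metis
  qed
  have img: "g ` ?CP \<subseteq> (SIGMA \<sigma>:sign_vectors. ?CQ \<sigma>)"
  proof
    fix y assume "y \<in> g ` ?CP"
    then obtain s k s' k' where cp: "((s, k), (s', k')) \<in> ?CP" and y: "y = (sg k, ((s, ab k), (s', ab k')))"
      by (auto simp: g_def)
    note p = P[OF cp]
    have k0: "k \<noteq> (\<lambda>_. 0)" using p by (auto simp: freqs_def)
    have sgv: "sg k \<in> sign_vectors"
    proof -
      have "sg k \<noteq> (\<lambda>_. 0)"
      proof
        assume "sg k = (\<lambda>_. 0)"
        then have "k l = 0" for l by (auto simp: sg_def sgn_0_0 dest!: fun_cong[of _ _ l])
        then show False using k0 by blast
      qed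
      moreover have "sg k l \<in> {-1, 0, 1}" for l by (auto simp: sg_def sgn_if)
      ultimately show ?thesis by (auto simp: sign_vectors_def)
    qed
    have fb: "ab k1 \<in> freq_box {l. sg k l \<noteq> 0} K" if "k1 \<in> freqs M K" "sg k = sg k1" for k1
    proof -
      have "\<bar>k1 l\<bar> \<le> int K" for l using that by (auto simp: freqs_def)
      then show ?thesis unfolding freq_box_def that(2)
        by (auto simp: ab_def sg_def sgn_0_0 nat_le_iff)
    qed
    have "\<bar>real (ab k l) * gap_vec x {l. sg k l \<noteq> 0} s l - real (ab k' l) * gap_vec x {l. sg k l \<noteq> 0} s' l\<bar> \<le> \<eta> / 2" for l
    proof (cases "k l = 0")
      case True
      have "sg k l = sg k' l" using p by simp
      then have "k' l = 0" using True by (simp add: sg_def sgn_0_0)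
      then show ?thesis using True \<eta> by (simp add: ab_def sg_def gap_vec_def case_prod_unfold)
    next
      case False
      have "sg k l = sg k' l" using p by simp
      then have ss: "sgn (k l) = sgn (k' l)" by (simp add: sg_def)
      then have k': "k' l \<noteq> 0" using False by (metis sgn_0_0)
      have g: "gap_vec x {l. sg k l \<noteq> 0} t l = gap_vec x UNIV t l" for t
        using False by (simp add: gap_vec_def sg_def sgn_0_0 case_prod_unfold)
      have r: "real (ab k l) = real_of_int (sgn (k l)) * real_of_int (k l)"
        "real (ab k' l) = real_of_int (sgn (k l)) * real_of_int (k' l)"
        using False k' ss by (auto simp: ab_def sgn_if split: if_splits)
      have "\<bar>real_of_int (sgn (k l)) * (real_of_int (k l) * gap_vec x UNIV s l - real_of_int (k' l) * gap_vec x UNIV s' l)\<bar> \<le> \<eta> / 2"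
        using p False by (auto simp: sgn_if abs_minus_commute abs_mult)
      then show ?thesis unfolding g r by (simp add: algebra_simps)
    qed
    then show "y \<in> (SIGMA \<sigma>:sign_vectors. ?CQ \<sigma>)"
      using sgv fb[of k] fb[of k'] p unfolding y by (auto simp: close_pairs_def close_points_def)
  qed
  have fin: "finite (?CQ \<sigma>)" for \<sigma> by simp
  have "card ?CP \<le> card (SIGMA \<sigma>:sign_vectors. ?CQ \<sigma>)"
    using fin by (intro card_inj_on_le[OF inj img]) auto
  also have "\<dots> = (\<Sum>\<sigma>\<in>sign_vectors. card (?CQ \<sigma>))" using fin by simp
  finally show ?thesis .
qed

lemma sum_close_amplitude_le:
  fixes x :: "nat \<Rightarrow> real^'d" and M :: "'d \<Rightarrow> nat"
  shows "(\<Sum>(i, j)\<in>close_pairs t (index_pairs N \<times> freqs M K) p. amplitude M N i * amplitude M N j)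
    \<le> (2 / real N * (\<Prod>l\<in>UNIV. cos_coeff (M l) 0))\<^sup>2 * card (close_pairs t (index_pairs N \<times> freqs M K) p)"
proof -
  let ?A = "2 / real N * (\<Prod>l\<in>UNIV. cos_coeff (M l) 0)"
  have le: "amplitude M N i \<le> ?A" for i :: "(nat \<times> nat) \<times> ('d \<Rightarrow> int)"
  proof (cases i)
    case (Pair s k)
    show ?thesis unfolding Pair amplitude_def case_prod_conv
      by (intro mult_left_mono prod_mono conjI cos_coeff_nonneg cos_coeff_le) auto
  qed
  have A0: "?A \<ge> 0" by (intro mult_nonneg_nonneg prod_nonneg cos_coeff_nonneg) auto
  have "(\<Sum>(i, j)\<in>close_pairs t (index_pairs N \<times> freqs M K) p. amplitude M N i * amplitude M N j)
      \<le> (\<Sum>(i, j)\<in>close_pairs t (index_pairs N \<times> freqs M K) p. ?A * ?A)"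
  proof (rule sum_mono)
    fix ij
    have "amplitude M N (fst ij) * amplitude M N (snd ij) \<le> ?A * ?A"
      by (rule mult_mono[OF le le A0 amplitude_nonneg])
    then show "(case ij of (i, j) \<Rightarrow> amplitude M N i * amplitude M N j) \<le> (case ij of (i, j) \<Rightarrow> ?A * ?A)"
      by (simp only: case_prod_unfold)
  qed
  also have "\<dots> = ?A\<^sup>2 * card (close_pairs t (index_pairs N \<times> freqs M K) p)"
    by (simp add: case_prod_unfold power2_eq_square)
  finally show ?thesis .
qed

lemma card_index_pairs: "real (card (index_pairs N)) = real N * (real N - 1) / 2"
proof -
  have "index_pairs N = (\<lambda>(n, m). (m, n)) ` (SIGMA n:{1..N}. {1..<n})"
    by (auto simp: index_pairs_def image_iff)
  then have "card (index_pairs N) = card (SIGMA n:{1..N}. {1..<n})"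
    by (simp add: card_image inj_on_def)
  also have "\<dots> = (\<Sum>n\<in>{1..N}. n - 1)" by simp
  finally have "real (card (index_pairs N)) = real (\<Sum>n\<in>{1..N}. n - 1)" by (rule arg_cong)
  also have "\<dots> = real N * (real N - 1) / 2"
  proof (induction N)
    case (Suc N)
    have "real (\<Sum>n\<in>{1..Suc N}. n - 1) = real (\<Sum>n\<in>{1..N}. n - 1) + real N" by simp
    also note Suc.IH
    finally show ?case by (simp add: field_simps)
  qed simp
  finally show ?thesis .
qed

lemma sum_prod_cos_coeff:
  fixes M :: "'d::finite \<Rightarrow> nat"
  shows "(\<Sum>k\<in>PiE UNIV (\<lambda>l. {- int (M l)..int (M l)}). \<Prod>l\<in>UNIV. cos_coeff (M l) (k l)) = 1"
  by (subst prod_sum_PiE [symmetric]) (auto simp: sum_cos_coeff)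

lemma sum_amplitude_le:
  assumes "N \<ge> 1"
  shows "(\<Sum>i\<in>index_pairs N \<times> freqs M K. amplitude M N i) \<le> real N"
proof -
  let ?P = "PiE UNIV (\<lambda>l. {- int (M l)..int (M l)})"
  have finP: "finite ?P" by (intro finite_PiE) auto
  have "(\<Sum>i\<in>index_pairs N \<times> freqs M K. amplitude M N i) \<le> (\<Sum>i\<in>index_pairs N \<times> ?P. amplitude M N i)"
    using finP by (intro sum_mono2 amplitude_nonneg) (auto simp: freqs_def)
  also have "\<dots> = (\<Sum>s\<in>index_pairs N. 2 / real N * (\<Sum>k\<in>?P. \<Prod>l\<in>UNIV. cos_coeff (M l) (k l)))"
    by (simp add: amplitude_def sum_distrib_left flip: sum.cartesian_product)
  also have "\<dots> = real N - 1"
    using assms by (simp add: sum_prod_cos_coeff card_index_pairs)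
  finally show ?thesis by simp
qed

lemma sum_amplitude_tail_le:
  fixes M :: "'d::finite \<Rightarrow> nat"
  assumes N: "N \<ge> 1" and M: "\<And>l. M l \<ge> 1"
  shows "(\<Sum>i\<in>index_pairs N \<times> {k \<in> PiE UNIV (\<lambda>l. {- int (M l)..int (M l)}). \<exists>l. \<bar>k l\<bar> > int K}. amplitude M N i)
    \<le> real N * (\<Sum>l\<in>UNIV. 4 * exp (- real K / sqrt (real (M l))))"
proof -
  let ?P = "PiE (UNIV :: 'd set) (\<lambda>l. {- int (M l)..int (M l)})"
  let ?w = "\<lambda>k. \<Prod>l\<in>UNIV. cos_coeff (M l) (k l)"
  have finP: "finite ?P" by (intro finite_PiE) auto
  have w0: "?w k \<ge> 0" for k by (intro prod_nonneg cos_coeff_nonneg)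
  have "(\<Sum>k\<in>{k \<in> ?P. \<exists>l. \<bar>k l\<bar> > int K}. ?w k) \<le> (\<Sum>k\<in>{k \<in> ?P. \<exists>l. \<bar>k l\<bar> > int K}. \<Sum>l\<in>UNIV. if \<bar>k l\<bar> > int K then ?w k else 0)"
  proof (rule sum_mono)
    fix k assume "k \<in> {k \<in> ?P. \<exists>l. \<bar>k l\<bar> > int K}"
    then obtain l where l: "\<bar>k l\<bar> > int K" by auto
    have "(if \<bar>k l\<bar> > int K then ?w k else 0) \<le> (\<Sum>l\<in>UNIV. if \<bar>k l\<bar> > int K then ?w k else 0)"
      using w0 by (intro member_le_sum) auto
    then show "?w k \<le> (\<Sum>l\<in>UNIV. if \<bar>k l\<bar> > int K then ?w k else 0)" using l by simp
  qed
  also have "\<dots> \<le> (\<Sum>k\<in>?P. \<Sum>l\<in>UNIV. if \<bar>k l\<bar> > int K then ?w k else 0)"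
    using finP w0 by (intro sum_mono2) (auto intro!: sum_nonneg)
  also have "\<dots> = (\<Sum>l\<in>UNIV. \<Sum>k\<in>?P. if \<bar>k l\<bar> > int K then ?w k else 0)" by (rule sum.swap)
  also have "\<dots> \<le> (\<Sum>l\<in>UNIV. 4 * exp (- real K / sqrt (real (M l))))"
  proof (rule sum_mono)
    fix l :: 'd
    \<comment> \<open>A union bound over the coordinates: cutting off only coordinate l keeps the
      product form, so all other coordinates sum to 1.\<close>
    let ?f = "\<lambda>l' i. if l' = l \<and> \<not> \<bar>i\<bar> > int K then 0 else cos_coeff (M l') i"
    have "(\<Sum>k\<in>?P. if \<bar>k l\<bar> > int K then ?w k else 0) = (\<Sum>k\<in>?P. \<Prod>l'\<in>UNIV. ?f l' (k l'))"
    proof (rule sum.cong[OF refl])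
      fix k
      show "(if \<bar>k l\<bar> > int K then ?w k else 0) = (\<Prod>l'\<in>UNIV. ?f l' (k l'))"
      proof (cases "\<bar>k l\<bar> > int K")
        case True
        then show ?thesis by (auto intro!: prod.cong)
      next
        case False
        then have "(\<Prod>l'\<in>UNIV. ?f l' (k l')) = 0" by (intro prod_zero) auto
        then show ?thesis using False by simp
      qed
    qed
    also have "\<dots> = (\<Prod>l'\<in>UNIV. \<Sum>i\<in>{- int (M l')..int (M l')}. ?f l' i)"
      by (subst prod_sum_PiE [symmetric]) auto
    also have "\<dots> = (\<Sum>i\<in>{- int (M l)..int (M l)}. ?f l i) * (\<Prod>l'\<in>UNIV - {l}. \<Sum>i\<in>{- int (M l')..int (M l')}. ?f l' i)"
      by (rule prod.remove) auto
    also have "(\<Prod>l'\<in>UNIV - {l}. \<Sum>i\<in>{- int (M l')..int (M l')}. ?f l' i) = 1"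
      by (intro prod.neutral) (auto simp: sum_cos_coeff)
    also have "(\<Sum>i\<in>{- int (M l)..int (M l)}. ?f l i) = (\<Sum>i\<in>{i \<in> {- int (M l)..int (M l)}. real_of_int \<bar>i\<bar> > real K}. cos_coeff (M l) i)"
      by (subst sum.inter_filter) (auto intro!: sum.cong)
    finally have e: "(\<Sum>k\<in>?P. if \<bar>k l\<bar> > int K then ?w k else 0) = (\<Sum>i\<in>{i \<in> {- int (M l)..int (M l)}. real_of_int \<bar>i\<bar> > real K}. cos_coeff (M l) i)"
      by simp
    show "(\<Sum>k\<in>?P. if \<bar>k l\<bar> > int K then ?w k else 0) \<le> 4 * exp (- real K / sqrt (real (M l)))"
      unfolding e by (rule cos_coeff_tail[OF M])
  qed
  finally have t: "(\<Sum>k\<in>{k \<in> ?P. \<exists>l. \<bar>k l\<bar> > int K}. ?w k) \<le> (\<Sum>l\<in>UNIV. 4 * exp (- real K / sqrt (real (M l))))" .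
  have "(\<Sum>i\<in>index_pairs N \<times> {k \<in> ?P. \<exists>l. \<bar>k l\<bar> > int K}. amplitude M N i)
      = (\<Sum>s\<in>index_pairs N. 2 / real N * (\<Sum>k\<in>{k \<in> ?P. \<exists>l. \<bar>k l\<bar> > int K}. ?w k))"
    by (simp add: amplitude_def sum_distrib_left flip: sum.cartesian_product)
  also have "\<dots> = (real N - 1) * (\<Sum>k\<in>{k \<in> ?P. \<exists>l. \<bar>k l\<bar> > int K}. ?w k)"
    using N by (simp add: card_index_pairs)
  also have "\<dots> \<le> real N * (\<Sum>l\<in>UNIV. 4 * exp (- real K / sqrt (real (M l))))"
    using t w0 by (intro mult_mono) (auto intro!: sum_nonneg)
  finally show ?thesis .
qed

definition smooth_corr :: "(nat \<Rightarrow> real^'d) \<Rightarrow> ('d \<Rightarrow> nat) \<Rightarrow> nat \<Rightarrow> real^'d \<Rightarrow> real" where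
  "smooth_corr x M N \<alpha> = 2 / real N * (\<Sum>s\<in>index_pairs N. \<Prod>l\<in>UNIV. cos (pi * (gap_vec x UNIV s l * \<alpha> $ l)) ^ (2 * M l))"

definition main_freq_sum :: "(nat \<Rightarrow> real^'d) \<Rightarrow> ('d \<Rightarrow> nat) \<Rightarrow> nat \<Rightarrow> nat \<Rightarrow> real^'d \<Rightarrow> complex" where
  "main_freq_sum x M N K \<alpha> = (\<Sum>i\<in>index_pairs N \<times> freqs M K. amplitude M N i *\<^sub>R cis (((2 * pi) *\<^sub>R dilated_gap x i) \<bullet> \<alpha>))"

text \<open>The zero frequency is the mean, the frequencies up to K form
  \<open>main_freq_sum\<close>, and the rest is bounded by its total mass, hence uniformly in
  \<alpha>.\<close>

lemma smooth_corr_expansion: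
  fixes x :: "nat \<Rightarrow> real^'d"
  assumes N: "N \<ge> 1" and M: "\<And>l. M l \<ge> 1"
  shows "cmod (complex_of_real (smooth_corr x M N \<alpha> - (real N - 1) * (\<Prod>l\<in>UNIV. cos_coeff (M l) 0)) - main_freq_sum x M N K \<alpha>)
    \<le> real N * (\<Sum>l\<in>UNIV. 4 * exp (- real K / sqrt (real (M l))))"
proof -
  let ?P = "PiE (UNIV :: 'd set) (\<lambda>l. {- int (M l)..int (M l)})"
  let ?big = "{k \<in> ?P. \<exists>l. \<bar>k l\<bar> > int K}"
  let ?t = "\<lambda>i. amplitude M N i *\<^sub>R cis (((2 * pi) *\<^sub>R dilated_gap x i) \<bullet> \<alpha>)"
  have finP: "finite ?P" by (intro finite_PiE) auto
  have dec: "?P = {\<lambda>_. 0} \<union> (freqs M K \<union> ?big)"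
    by (auto simp: freqs_def not_less)
  have disj: "{\<lambda>_. 0} \<inter> (freqs M K \<union> ?big) = {}" "freqs M K \<inter> ?big = {}"
    by (auto simp: freqs_def) (metis linorder_not_less)
  have "complex_of_real (smooth_corr x M N \<alpha>)
      = (\<Sum>s\<in>index_pairs N. (2 / real N) *\<^sub>R (\<Prod>l\<in>UNIV. complex_of_real (cos (pi * (gap_vec x UNIV s l * \<alpha> $ l)) ^ (2 * M l))))"
    by (simp add: smooth_corr_def scaleR_conv_of_real sum_distrib_left)
  also have "\<dots> = (\<Sum>s\<in>index_pairs N. \<Sum>k\<in>?P. ?t (s, k))"
  proof (rule sum.cong[OF refl])
    fix s
    have "(\<Prod>l\<in>UNIV. complex_of_real (cos (pi * (gap_vec x UNIV s l * \<alpha> $ l)) ^ (2 * M l)))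
        = (\<Prod>l\<in>UNIV. \<Sum>k\<in>{- int (M l)..int (M l)}. cos_coeff (M l) k *\<^sub>R cis (2 * pi * (real_of_int k * (gap_vec x UNIV s l * \<alpha> $ l))))"
      by (simp only: cos_power_expansion)
    also have "\<dots> = (\<Sum>k\<in>?P. \<Prod>l\<in>UNIV. cos_coeff (M l) (k l) *\<^sub>R cis (2 * pi * (real_of_int (k l) * (gap_vec x UNIV s l * \<alpha> $ l))))"
      by (subst prod_sum_PiE) auto
    finally have e: "(\<Prod>l\<in>UNIV. complex_of_real (cos (pi * (gap_vec x UNIV s l * \<alpha> $ l)) ^ (2 * M l))) = \<dots>" .
    show "(2 / real N) *\<^sub>R (\<Prod>l\<in>UNIV. complex_of_real (cos (pi * (gap_vec x UNIV s l * \<alpha> $ l)) ^ (2 * M l))) = (\<Sum>k\<in>?P. ?t (s, k))"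
      unfolding e scaleR_sum_right
    proof (rule sum.cong[OF refl])
      fix k
      have "(\<Prod>l\<in>UNIV. cos_coeff (M l) (k l) *\<^sub>R cis (2 * pi * (real_of_int (k l) * (gap_vec x UNIV s l * \<alpha> $ l))))
          = complex_of_real (\<Prod>l\<in>UNIV. cos_coeff (M l) (k l)) * cis (((2 * pi) *\<^sub>R dilated_gap x (s, k)) \<bullet> \<alpha>)"
      proof -
        have "((2 * pi) *\<^sub>R dilated_gap x (s, k)) $ l * \<alpha> $ l = 2 * pi * (real_of_int (k l) * (gap_vec x UNIV s l * \<alpha> $ l))" for l
          by (simp add: dilated_gap_def)
        then have "cis (((2 * pi) *\<^sub>R dilated_gap x (s, k)) \<bullet> \<alpha>) = (\<Prod>l\<in>UNIV. cis (2 * pi * (real_of_int (k l) * (gap_vec x UNIV s l * \<alpha> $ l))))"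
          unfolding cis_inner by (simp only:)
        then show ?thesis by (simp only: scaleR_conv_of_real prod.distrib of_real_prod)
      qed
      then show "(2 / real N) *\<^sub>R (\<Prod>l\<in>UNIV. cos_coeff (M l) (k l) *\<^sub>R cis (2 * pi * (real_of_int (k l) * (gap_vec x UNIV s l * \<alpha> $ l)))) = ?t (s, k)"
        by (simp add: amplitude_def scaleR_conv_of_real)
    qed
  qed
  also have "\<dots> = (\<Sum>s\<in>index_pairs N. ?t (s, \<lambda>_. 0) + ((\<Sum>k\<in>freqs M K. ?t (s, k)) + (\<Sum>k\<in>?big. ?t (s, k))))"
  proof (rule sum.cong[OF refl])
    fix s
    have "(\<Sum>k\<in>?P. ?t (s, k)) = (\<Sum>k\<in>{\<lambda>_. 0} \<union> (freqs M K \<union> ?big). ?t (s, k))"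
      using dec by (rule arg_cong)
    also have "\<dots> = (\<Sum>k\<in>{\<lambda>_. 0}. ?t (s, k)) + (\<Sum>k\<in>freqs M K \<union> ?big. ?t (s, k))"
      using finP disj(1) by (intro sum.union_disjoint) auto
    also have "(\<Sum>k\<in>freqs M K \<union> ?big. ?t (s, k)) = (\<Sum>k\<in>freqs M K. ?t (s, k)) + (\<Sum>k\<in>?big. ?t (s, k))"
      using finP disj(2) by (intro sum.union_disjoint) auto
    finally show "(\<Sum>k\<in>?P. ?t (s, k)) = ?t (s, \<lambda>_. 0) + ((\<Sum>k\<in>freqs M K. ?t (s, k)) + (\<Sum>k\<in>?big. ?t (s, k)))" by simp
  qed
  also have "\<dots> = (\<Sum>s\<in>index_pairs N. ?t (s, \<lambda>_. 0)) + (main_freq_sum x M N K \<alpha> + (\<Sum>i\<in>index_pairs N \<times> ?big. ?t i))"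
    by (simp only: sum.distrib main_freq_sum_def sum.cartesian_product) (simp add: case_prod_unfold)
  also have "(\<Sum>s\<in>index_pairs N. ?t (s, \<lambda>_. 0)) = complex_of_real ((real N - 1) * (\<Prod>l\<in>UNIV. cos_coeff (M l) 0))"
  proof -
    have "dilated_gap x (s, \<lambda>_. 0) = 0" for s by (simp add: dilated_gap_def vec_eq_iff)
    then have "(\<Sum>s\<in>index_pairs N. ?t (s, \<lambda>_. 0)) = complex_of_real (real (card (index_pairs N)) * (2 / real N * (\<Prod>l\<in>UNIV. cos_coeff (M l) 0)))"
      by (simp add: amplitude_def scaleR_conv_of_real)
    then show ?thesis using N by (simp add: card_index_pairs)
  qed
  finally have "complex_of_real (smooth_corr x M N \<alpha> - (real N - 1) * (\<Prod>l\<in>UNIV. cos_coeff (M l) 0)) - main_freq_sum x M N K \<alpha>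
      = (\<Sum>i\<in>index_pairs N \<times> ?big. ?t i)" by simp
  then have "cmod (complex_of_real (smooth_corr x M N \<alpha> - (real N - 1) * (\<Prod>l\<in>UNIV. cos_coeff (M l) 0)) - main_freq_sum x M N K \<alpha>)
      \<le> (\<Sum>i\<in>index_pairs N \<times> ?big. norm (?t i))" by (simp only: norm_sum)
  also have "\<dots> = (\<Sum>i\<in>index_pairs N \<times> ?big. amplitude M N i)"
    by (simp add: amplitude_nonneg)
  also have "\<dots> \<le> real N * (\<Sum>l\<in>UNIV. 4 * exp (- real K / sqrt (real (M l))))"
    by (rule sum_amplitude_tail_le[OF N M])
  finally show ?thesis .
qed

lemma main_freq_sum_mean_square:
  fixes x :: "nat \<Rightarrow> real^'d"
  assumes c: "c > 0" and sep: "\<And>l n. n \<ge> 1 \<Longrightarrow> x (n + 1) $ l - x n $ l \<ge> c" and \<eta>: "\<eta> > 0" "8 * \<eta> \<le> c"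
    and N: "N \<ge> 1" and B: "B > 0"
  shows "(\<integral>\<^sup>+\<alpha>. ennreal (gauss_weight B \<alpha> * (cmod (main_freq_sum x M N K \<alpha>))\<^sup>2) \<partial>lborel)
    \<le> ennreal ((2 / real N * (\<Prod>l\<in>UNIV. cos_coeff (M l) 0))\<^sup>2 *
        (\<Sum>\<sigma>\<in>sign_vectors. card (gap_collisions \<eta> x {l. \<sigma> l \<noteq> 0} N K))
      + (real N)\<^sup>2 * exp (- (B\<^sup>2 * \<eta>\<^sup>2)))"
proof -
  let ?I = "index_pairs N \<times> freqs M K"
  let ?\<phi> = "\<lambda>i. (2 * pi) *\<^sub>R dilated_gap x i"
  \<comment> \<open>The phases are 2 pi times the dilated gaps, so the window pi \<eta> for phases
    is the window \<eta>/2 required in \<open>gap_collisions\<close>.\<close>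
  have cp: "close_pairs (\<chi> l. pi * \<eta>) ?I ?\<phi> = close_pairs ((\<chi> l. \<eta>) /\<^sub>R 2) ?I (dilated_gap x)"
  proof -
    have "\<bar>2 * pi * a - 2 * pi * b\<bar> \<le> pi * \<eta> \<longleftrightarrow> \<bar>a - b\<bar> \<le> \<eta> / 2" for a b :: real
    proof -
      have "\<bar>2 * pi * a - 2 * pi * b\<bar> = pi * (2 * \<bar>a - b\<bar>)"
        by (simp flip: right_diff_distrib add: abs_mult)
      moreover have "pi * (2 * \<bar>a - b\<bar>) \<le> pi * \<eta> \<longleftrightarrow> 2 * \<bar>a - b\<bar> \<le> \<eta>"
        by (rule mult_le_cancel_left_pos) simp
      ultimately have "(\<bar>2 * pi * a - 2 * pi * b\<bar> \<le> pi * \<eta>) = (2 * \<bar>a - b\<bar> \<le> \<eta>)" by (simp only:)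
      also have "\<dots> = (\<bar>a - b\<bar> \<le> \<eta> / 2)" by (simp only: pos_le_divide_eq zero_less_numeral mult.commute)
      finally show ?thesis .
    qed
    then show ?thesis by (simp add: close_pairs_def close_points_def)
  qed
  have "(\<integral>\<^sup>+\<alpha>. ennreal (gauss_weight B \<alpha> * (cmod (main_freq_sum x M N K \<alpha>))\<^sup>2) \<partial>lborel)
      \<le> ennreal ((\<Sum>(i, j)\<in>close_pairs (\<chi> l. pi * \<eta>) ?I ?\<phi>. amplitude M N i * amplitude M N j)
        + (\<Sum>i\<in>?I. amplitude M N i)\<^sup>2 * exp (- (B\<^sup>2 * (pi * \<eta>)\<^sup>2 / 2)))"
    unfolding main_freq_sum_def using \<eta> B
    by (intro gaussian_mean_square_le) (auto simp: amplitude_nonneg)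
  also have "\<dots> \<le> ennreal ((2 / real N * (\<Prod>l\<in>UNIV. cos_coeff (M l) 0))\<^sup>2 *
        (\<Sum>\<sigma>\<in>sign_vectors. card (gap_collisions \<eta> x {l. \<sigma> l \<noteq> 0} N K))
      + (real N)\<^sup>2 * exp (- (B\<^sup>2 * \<eta>\<^sup>2)))"
  proof (intro ennreal_leI add_mono mult_mono power_mono sum_amplitude_le N)
    have "(\<Sum>(i, j)\<in>close_pairs (\<chi> l. pi * \<eta>) ?I ?\<phi>. amplitude M N i * amplitude M N j)
        \<le> (2 / real N * (\<Prod>l\<in>UNIV. cos_coeff (M l) 0))\<^sup>2 * card (close_pairs ((\<chi> l. \<eta>) /\<^sub>R 2) ?I (dilated_gap x))"
      unfolding cp by (rule sum_close_amplitude_le)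
    also have "\<dots> \<le> (2 / real N * (\<Prod>l\<in>UNIV. cos_coeff (M l) 0))\<^sup>2 *
        (\<Sum>\<sigma>\<in>sign_vectors. card (gap_collisions \<eta> x {l. \<sigma> l \<noteq> 0} N K))"
      using c sep \<eta> by (intro mult_left_mono of_nat_mono card_close_signed_le) auto
    finally show "(\<Sum>(i, j)\<in>close_pairs (\<chi> l. pi * \<eta>) ?I ?\<phi>. amplitude M N i * amplitude M N j) \<le> \<dots>" .
    have "2 * 1 \<le> pi * pi" using pi_gt3 by (intro mult_mono) auto
    then have "2 \<le> pi\<^sup>2" by (simp add: power2_eq_square)
    then have "B\<^sup>2 * \<eta>\<^sup>2 * 2 \<le> B\<^sup>2 * \<eta>\<^sup>2 * pi\<^sup>2" by (intro mult_left_mono) auto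
    then show "exp (- (B\<^sup>2 * (pi * \<eta>)\<^sup>2 / 2)) \<le> exp (- (B\<^sup>2 * \<eta>\<^sup>2))" by (simp add: power_mult_distrib mult_ac)
  qed (auto intro!: sum_nonneg amplitude_nonneg)
  finally show ?thesis .
qed

section \<open>The width of the smoothing kernel and the limit of its mean\<close>

definition width :: "nat \<Rightarrow> nat \<Rightarrow> nat" where
  "width d N = nat \<lfloor>real N powr (2 / real d)\<rfloor>"

lemma width_ge_1: "N \<ge> 1 \<Longrightarrow> width d N \<ge> 1"
  using ge_one_powr_ge_zero[of "real N" "2 / real d"] by (simp add: width_def le_nat_iff le_floor_iff)

lemma width_le: "real (width d N) \<le> real N powr (2 / real d)"
  by (simp add: width_def)

lemma sqrt_powr_two_div: "sqrt (real N powr (2 / real d)) = real N powr (1 / real d)"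
  by (simp add: powr_half_sqrt [symmetric] powr_powr)

lemma sqrt_width_le: "sqrt (real (width d N)) \<le> real N powr (1 / real d)"
  using real_sqrt_le_mono[OF width_le[of d N]] by (simp add: sqrt_powr_two_div)

lemma powr_at_top_nat: "a > 0 \<Longrightarrow> filterlim (\<lambda>N :: nat. real N powr a) at_top sequentially"
  by real_asymp

lemma width_asymp:
  assumes d: "d \<ge> 1"
  shows "(\<lambda>N. real N powr (1 / real d) / sqrt (real (width d N))) \<longlonglongrightarrow> 1"
proof -
  let ?y = "\<lambda>N. real N powr (2 / real d)"
  have y: "filterlim ?y at_top sequentially" using d by (intro powr_at_top_nat) auto
  have "(\<lambda>N. real (width d N) / ?y N) \<longlonglongrightarrow> 1"
  proof (rule tendsto_sandwich)
    show "\<forall>\<^sub>F N in sequentially. 1 - 1 / ?y N \<le> real (width d N) / ?y N"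
      using eventually_ge_at_top[of 1]
    proof eventually_elim
      case (elim N)
      have p: "?y N > 0" using elim by simp
      have "?y N - 1 \<le> real (width d N)" unfolding width_def by linarith
      then have "(?y N - 1) / ?y N \<le> real (width d N) / ?y N" using p by (intro divide_right_mono) auto
      then show ?case using p by (simp add: diff_divide_distrib)
    qed
    show "\<forall>\<^sub>F N in sequentially. real (width d N) / ?y N \<le> 1"
      using eventually_ge_at_top[of 1]
    proof eventually_elim
      case (elim N)
      then show ?case using width_le[of d N] by (simp add: divide_le_eq)
    qed
    have "(\<lambda>N. 1 / ?y N) \<longlonglongrightarrow> 0"
      using tendsto_divide_0[OF tendsto_const filterlim_at_top_imp_at_infinity[OF y], of 1] by simp
    then show "(\<lambda>N. 1 - 1 / ?y N) \<longlonglongrightarrow> 1" using tendsto_diff[OF tendsto_const, of _ 0 _ "1 :: real"] by fastforce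
  qed simp
  then have "(\<lambda>N. sqrt (real (width d N) / ?y N)) \<longlonglongrightarrow> sqrt 1" by (rule tendsto_real_sqrt)
  then have "(\<lambda>N. inverse (sqrt (real (width d N) / ?y N))) \<longlonglongrightarrow> inverse (sqrt 1)"
    by (intro tendsto_inverse) auto
  then show ?thesis by (simp add: real_sqrt_divide sqrt_powr_two_div)
qed

lemma width_at_top:
  assumes d: "d \<ge> 1" and j: "j \<ge> 1"
  shows "filterlim (\<lambda>N. width d N * j) at_top sequentially"
proof -
  have "filterlim (\<lambda>N. real (width d N)) at_top sequentially"
  proof (rule filterlim_at_top_mono)
    show "filterlim (\<lambda>N :: nat. real N powr (2 / real d) - 1) at_top sequentially"
      using d by (intro filterlim_tendsto_add_at_top[OF tendsto_const[of "-1"], simplified add.commute, simplified]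
          powr_at_top_nat[THEN filterlim_compose[rotated]]) (auto simp: filterlim_ident)
    show "\<forall>\<^sub>F N in sequentially. real N powr (2 / real d) - 1 \<le> real (width d N)"
    proof (intro always_eventually allI)
      fix N
      show "real N powr (2 / real d) - 1 \<le> real (width d N)" unfolding width_def by linarith
    qed
  qed
  then have "filterlim (width d) at_top sequentially"
    by (simp add: filterlim_sequentially_iff_filterlim_real)
  then show ?thesis
    by (rule filterlim_at_top_mono) (use j in \<open>auto intro!: always_eventually\<close>)
qed

lemma prod_powr_one_div_card:
  assumes "N \<ge> 1"
  shows "(\<Prod>l\<in>(UNIV :: 'd::finite set). real N powr (1 / real CARD('d))) = real N"
  using assms by (simp add: powr_power)

text \<open>Each central coefficient behaves like 1/sqrt(pi w j_l), and w^(d/2) is asymptotic to N.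
  The limit is the integral of the product of the Gaussians exp(-j_l pi^2 t^2), as the Poissonian
  prediction requires.\<close>

lemma mean_limit:
  fixes j :: "'d::finite \<Rightarrow> nat"
  assumes j: "\<And>l. j l \<ge> 1"
  shows "(\<lambda>N. real N * (\<Prod>l\<in>UNIV. cos_coeff (width CARD('d) N * j l) 0)) \<longlonglongrightarrow> (\<Prod>l\<in>UNIV. 1 / sqrt (pi * real (j l)))"
proof -
  let ?w = "width CARD('d)"
  have "(\<lambda>N. real N powr (1 / real CARD('d)) * cos_coeff (?w N * j l) 0) \<longlonglongrightarrow> 1 / sqrt (pi * real (j l))" for l
  proof -
    have "(\<lambda>N. cos_coeff (?w N * j l) 0 * sqrt (real (?w N * j l))) \<longlonglongrightarrow> 1 / sqrt pi"
      by (rule filterlim_compose[OF cos_coeff_0_asymp width_at_top]) (use j Suc_le_eq in auto)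
    then have "(\<lambda>N. (cos_coeff (?w N * j l) 0 * sqrt (real (?w N * j l))) * (real N powr (1 / real CARD('d)) / sqrt (real (?w N))) * (1 / sqrt (real (j l))))
        \<longlonglongrightarrow> 1 / sqrt pi * 1 * (1 / sqrt (real (j l)))"
      by (intro tendsto_mult tendsto_const width_asymp) (simp_all add: Suc_le_eq)
    then have "(\<lambda>N. (cos_coeff (?w N * j l) 0 * sqrt (real (?w N * j l))) * (real N powr (1 / real CARD('d)) / sqrt (real (?w N))) * (1 / sqrt (real (j l))))
        \<longlonglongrightarrow> 1 / sqrt (pi * real (j l))" by (simp add: real_sqrt_mult)
    moreover have "\<forall>\<^sub>F N in sequentially. (cos_coeff (?w N * j l) 0 * sqrt (real (?w N * j l))) * (real N powr (1 / real CARD('d)) / sqrt (real (?w N))) * (1 / sqrt (real (j l)))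
        = real N powr (1 / real CARD('d)) * cos_coeff (?w N * j l) 0"
      using eventually_ge_at_top[of 1]
    proof eventually_elim
      case (elim N)
      have "sqrt (real (?w N)) > 0" "sqrt (real (j l)) > 0" using width_ge_1[OF elim, of "CARD('d)"] j[of l] by auto
      then show ?case by (simp add: real_sqrt_mult field_simps)
    qed
    ultimately show ?thesis by (rule Lim_transform_eventually)
  qed
  then have "(\<lambda>N. \<Prod>l\<in>UNIV. real N powr (1 / real CARD('d)) * cos_coeff (?w N * j l) 0) \<longlonglongrightarrow> (\<Prod>l\<in>UNIV. 1 / sqrt (pi * real (j l)))"
    by (intro tendsto_prod)
  moreover have "\<forall>\<^sub>F N in sequentially. (\<Prod>l\<in>UNIV. real N powr (1 / real CARD('d)) * cos_coeff (?w N * j l) 0)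
      = real N * (\<Prod>l\<in>UNIV. cos_coeff (?w N * j l) 0)"
    using eventually_ge_at_top[of 1]
    by eventually_elim (simp only: prod.distrib prod_powr_one_div_card)
  ultimately show ?thesis by (rule Lim_transform_eventually)
qed

text \<open>Passing from the Gaussian weight to a box inside its width costs only the factor
  B^d.\<close>

lemma gauss_weight_ge_on_box:
  fixes \<alpha> :: "real^'d"
  assumes B: "B > 0" and box: "\<And>l. \<bar>\<alpha> $ l\<bar> \<le> B"
  shows "gauss_weight B \<alpha> \<ge> (exp (- 1 / 2) / sqrt (2 * pi)) ^ CARD('d) / B ^ CARD('d)"
proof -
  have "(exp (- 1 / 2) / sqrt (2 * pi)) ^ CARD('d) / B ^ CARD('d) = (\<Prod>l\<in>(UNIV :: 'd set). exp (- 1 / 2) / sqrt (2 * pi) / B)"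
    by (simp add: power_divide power_mult_distrib)
  also have "\<dots> \<le> gauss_weight B \<alpha>"
    unfolding gauss_weight_def
  proof (intro prod_mono conjI)
    fix l
    have "(\<alpha> $ l)\<^sup>2 \<le> B\<^sup>2" using box[of l] B by (subst abs_le_square_iff [symmetric]) auto
    then have "- 1 / 2 \<le> - (\<alpha> $ l)\<^sup>2 / (2 * B\<^sup>2)" using B by (simp add: field_simps)
    then have "exp (- 1 / 2) \<le> exp (- (\<alpha> $ l)\<^sup>2 / (2 * B\<^sup>2))" by (simp only: exp_le_cancel_iff)
    moreover have "sqrt (2 * pi * B\<^sup>2) = sqrt (2 * pi) * B" using B by (simp add: real_sqrt_mult)
    ultimately show "exp (- 1 / 2) / sqrt (2 * pi) / B \<le> normal_density 0 B (\<alpha> $ l)"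
      using B by (simp add: normal_density_def divide_right_mono)
  qed (use B in auto)
  finally show ?thesis .
qed

lemma main_freq_sum_measurable [measurable]: "main_freq_sum x M N K \<in> borel_measurable borel"
  unfolding main_freq_sum_def [abs_def]
  by (intro borel_measurable_continuous_onI continuous_intros continuous_on_scaleR)

text \<open>The exponent A is chosen before j: polynomials in the cosine power mix several j, so all
  of them must converge along the same subsequence.\<close>

lemma smooth_corr_AE:
  fixes x :: "nat \<Rightarrow> real^'d"
  assumes d2: "CARD('d) \<ge> 2"
    and c: "c > 0" and sep: "\<And>l n. n \<ge> 1 \<Longrightarrow> x (n + 1) $ l - x n $ l \<ge> c"
    and en: "\<And>D' :: 'd set. \<exists>lam>0. (\<lambda>N. real (joint_additive_energy x D' N)) \<in>
        O(\<lambda>N. real N powr (4 - 1 / real CARD('d) * (2 * real (card D') - 31 / 76) - lam))"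
  shows "\<exists>A\<ge>1. \<forall>j. (\<forall>l. j l \<ge> 1) \<longrightarrow> (AE \<alpha> in lborel.
    (\<lambda>i. smooth_corr x (\<lambda>l. width CARD('d) (Suc i ^ A) * j l) (Suc i ^ A) \<alpha>) \<longlonglongrightarrow> (\<Prod>l\<in>UNIV. 1 / sqrt (pi * real (j l))))"
proof -
  define d where "d = CARD('d)"
  have d: "d \<ge> 2" using d2 by (simp add: d_def)
  obtain lam where lam: "\<And>D' :: 'd set. lam D' > 0"
    "\<And>D' :: 'd set. (\<lambda>N. real (joint_additive_energy x D' N)) \<in>
        O(\<lambda>N. real N powr (4 - 1 / real CARD('d) * (2 * real (card D') - 31 / 76) - lam D'))"
    using en by metis
  define \<delta> where "\<delta> = Min (range (\<lambda>D' :: 'd set. min (lam D') (14 / 76 / real d)))"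
  have \<delta>0: "\<delta> > 0" unfolding \<delta>_def using lam d by (subst Min_gr_iff) auto
  have \<delta>le: "\<delta> \<le> min (lam D') (14 / 76 / real d)" for D' unfolding \<delta>_def by (intro Min_le) auto
  have \<delta>1: "\<delta> \<le> 1"
  proof -
    have "\<delta> \<le> 14 / 76 / real d" using \<delta>le[of "{}"] by simp
    also have "\<dots> \<le> 1" using d by (simp add: field_simps)
    finally show ?thesis .
  qed
  \<comment> \<open>The losses are 12 d \<epsilon> from the collision count and d \<epsilon> from
    leaving the Gaussian weight; with 26 = 2 * 13 together they use half of \<delta>.\<close>
  define \<epsilon> where "\<epsilon> = \<delta> / (26 * real d)"
  have \<epsilon>: "\<epsilon> > 0" "\<epsilon> \<le> 1 / 2" using \<delta>0 \<delta>1 d by (auto simp: \<epsilon>_def field_simps)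
  have \<epsilon>d: "13 * real d * \<epsilon> = \<delta> / 2" using d by (simp add: \<epsilon>_def)
  define \<eta> where "\<eta> = min c 1 / 8"
  have \<eta>: "\<eta> > 0" "8 * \<eta> \<le> c" "8 * \<eta> \<le> 1" using c by (auto simp: \<eta>_def)
  define K where "K = (\<lambda>N. nat \<lfloor>real N powr (1 / real d + \<epsilon>)\<rfloor>)"
  have K1: "K N \<ge> 1" if "N \<ge> 1" for N
    using ge_one_powr_ge_zero[of "real N" "1 / real d + \<epsilon>"] that \<epsilon> by (simp add: K_def le_nat_iff le_floor_iff)
  have K2: "real (K N) \<le> real N powr (1 / real CARD('d) + \<epsilon>)" for N by (simp add: K_def d_def)
  have K3: "real (K N) \<ge> real N powr (1 / real d + \<epsilon>) - 1" for N unfolding K_def by linarith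
  define cnt where "cnt = (\<lambda>D' N. real (card (gap_collisions \<eta> x D' N (K N))))"
  have "\<exists>C>0. \<forall>N\<ge>1. cnt D' N \<le> C * real N powr (4 - \<delta> + 12 * real d * \<epsilon>)" if D': "D' \<noteq> {}" for D'
  proof -
    have "\<exists>C>0. \<forall>N\<ge>1. \<forall>K\<ge>1. real K \<le> real N powr (1 / real CARD('d) + \<epsilon>) \<longrightarrow>
    real (card (gap_collisions \<eta> x D' N K))
    \<le> C * real N powr (4 - min (lam D') (14 / 76 / real CARD('d)) + 12 * real CARD('d) * \<epsilon>)"
      by (rule dilated_gap_count_asymptotic[where c = c]) (fact d2 c sep \<eta> D' \<epsilon> lam(2))+
    then obtain C where C: "C > 0" "\<And>N K. N \<ge> 1 \<Longrightarrow> K \<ge> 1 \<Longrightarrow> real K \<le> real N powr (1 / real CARD('d) + \<epsilon>) \<Longrightarrow>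
    real (card (gap_collisions \<eta> x D' N K))
    \<le> C * real N powr (4 - min (lam D') (14 / 76 / real CARD('d)) + 12 * real CARD('d) * \<epsilon>)"
      by blast
    have "cnt D' N \<le> C * real N powr (4 - \<delta> + 12 * real d * \<epsilon>)" if N: "N \<ge> 1" for N
    proof -
      have "cnt D' N \<le> C * real N powr (4 - min (lam D') (14 / 76 / real CARD('d)) + 12 * real CARD('d) * \<epsilon>)"
        unfolding cnt_def by (rule C(2)[OF N K1[OF N] K2])
      also have "\<dots> \<le> C * real N powr (4 - \<delta> + 12 * real d * \<epsilon>)"
        using C(1) N \<delta>le[of D'] by (intro mult_left_mono powr_mono) (auto simp: d_def)
      finally show ?thesis .
    qed
    then show ?thesis using C(1) by blast
  qed
  note ex = this
  define CD where "CD = (\<lambda>D'. SOME C. C > 0 \<and> (\<forall>N\<ge>1. cnt D' N \<le> C * real N powr (4 - \<delta> + 12 * real d * \<epsilon>)))"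
  have CD: "CD D' > 0 \<and> (\<forall>N\<ge>1. cnt D' N \<le> CD D' * real N powr (4 - \<delta> + 12 * real d * \<epsilon>))" if "D' \<noteq> {}" for D'
    unfolding CD_def by (rule someI_ex[OF ex[OF that]])
  define C1 where "C1 = (\<Sum>\<sigma>\<in>(sign_vectors :: ('d \<Rightarrow> int) set). CD {l. \<sigma> l \<noteq> 0})"
  have sv: "{l. \<sigma> l \<noteq> 0} \<noteq> {}" if "\<sigma> \<in> (sign_vectors :: ('d \<Rightarrow> int) set)" for \<sigma>
    using that by (auto simp: sign_vectors_def)
  have cnt_sum: "(\<Sum>\<sigma>\<in>(sign_vectors :: ('d \<Rightarrow> int) set). cnt {l. \<sigma> l \<noteq> 0} N) \<le> C1 * real N powr (4 - \<delta> + 12 * real d * \<epsilon>)" if "N \<ge> 1" for N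
    unfolding C1_def sum_distrib_right
  proof (rule sum_mono)
    fix \<sigma> :: "'d \<Rightarrow> int" assume "\<sigma> \<in> sign_vectors"
    then show "cnt {l. \<sigma> l \<noteq> 0} N \<le> CD {l. \<sigma> l \<noteq> 0} * real N powr (4 - \<delta> + 12 * real d * \<epsilon>)"
      using CD[OF sv] that by simp
  qed
  have C10: "C1 \<ge> 0" unfolding C1_def by (intro sum_nonneg less_imp_le conjunct1[OF CD[OF sv]])
  \<comment> \<open>Weight width B = N^\<epsilon>: wide enough that the distant pairs contribute
    less than any power of N, narrow enough that B^d is affordable.\<close>
  have "(\<lambda>N. real N ^ 2 * exp (- ((real N powr \<epsilon>)\<^sup>2 * \<eta>\<^sup>2))) \<in> O(\<lambda>N. real N powr (- 1))"
    using \<epsilon>(1) \<eta>(1) by real_asymp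
  then obtain C2 where C2: "C2 > 0" "\<And>N. N \<ge> 1 \<Longrightarrow> real N ^ 2 * exp (- ((real N powr \<epsilon>)\<^sup>2 * \<eta>\<^sup>2)) \<le> C2 * real N powr (- 1)"
    by (rule bigo_all_nat) auto
  \<comment> \<open>With N = (i+1)^A the second moment, of size N^(-\<delta>/2), is at most of order
    i^(-2) and so summable.\<close>
  define A where "A = nat \<lceil>4 / \<delta>\<rceil>"
  have A: "A \<ge> 1" "real A * \<delta> \<ge> 4"
  proof -
    have "4 / \<delta> > 0" using \<delta>0 by simp
    then show "A \<ge> 1" unfolding A_def by linarith
    have "4 / \<delta> \<le> real A" unfolding A_def by linarith
    then show "real A * \<delta> \<ge> 4" using \<delta>0 by (simp add: field_simps)
  qed
  define NN where "NN = (\<lambda>i. Suc i ^ A)"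
  have NN1: "NN i \<ge> 1" for i by (simp add: NN_def)
  have NNge: "NN i \<ge> i" for i
  proof -
    have "Suc i ^ 1 \<le> Suc i ^ A" using A by (intro power_increasing) auto
    then show ?thesis by (simp add: NN_def)
  qed
  have NNlim: "filterlim NN at_top sequentially"
    using NNge by (intro filterlim_at_top_mono[OF filterlim_ident]) (auto intro: always_eventually)
  have main: "AE \<alpha> in lborel. (\<lambda>i. smooth_corr x (\<lambda>l. width CARD('d) (NN i) * j l) (NN i) \<alpha>) \<longlonglongrightarrow> (\<Prod>l\<in>UNIV. 1 / sqrt (pi * real (j l)))"
    if j: "\<And>l. j l \<ge> 1" for j :: "'d \<Rightarrow> nat"
  proof -
    define M where "M = (\<lambda>N l. width d N * j l)"
    have M1: "M N l \<ge> 1" if "N \<ge> 1" for N l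
      using width_ge_1[OF that, of d] j[of l] by (simp add: M_def Suc_le_eq)
    define P where "P = (\<lambda>N. \<Prod>l\<in>UNIV. cos_coeff (M N l) 0)"
    have Plim: "(\<lambda>N. real N * P N) \<longlonglongrightarrow> (\<Prod>l\<in>UNIV. 1 / sqrt (pi * real (j l)))"
      using mean_limit[of j, OF j] by (simp add: P_def M_def d_def)
    have P0: "P N \<ge> 0" for N unfolding P_def by (intro prod_nonneg cos_coeff_nonneg)
    have "Bseq (\<lambda>N. real N * P N)" using Plim by (intro convergent_imp_Bseq convergentI)
    then obtain Cp where Cp: "Cp > 0" "\<And>N. norm (real N * P N) \<le> Cp" by (auto elim: BseqE)
    define f where "f = (\<lambda>i. main_freq_sum x (M (NN i)) (NN i) (K (NN i)))"
    define C3 where "C3 = 4 * Cp\<^sup>2 * C1 + C2"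
    define w0 where "w0 = (exp (- 1 / 2) / sqrt (2 * pi)) ^ d"
    have w0: "w0 > 0" by (simp add: w0_def)
    have int: "(\<integral>\<^sup>+\<alpha>. ennreal (gauss_weight (real N powr \<epsilon>) \<alpha> * (cmod (main_freq_sum x (M N) N (K N) \<alpha>))\<^sup>2) \<partial>lborel)
        \<le> ennreal (C3 * real N powr (- \<delta> + 12 * real d * \<epsilon>))" if N: "N \<ge> 1" for N
    proof -
      have N0: "real N \<ge> 1" using N by simp
      have "(\<integral>\<^sup>+\<alpha>. ennreal (gauss_weight (real N powr \<epsilon>) \<alpha> * (cmod (main_freq_sum x (M N) N (K N) \<alpha>))\<^sup>2) \<partial>lborel)
        \<le> ennreal ((2 / real N * P N)\<^sup>2 * (\<Sum>\<sigma>\<in>(sign_vectors :: ('d \<Rightarrow> int) set). cnt {l. \<sigma> l \<noteq> 0} N)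
          + (real N)\<^sup>2 * exp (- ((real N powr \<epsilon>)\<^sup>2 * \<eta>\<^sup>2)))"
        using main_freq_sum_mean_square[where c = c and x = x and \<eta> = \<eta> and N = N and B = "real N powr \<epsilon>" and M = "M N" and K = "K N"]
          c sep \<eta> N by (simp add: P_def cnt_def)
      also have "\<dots> \<le> ennreal (C3 * real N powr (- \<delta> + 12 * real d * \<epsilon>))"
      proof (rule ennreal_leI)
        \<comment> \<open>As N P(N) is bounded, the squared amplitude bound is of order N^(-4),
          which exactly cancels the main exponent of the collision count.\<close>
        have "(2 / real N * P N)\<^sup>2 = 4 * (real N * P N)\<^sup>2 / real N ^ 4"
          using N0 by (simp add: power_mult_distrib power_divide field_simps power2_eq_square power4_eq_xxxx)
        also have "\<dots> \<le> 4 * Cp\<^sup>2 / real N ^ 4"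
          using Cp(2)[of N] P0[of N] by (intro divide_right_mono mult_left_mono power_mono) auto
        finally have a: "(2 / real N * P N)\<^sup>2 \<le> 4 * Cp\<^sup>2 / real N ^ 4" .
        have "(2 / real N * P N)\<^sup>2 * (\<Sum>\<sigma>\<in>(sign_vectors :: ('d \<Rightarrow> int) set). cnt {l. \<sigma> l \<noteq> 0} N)
            \<le> (4 * Cp\<^sup>2 / real N ^ 4) * (C1 * real N powr (4 - \<delta> + 12 * real d * \<epsilon>))"
          using a cnt_sum[OF N] by (intro mult_mono) (auto simp: cnt_def intro!: sum_nonneg)
        also have "\<dots> = 4 * Cp\<^sup>2 * C1 * (real N powr (4 - \<delta> + 12 * real d * \<epsilon>) / real N powr 4)"
          using N0 by (simp add: powr_numeral)
        also have "\<dots> = 4 * Cp\<^sup>2 * C1 * real N powr (- \<delta> + 12 * real d * \<epsilon>)"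
          by (simp only: powr_diff [symmetric]) simp
        finally have b: "(2 / real N * P N)\<^sup>2 * (\<Sum>\<sigma>\<in>(sign_vectors :: ('d \<Rightarrow> int) set). cnt {l. \<sigma> l \<noteq> 0} N) \<le> \<dots>" .
        have "0 \<le> 12 * real d * \<epsilon>" using \<epsilon> by simp
        then have "- 1 \<le> - \<delta> + 12 * real d * \<epsilon>" using \<delta>1 by linarith
        then have "C2 * real N powr (- 1) \<le> C2 * real N powr (- \<delta> + 12 * real d * \<epsilon>)"
          using C2(1) N0 by (intro mult_left_mono powr_mono) auto
        then have "(real N)\<^sup>2 * exp (- ((real N powr \<epsilon>)\<^sup>2 * \<eta>\<^sup>2)) \<le> C2 * real N powr (- \<delta> + 12 * real d * \<epsilon>)"
          using C2(2)[OF N] by linarith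
        then show "(2 / real N * P N)\<^sup>2 * (\<Sum>\<sigma>\<in>(sign_vectors :: ('d \<Rightarrow> int) set). cnt {l. \<sigma> l \<noteq> 0} N)
          + (real N)\<^sup>2 * exp (- ((real N powr \<epsilon>)\<^sup>2 * \<eta>\<^sup>2)) \<le> C3 * real N powr (- \<delta> + 12 * real d * \<epsilon>)"
          using b by (simp add: C3_def distrib_right)
      qed
      finally show ?thesis .
    qed
    have "AE \<alpha> in lborel. (\<lambda>i. f i \<alpha>) \<longlonglongrightarrow> 0"
    proof (rule AE_tendsto_zero_of_box_integrals)
      show "f i \<in> borel_measurable borel" for i unfolding f_def by measurable
      fix R :: nat
      have "filterlim (\<lambda>i. real (NN i) powr \<epsilon>) at_top sequentially"
        by (rule filterlim_compose[OF powr_at_top_nat[OF \<epsilon>(1)] NNlim])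
      then have "\<forall>\<^sub>F i in sequentially. real (NN i) powr \<epsilon> \<ge> real R"
        by (simp add: filterlim_at_top)
      then obtain i0 where i0: "\<And>i. i \<ge> i0 \<Longrightarrow> real (NN i) powr \<epsilon> \<ge> real R"
        by (auto simp: eventually_sequentially)
      show "\<exists>i0 C. \<forall>i\<ge>i0. (\<integral>\<^sup>+\<alpha>. ennreal (indicator {\<alpha>. \<forall>l. \<bar>\<alpha> $ l\<bar> \<le> real R} \<alpha> * (cmod (f i \<alpha>))\<^sup>2) \<partial>lborel)
          \<le> ennreal (C / real (Suc i) ^ 2)"
      proof (intro exI[of _ i0] exI[of _ "C3 / w0"] allI impI)
        fix i assume i: "i \<ge> i0"
        define N where "N = NN i"
        define B where "B = real N powr \<epsilon>"
        have N: "N \<ge> 1" using NN1 by (simp add: N_def)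
        have N0: "real N \<ge> 1" using N by simp
        have B: "B > 0" using N by (simp add: B_def)
        have "(\<integral>\<^sup>+\<alpha>. ennreal (indicator {\<alpha>. \<forall>l. \<bar>\<alpha> $ l\<bar> \<le> real R} \<alpha> * (cmod (f i \<alpha>))\<^sup>2) \<partial>lborel)
            \<le> (\<integral>\<^sup>+\<alpha>. ennreal (B ^ d / w0) * ennreal (gauss_weight B \<alpha> * (cmod (f i \<alpha>))\<^sup>2) \<partial>lborel)"
        proof (rule nn_integral_mono)
          fix \<alpha> :: "real^'d"
          have "indicator {\<alpha>. \<forall>l. \<bar>\<alpha> $ l\<bar> \<le> real R} \<alpha> * (cmod (f i \<alpha>))\<^sup>2 \<le> B ^ d / w0 * (gauss_weight B \<alpha> * (cmod (f i \<alpha>))\<^sup>2)"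
          proof (cases "\<forall>l. \<bar>\<alpha> $ l\<bar> \<le> real R")
            case True
            then have "\<And>l. \<bar>\<alpha> $ l\<bar> \<le> B" using i0[OF i] order_trans unfolding B_def N_def by blast
            then have "w0 / B ^ d \<le> gauss_weight B \<alpha>"
              using gauss_weight_ge_on_box[OF B] unfolding w0_def d_def by blast
            then have "1 \<le> B ^ d / w0 * gauss_weight B \<alpha>" using B w0 by (simp add: field_simps)
            then have "1 * (cmod (f i \<alpha>))\<^sup>2 \<le> B ^ d / w0 * gauss_weight B \<alpha> * (cmod (f i \<alpha>))\<^sup>2"
              by (intro mult_right_mono) auto
            then show ?thesis using True by simp
          next
            case False
            then show ?thesis using B w0 gauss_weight_nonneg[of B \<alpha>] by simp
          qed
          then show "ennreal (indicator {\<alpha>. \<forall>l. \<bar>\<alpha> $ l\<bar> \<le> real R} \<alpha> * (cmod (f i \<alpha>))\<^sup>2)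
            \<le> ennreal (B ^ d / w0) * ennreal (gauss_weight B \<alpha> * (cmod (f i \<alpha>))\<^sup>2)"
            using B w0 gauss_weight_nonneg[of B \<alpha>] by (subst ennreal_mult [symmetric]) (auto intro: ennreal_leI)
        qed
        also have "\<dots> = ennreal (B ^ d / w0) * (\<integral>\<^sup>+\<alpha>. ennreal (gauss_weight B \<alpha> * (cmod (f i \<alpha>))\<^sup>2) \<partial>lborel)"
          unfolding f_def by (rule nn_integral_cmult) measurable
        also have "\<dots> \<le> ennreal (B ^ d / w0) * ennreal (C3 * real N powr (- \<delta> + 12 * real d * \<epsilon>))"
          using int[OF N] unfolding f_def B_def N_def by (intro mult_left_mono) auto
        also have "\<dots> = ennreal (B ^ d / w0 * (C3 * real N powr (- \<delta> + 12 * real d * \<epsilon>)))"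
          using B w0 C10 C2(1) by (subst ennreal_mult [symmetric]) (auto simp: C3_def)
        also have "\<dots> \<le> ennreal (C3 / w0 / real (Suc i) ^ 2)"
        proof (rule ennreal_leI)
          have "B ^ d = real N powr (\<epsilon> * real d)" using N0 by (simp add: B_def powr_power mult.commute)
          then have "B ^ d / w0 * (C3 * real N powr (- \<delta> + 12 * real d * \<epsilon>)) = C3 / w0 * (real N powr (\<epsilon> * real d) * real N powr (- \<delta> + 12 * real d * \<epsilon>))"
            by simp
          also have "real N powr (\<epsilon> * real d) * real N powr (- \<delta> + 12 * real d * \<epsilon>) = real N powr (- (\<delta> / 2))"
            unfolding powr_add [symmetric] using \<epsilon>d by (intro arg_cong[where f = "\<lambda>t. real N powr t"]) (simp add: algebra_simps)
          also have "\<dots> = real (Suc i) powr (real A * - (\<delta> / 2))"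
            by (simp add: N_def NN_def powr_powr flip: powr_realpow)
          also have "\<dots> \<le> real (Suc i) powr (- 2)" using A by (intro powr_mono) auto
          also have "\<dots> = 1 / real (Suc i) ^ 2" by (simp add: powr_minus powr_numeral divide_inverse)
          finally show "B ^ d / w0 * (C3 * real N powr (- \<delta> + 12 * real d * \<epsilon>)) \<le> C3 / w0 / real (Suc i) ^ 2"
            using w0 C10 C2(1) by (simp add: C3_def mult_left_mono divide_right_mono)
        qed
        finally show "(\<integral>\<^sup>+\<alpha>. ennreal (indicator {\<alpha>. \<forall>l. \<bar>\<alpha> $ l\<bar> \<le> real R} \<alpha> * (cmod (f i \<alpha>))\<^sup>2) \<partial>lborel)
          \<le> ennreal (C3 / w0 / real (Suc i) ^ 2)" .
      qed
    qed
    then show ?thesis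
    proof (rule AE_mp, intro AE_I2 impI)
      fix \<alpha> :: "real^'d"
      assume f0: "(\<lambda>i. f i \<alpha>) \<longlonglongrightarrow> 0"
      define T where "T = (\<lambda>N. real N * (\<Sum>l\<in>UNIV. 4 * exp (- real (K N) / sqrt (real (M N l)))))"
      have T0: "T \<longlonglongrightarrow> 0"
      proof -
        have "(\<lambda>N. real N * (4 * exp (- real (K N) / sqrt (real (M N l))))) \<longlonglongrightarrow> 0" for l
        proof (rule tendsto_sandwich[where f = "\<lambda>_. 0"])
          \<comment> \<open>The tail is negligible because K exceeds the standard deviation sqrt(w
            j_l) \<le> N^(1/d) q by a factor of order N^\<epsilon>.\<close>
          define q where "q = sqrt (real (j l))"
          have q: "q > 0" using j[of l] by (simp add: q_def)
          show "(\<lambda>N. real N * (4 * exp (1 - real N powr \<epsilon> / q))) \<longlonglongrightarrow> 0"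
            using \<epsilon>(1) q by real_asymp
          show "\<forall>\<^sub>F N in sequentially. real N * (4 * exp (- real (K N) / sqrt (real (M N l)))) \<le> real N * (4 * exp (1 - real N powr \<epsilon> / q))"
            using eventually_ge_at_top[of 1]
          proof eventually_elim
            case (elim N)
            have m1: "sqrt (real (M N l)) \<ge> 1" using M1[OF elim, of l] by simp
            have "sqrt (real (M N l)) \<le> real N powr (1 / real d) * q"
              using sqrt_width_le[of d N] q by (simp add: M_def real_sqrt_mult q_def mult_right_mono)
            then have "real N powr \<epsilon> / q * sqrt (real (M N l)) \<le> real N powr \<epsilon> / q * (real N powr (1 / real d) * q)"
              using q by (intro mult_left_mono) auto
            also have "\<dots> = real N powr (1 / real d + \<epsilon>)" using q by (simp add: powr_add)
            also have "\<dots> \<le> real (K N) + 1 * 1" using K3[of N] by linarith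
            also have "\<dots> \<le> real (K N) + 1 * sqrt (real (M N l))" using m1 by linarith
            finally have "real N powr \<epsilon> / q - 1 \<le> real (K N) / sqrt (real (M N l))"
              using m1 by (simp add: pos_le_divide_eq left_diff_distrib)
            then show ?case by (intro mult_left_mono) auto
          qed
        qed (auto intro!: always_eventually)
        then have "(\<lambda>N. \<Sum>l\<in>UNIV. real N * (4 * exp (- real (K N) / sqrt (real (M N l))))) \<longlonglongrightarrow> (\<Sum>l\<in>(UNIV :: 'd set). 0)"
          by (intro tendsto_sum)
        then show ?thesis by (simp add: T_def sum_distrib_left)
      qed
      define V where "V = (\<lambda>N. smooth_corr x (M N) N \<alpha> - (real N - 1) * P N)"
      have diff: "(\<lambda>i. complex_of_real (V (NN i)) - f i \<alpha>) \<longlonglongrightarrow> 0"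
      proof (rule Lim_null_comparison)
        show "\<forall>\<^sub>F i in sequentially. norm (complex_of_real (V (NN i)) - f i \<alpha>) \<le> T (NN i)"
          unfolding V_def f_def T_def P_def
          by (intro always_eventually allI smooth_corr_expansion NN1 M1)
        show "(\<lambda>i. T (NN i)) \<longlonglongrightarrow> 0" by (rule filterlim_compose[OF T0 NNlim])
      qed
      have "(\<lambda>i. complex_of_real (V (NN i))) \<longlonglongrightarrow> 0" using tendsto_add[OF diff f0] by simp
      then have V0: "(\<lambda>i. V (NN i)) \<longlonglongrightarrow> 0" using tendsto_of_real_iff[where 'a = complex, of "\<lambda>i. V (NN i)" 0 sequentially] by simp
      \<comment> \<open>Removes the difference between (N - 1) P(N), the true mean, and N P(N),
        whose limit is known.\<close>
      have "P \<longlonglongrightarrow> 0"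
      proof -
        have "(\<lambda>N. (real N * P N) * (1 / real N)) \<longlonglongrightarrow> (\<Prod>l\<in>UNIV. 1 / sqrt (pi * real (j l))) * 0"
          by (intro tendsto_mult Plim lim_1_over_n)
        then have "(\<lambda>N. (real N * P N) * (1 / real N)) \<longlonglongrightarrow> 0" by simp
        moreover have "\<forall>\<^sub>F N in sequentially. (real N * P N) * (1 / real N) = P N"
          using eventually_gt_at_top[of 0] by eventually_elim simp
        ultimately show ?thesis by (rule Lim_transform_eventually)
      qed
      then have "(\<lambda>N. real N * P N - P N) \<longlonglongrightarrow> (\<Prod>l\<in>UNIV. 1 / sqrt (pi * real (j l))) - 0"
        by (intro tendsto_diff Plim)
      from filterlim_compose[OF this NNlim]
      have "(\<lambda>i. V (NN i) + (real (NN i) * P (NN i) - P (NN i))) \<longlonglongrightarrow> 0 + ((\<Prod>l\<in>UNIV. 1 / sqrt (pi * real (j l))) - 0)"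
        by (intro tendsto_add V0)
      moreover have "V N + (real N * P N - P N) = smooth_corr x (M N) N \<alpha>" for N
        by (simp add: V_def algebra_simps)
      ultimately show "(\<lambda>i. smooth_corr x (\<lambda>l. width CARD('d) (NN i) * j l) (NN i) \<alpha>) \<longlonglongrightarrow> (\<Prod>l\<in>UNIV. 1 / sqrt (pi * real (j l)))"
        by (simp add: M_def d_def)
    qed
  qed
  show ?thesis using A main unfolding NN_def by blast
qed

section \<open>From smoothed pair sums to pair correlation\<close>

text \<open>Between consecutive members of the subsequence the count is squeezed by monotonicity in
  N and r. The rescaled radii and the normalisations differ by ratios tending to 1; a slightly
  changed s absorbs the former, and continuity of f removes the change.\<close>

lemma subsequence_interpolation:
  fixes cnt :: "nat \<Rightarrow> real \<Rightarrow> real" and A d :: nat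
  assumes A: "A \<ge> 1" and d: "d \<ge> 1"
    and nonneg: "\<And>N r. cnt N r \<ge> 0"
    and mono: "\<And>N N' r r'. N \<le> N' \<Longrightarrow> r \<le> r' \<Longrightarrow> cnt N r \<le> cnt N' r'"
    and lim: "\<And>s. s > 0 \<Longrightarrow> (\<lambda>i. cnt (Suc i ^ A) (s / real (Suc i ^ A) powr (1 / real d)) / real (Suc i ^ A)) \<longlonglongrightarrow> f s"
    and f: "isCont f s" and s: "s > 0"
  shows "(\<lambda>N. cnt N (s / real N powr (1 / real d)) / real N) \<longlonglongrightarrow> f s"
proof -
  define NN where "NN = (\<lambda>i. Suc i ^ A)"
  define i where "i N = Max {i. NN i \<le> N}" for N
  have NNgt: "NN k > k" for k
  proof -
    have "Suc k ^ 1 \<le> Suc k ^ A" using A by (intro power_increasing) auto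
    then show ?thesis by (simp add: NN_def)
  qed
  have fin: "finite {i. NN i \<le> N}" for N
    by (rule finite_subset[of _ "{..N}"]) (use NNgt in \<open>auto intro: less_imp_le order_trans\<close>)
  have NNmono: "NN k \<le> NN l" if "k \<le> l" for k l using that unfolding NN_def by (intro power_mono) auto
  have i1: "NN (i N) \<le> N" if "N \<ge> 1" for N
  proof -
    have "0 \<in> {i. NN i \<le> N}" using that by (simp add: NN_def)
    then have "i N \<in> {i. NN i \<le> N}" unfolding i_def using fin by (intro Max_in) auto
    then show ?thesis by simp
  qed
  have i2: "N \<le> NN (Suc (i N))" for N
  proof (rule ccontr)
    assume "\<not> N \<le> NN (Suc (i N))"
    then have "Suc (i N) \<le> i N" unfolding i_def using fin[of N] by (intro Max_ge) auto
    then show False by simp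
  qed
  have ilim: "filterlim i at_top sequentially"
    unfolding filterlim_at_top
  proof (intro allI)
    fix k
    show "\<forall>\<^sub>F N in sequentially. k \<le> i N"
      using eventually_ge_at_top[of "NN k"]
    proof eventually_elim
      case (elim N)
      then show ?case unfolding i_def using fin[of N] by (intro Max_ge) auto
    qed
  qed
  have NN0: "real (NN k) > 0" for k by (simp add: NN_def)
  \<comment> \<open>Here the polynomial growth of the subsequence is essential: along a geometric
    one this ratio would not tend to 1.\<close>
  have ratio: "(\<lambda>k. real (NN (Suc k)) / real (NN k)) \<longlonglongrightarrow> 1"
  proof -
    have "(\<lambda>k. (real (Suc (Suc k)) / real (Suc k)) ^ A) \<longlonglongrightarrow> 1 ^ A"
      by (intro tendsto_power) real_asymp
    then show ?thesis by (simp add: NN_def power_divide)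
  qed
  have ratio': "(\<lambda>k. real (NN k) / real (NN (Suc k))) \<longlonglongrightarrow> 1"
    using tendsto_inverse[OF ratio] by simp
  have ratiod: "(\<lambda>k. (real (NN (Suc k)) / real (NN k)) powr (1 / real d)) \<longlonglongrightarrow> 1"
    using tendsto_powr[OF ratio tendsto_const, of "1 / real d"] by simp
  define X where "X = (\<lambda>s k. cnt (NN k) (s / real (NN k) powr (1 / real d)) / real (NN k))"
  have X: "X s' \<longlonglongrightarrow> f s'" if "s' > 0" for s' using lim[OF that] by (simp add: X_def NN_def)
  have ev_ratio: "\<forall>\<^sub>F k in sequentially. s1 / real (NN k) powr (1 / real d) \<le> s2 / real (NN (Suc k)) powr (1 / real d)"
    if "0 < s1" "s1 < s2" for s1 s2
  proof -
    have "s2 / s1 > 1" using that by simp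
    then have "\<forall>\<^sub>F k in sequentially. (real (NN (Suc k)) / real (NN k)) powr (1 / real d) < s2 / s1"
      using ratiod by (rule order_tendstoD(2)[rotated])
    then show ?thesis
    proof eventually_elim
      case (elim k)
      have p: "real (NN k) powr (1 / real d) > 0" "real (NN (Suc k)) powr (1 / real d) > 0" using NN0 by (simp_all add: less_imp_neq[symmetric])
      have "real (NN (Suc k)) powr (1 / real d) / real (NN k) powr (1 / real d) < s2 / s1"
        using elim NN0 by (simp add: powr_divide)
      then show ?case using p that by (simp add: field_simps)
    qed
  qed
  show ?thesis
  proof (rule order_tendstoI)
    fix a assume a: "f s < a"
    have "\<forall>\<^sub>F t in at_right s. f t < a"
      using f a by (intro order_tendstoD(2)[of f "f s"]) (auto simp: isCont_def filterlim_at_split)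
    then obtain s' where s': "s' > s" "f s' < a"
      by (auto simp: eventually_at_right_field) (meson dense)
    have "(\<lambda>k. X s' (Suc k) * (real (NN (Suc k)) / real (NN k))) \<longlonglongrightarrow> f s' * 1"
      using X[of s'] s s' by (intro tendsto_mult ratio LIMSEQ_Suc) auto
    then have "\<forall>\<^sub>F k in sequentially. X s' (Suc k) * (real (NN (Suc k)) / real (NN k)) < a"
      using s' by (intro order_tendstoD(2)) auto
    with ev_ratio[OF s s'(1)] have "\<forall>\<^sub>F k in sequentially. s / real (NN k) powr (1 / real d) \<le> s' / real (NN (Suc k)) powr (1 / real d)
        \<and> X s' (Suc k) * (real (NN (Suc k)) / real (NN k)) < a" by eventually_elim simp
    from eventually_compose_filterlim[OF this ilim] eventually_ge_at_top[of 1]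
    show "\<forall>\<^sub>F N in sequentially. cnt N (s / real N powr (1 / real d)) / real N < a"
    proof eventually_elim
      case (elim N)
      have n: "real (NN (i N)) \<le> real N" using i1[of N] elim by simp
      have "s / real N powr (1 / real d) \<le> s / real (NN (i N)) powr (1 / real d)"
        using n NN0[of "i N"] s elim d by (intro divide_left_mono powr_mono2) auto
      also have "\<dots> \<le> s' / real (NN (Suc (i N))) powr (1 / real d)" using elim by simp
      finally have "cnt N (s / real N powr (1 / real d)) \<le> cnt (NN (Suc (i N))) (s' / real (NN (Suc (i N))) powr (1 / real d))"
        using i2 by (intro mono) auto
      then have "cnt N (s / real N powr (1 / real d)) / real N \<le> cnt (NN (Suc (i N))) (s' / real (NN (Suc (i N))) powr (1 / real d)) / real (NN (i N))"
        using n NN0[of "i N"] nonneg by (intro frac_le) auto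
      also have "\<dots> = X s' (Suc (i N)) * (real (NN (Suc (i N))) / real (NN (i N)))"
        using NN0[of "Suc (i N)"] by (simp add: X_def)
      finally show ?case using elim by simp
    qed
  next
    fix a assume a: "a < f s"
    have "\<forall>\<^sub>F t in at_left s. a < f t"
      using f a by (intro order_tendstoD(1)[of f "f s"]) (auto simp: isCont_def filterlim_at_split)
    then obtain b where b: "b < s" "\<And>t. b < t \<Longrightarrow> t < s \<Longrightarrow> a < f t"
      by (auto simp: eventually_at_left_field)
    obtain s' where "max b 0 < s'" "s' < s" using dense[of "max b 0" s] b s by auto
    then have s': "s' < s" "s' > 0" "a < f s'" using b by auto
    have "(\<lambda>k. X s' k * (real (NN k) / real (NN (Suc k)))) \<longlonglongrightarrow> f s' * 1"
      using X[of s'] s' by (intro tendsto_mult ratio') auto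
    then have "\<forall>\<^sub>F k in sequentially. a < X s' k * (real (NN k) / real (NN (Suc k)))"
      using s' by (intro order_tendstoD(1)) auto
    with ev_ratio[OF s'(2,1)] have "\<forall>\<^sub>F k in sequentially. s' / real (NN k) powr (1 / real d) \<le> s / real (NN (Suc k)) powr (1 / real d)
        \<and> a < X s' k * (real (NN k) / real (NN (Suc k)))" by eventually_elim simp
    from eventually_compose_filterlim[OF this ilim] eventually_ge_at_top[of 1]
    show "\<forall>\<^sub>F N in sequentially. a < cnt N (s / real N powr (1 / real d)) / real N"
    proof eventually_elim
      case (elim N)
      have n: "real N \<le> real (NN (Suc (i N)))" using i2[of N] by simp
      have "s' / real (NN (i N)) powr (1 / real d) \<le> s / real (NN (Suc (i N))) powr (1 / real d)" using elim by simp
      also have "\<dots> \<le> s / real N powr (1 / real d)"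
        using n NN0[of "Suc (i N)"] s elim d by (intro divide_left_mono powr_mono2) auto
      finally have "cnt (NN (i N)) (s' / real (NN (i N)) powr (1 / real d)) \<le> cnt N (s / real N powr (1 / real d))"
        using i1 elim by (intro mono) auto
      then have "cnt (NN (i N)) (s' / real (NN (i N)) powr (1 / real d)) / real (NN (Suc (i N))) \<le> cnt N (s / real N powr (1 / real d)) / real N"
        using n elim nonneg by (intro frac_le) auto
      moreover have "X s' (i N) * (real (NN (i N)) / real (NN (Suc (i N)))) = cnt (NN (i N)) (s' / real (NN (i N)) powr (1 / real d)) / real (NN (Suc (i N)))"
        using NN0[of "i N"] by (simp add: X_def)
      moreover have "a < X s' (i N) * (real (NN (i N)) / real (NN (Suc (i N))))" using elim by blast
      ultimately show ?case by linarith
    qed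
  qed
qed

section \<open>Distance to the nearest integer and the torus norm\<close>

definition int_dist :: "real \<Rightarrow> real" where "int_dist t = \<bar>t - of_int (round t)\<bar>"

lemma int_dist_le: "int_dist t \<le> \<bar>t - of_int k\<bar>"
  unfolding int_dist_def using round_diff_minimal[of t k] by simp

lemma int_dist_cong:
  assumes "t - t' \<in> \<int>"
  shows "int_dist t = int_dist t'"
proof -
  obtain k where k: "t - t' = of_int k" using assms by (auto elim: Ints_cases)
  have "t - of_int (round t' + k) = t' - of_int (round t')" "t' - of_int (round t - k) = t - of_int (round t)"
    using k by simp_all
  then have "int_dist t \<le> int_dist t'" "int_dist t' \<le> int_dist t"
    using int_dist_le[of t "round t' + k"] int_dist_le[of t' "round t - k"]
    unfolding int_dist_def[of t] int_dist_def[of t'] by metis+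
  then show ?thesis by simp
qed

lemma int_dist_minus: "int_dist (- t) = int_dist t"
proof -
  have "int_dist (- t) \<le> int_dist t" for t
    using int_dist_le[of "- t" "- round t"] by (simp add: int_dist_def[of t])
  from this[of t] this[of "- t"] show ?thesis by simp
qed

lemma int_dist_bounds: "0 \<le> int_dist t" "int_dist t \<le> 1 / 2"
  using of_int_round_abs_le[of t] by (simp_all add: int_dist_def abs_minus_commute)

text \<open>Even powers of cos(pi t) are thus decreasing functions of the distance to the integers,
  so a threshold for the distance is a threshold for the cosine power.\<close>

lemma abs_cos_pi: "\<bar>cos (pi * t)\<bar> = cos (pi * int_dist t)"
proof -
  let ?k = "round t"
  have "cos (pi * t) = cos (pi * (t - of_int ?k) + of_int ?k * pi)" by (simp add: algebra_simps)
  also have "\<bar>\<dots>\<bar> = \<bar>cos (pi * (t - of_int ?k))\<bar>"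
    by (simp add: cos_add cos_integer_2pi sin_int_times_real abs_mult mult.commute)
  also have "cos (pi * (t - of_int ?k)) = cos (pi * int_dist t)"
    by (simp add: int_dist_def abs_if) (metis cos_minus minus_diff_eq mult_minus_right)
  also have "\<bar>\<dots>\<bar> = cos (pi * int_dist t)"
    using int_dist_bounds[of t] by (intro abs_of_nonneg cos_ge_zero) (auto intro: order_trans[of _ 0])
  finally show ?thesis .
qed

lemma cos_power_int_dist: "cos (pi * t) ^ (2 * w) = cos (pi * int_dist t) ^ (2 * w)"
  using abs_cos_pi[of t] by (metis power_even_abs_numeral power_mult power2_abs)

lemma cos_power_mono:
  assumes "0 \<le> a" "a \<le> b" "b \<le> 1 / 2"
  shows "cos (pi * b) ^ (2 * w) \<le> cos (pi * a) ^ (2 * w)"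
proof (rule power_mono)
  show "cos (pi * b) \<le> cos (pi * a)"
    using assms by (intro cos_monotone_0_pi_le) (auto intro!: mult_left_mono simp: mult_le_cancel_left1)
  show "0 \<le> cos (pi * b)" using assms by (intro cos_ge_zero) (auto intro: order_trans[of _ 0])
qed

text \<open>The integer vector may be chosen separately in each coordinate; rounding is
  optimal.\<close>

lemma torus_sup_norm_le_iff:
  fixes v :: "real^'d"
  shows "torus_sup_norm v \<le> r \<longleftrightarrow> (\<forall>l. int_dist (v $ l) \<le> r)"
proof
  let ?Z = "{k :: real^'d. \<forall>l. k $ l \<in> \<int>}"
  have ne: "?Z \<noteq> {}" by (auto intro!: exI[of _ 0])
  have bdd: "bdd_below ((\<lambda>k. infnorm (v + k)) ` ?Z)"
    by (intro bdd_belowI[of _ 0]) (auto simp: infnorm_pos_le)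
  assume le: "torus_sup_norm v \<le> r"
  show "\<forall>l. int_dist (v $ l) \<le> r"
  proof
    fix l
    have "int_dist (v $ l) \<le> torus_sup_norm v"
      unfolding torus_sup_norm_def
    proof (rule cINF_greatest[OF ne])
      fix k assume "k \<in> ?Z"
      then have "k $ l \<in> \<int>" by simp
      then obtain z where z: "k $ l = of_int z" by (auto elim: Ints_cases)
      have "int_dist (v $ l) \<le> \<bar>(v + k) $ l\<bar>" using int_dist_le[of "v $ l" "- z"] z by simp
      also have "\<dots> \<le> infnorm (v + k)" by (rule component_le_infnorm_cart)
      finally show "int_dist (v $ l) \<le> infnorm (v + k)" .
    qed
    then show "int_dist (v $ l) \<le> r" using le by simp
  qed
next
  let ?Z = "{k :: real^'d. \<forall>l. k $ l \<in> \<int>}"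
  assume r: "\<forall>l. int_dist (v $ l) \<le> r"
  define k where "k = (\<chi> l. - real_of_int (round (v $ l)))"
  have "torus_sup_norm v \<le> infnorm (v + k)"
    unfolding torus_sup_norm_def
    by (intro cINF_lower bdd_belowI[of _ 0]) (auto simp: infnorm_pos_le k_def)
  also have "\<dots> \<le> r"
    unfolding infnorm_cart
    by (intro cSup_least) (use r in \<open>auto simp: k_def int_dist_def\<close>)
  finally show "torus_sup_norm v \<le> r" .
qed

lemma exp_gauss_integral:
  assumes "j \<ge> 1"
  shows "has_bochner_integral lborel (\<lambda>t. exp (- (real j * (pi\<^sup>2 * t\<^sup>2)))) (1 / sqrt (pi * real j))"
proof -
  define \<sigma> where "\<sigma> = 1 / (pi * sqrt (2 * real j))"
  have \<sigma>: "\<sigma> > 0" "2 * \<sigma>\<^sup>2 = 1 / (pi\<^sup>2 * real j)" using assms by (auto simp: \<sigma>_def power_mult_distrib power_divide)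
  have "sqrt (2 * pi * \<sigma>\<^sup>2) = 1 / sqrt (pi * real j)"
  proof -
    have "2 * pi * \<sigma>\<^sup>2 = pi * (2 * \<sigma>\<^sup>2)" by simp
    also have "\<dots> = 1 / (pi * real j)" unfolding \<sigma>(2) by (simp add: power2_eq_square)
    finally show ?thesis by (simp add: real_sqrt_divide)
  qed
  moreover have "- t\<^sup>2 / (2 * \<sigma>\<^sup>2) = - (real j * (pi\<^sup>2 * t\<^sup>2))" for t
    unfolding \<sigma>(2) by (simp add: field_simps)
  ultimately have e: "exp (- (real j * (pi\<^sup>2 * t\<^sup>2))) = 1 / sqrt (pi * real j) * normal_density 0 \<sigma> t" for t
    using assms by (simp add: normal_density_def)
  have "has_bochner_integral lborel (normal_density 0 \<sigma>) 1"
    using \<sigma> by (simp add: has_bochner_integral_iff)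
  from has_bochner_integral_mult_right[OF this, of "1 / sqrt (pi * real j)"]
  show ?thesis unfolding e by simp
qed

text \<open>There is no constant term, since the constant 1 has the pair sum N - 1, which diverges,
  and no Gaussian integral over the line.\<close>

definition zpoly :: "nat \<Rightarrow> (nat \<Rightarrow> real) \<Rightarrow> real \<Rightarrow> real" where
  "zpoly J q u = (\<Sum>j\<in>{1..J}. q j * u ^ j)"

text \<open>The integral over the real line of the polynomial evaluated at exp(-pi^2 t^2), the limit
  shape of the cosine power.\<close>

definition gauss_mean :: "nat \<Rightarrow> (nat \<Rightarrow> real) \<Rightarrow> real" where
  "gauss_mean J q = (\<Sum>j\<in>{1..J}. q j * (1 / sqrt (pi * real j)))"

lemma gauss_mean_integral:
  "has_bochner_integral lborel (\<lambda>t. zpoly J q (exp (- (pi\<^sup>2 * t\<^sup>2)))) (gauss_mean J q)"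
proof -
  have "zpoly J q (exp (- (pi\<^sup>2 * t\<^sup>2))) = (\<Sum>j\<in>{1..J}. q j * exp (- (real j * (pi\<^sup>2 * t\<^sup>2))))" for t
    by (simp add: zpoly_def exp_of_nat_mult [symmetric])
  moreover have "has_bochner_integral lborel (\<lambda>t. \<Sum>j\<in>{1..J}. q j * exp (- (real j * (pi\<^sup>2 * t\<^sup>2)))) (gauss_mean J q)"
    unfolding gauss_mean_def
    by (intro has_bochner_integral_sum has_bochner_integral_mult_right exp_gauss_integral) simp
  ultimately show ?thesis by (simp only:)
qed

text \<open>The error must vanish at u = 0 like u, since u = exp(-pi^2 t^2) is small for most t and
  a constant error would not be integrable. So the ramp is divided by u before the Weierstrass
  approximation and multiplied by u afterwards, which also removes the constant term.\<close>

lemma ramp_polynomial: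
  fixes t1 t2 e :: real
  assumes t: "0 < t1" "t1 < t2" and e: "e > 0"
  obtains J q h where "J \<ge> 1" "\<And>u. 0 \<le> u \<Longrightarrow> u \<le> 1 \<Longrightarrow> h u \<le> zpoly J q u \<and> zpoly J q u \<le> h u + 2 * e * u"
    "\<And>u. 0 \<le> h u \<and> h u \<le> (1::real)" "\<And>u. u \<ge> exp (- (pi\<^sup>2 * t1\<^sup>2)) \<Longrightarrow> h u = 1"
    "\<And>u. u \<le> exp (- (pi\<^sup>2 * t2\<^sup>2)) \<Longrightarrow> h u = 0"
    "2 * t1 \<le> gauss_mean J q" "gauss_mean J q \<le> 2 * t2 + 2 * e"
proof -
  define a where "a = exp (- (pi\<^sup>2 * t2\<^sup>2))"
  define b where "b = exp (- (pi\<^sup>2 * t1\<^sup>2))"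
  have ab: "0 < a" "a < b" "b \<le> 1"
    using t by (auto simp: a_def b_def power_strict_mono)
  define h where "h = (\<lambda>u. max 0 (min 1 ((u - a) / (b - a))))"
  have h01: "0 \<le> h u \<and> h u \<le> 1" for u by (simp add: h_def)
  have h1: "h u = 1" if "u \<ge> b" for u using that ab by (simp add: h_def)
  have h0: "h u = 0" if "u \<le> a" for u 
  proof -
    have "(u - a) / (b - a) \<le> 0" using that ab by (intro divide_nonpos_pos) auto
    then show ?thesis by (simp add: h_def)
  qed
  \<comment> \<open>The ramp vanishes below a, so dividing by max(u, a) instead of u changes nothing
    but is continuous at 0.\<close>
  have hc: "continuous_on {0..1} (\<lambda>u. h u / max u a)"
    unfolding h_def using ab by (intro continuous_intros) (auto simp: max_def)
  obtain p where p: "real_polynomial_function p" "\<And>u. u \<in> {0..1} \<Longrightarrow> \<bar>h u / max u a - p u\<bar> < e"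
    using Stone_Weierstrass_real_polynomial_function[of "{0..1::real}" "\<lambda>u. h u / max u a" e] hc e by auto
  obtain c n where cn: "p = (\<lambda>u. \<Sum>i\<le>n. c i * u ^ i)"
    using p(1) real_polynomial_function_iff_sum by blast
  \<comment> \<open>Adding e u makes the approximation one-sided: it lies above the ramp by at most
    2 e u.\<close>
  define q where "q = (\<lambda>j. c (j - 1) + (if j = 1 then e else 0))"
  define J where "J = Suc n"
  have zq: "zpoly J q u = u * (p u + e)" for u
  proof -
    have "zpoly J q u = (\<Sum>i\<le>n. q (Suc i) * u ^ Suc i)"
      unfolding zpoly_def J_def by (rule sum.reindex_bij_witness[of _ Suc "\<lambda>j. j - 1"]) auto
    also have "\<dots> = (\<Sum>i\<le>n. u * (c i * u ^ i) + (if i = 0 then e * u else 0))"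
      by (intro sum.cong) (auto simp: q_def algebra_simps)
    also have "\<dots> = u * p u + e * u"
      by (simp add: sum.distrib cn sum_distrib_left)
    finally show ?thesis by (simp add: algebra_simps)
  qed
  have hu: "u * (h u / max u a) = h u" if "0 \<le> u" for u
    using h0[of u] ab that by (cases "u \<le> a") (auto simp: max_def)
  have bnd: "h u \<le> zpoly J q u \<and> zpoly J q u \<le> h u + 2 * e * u" if "0 \<le> u" "u \<le> 1" for u
  proof -
    have "h u / max u a \<le> p u + e" "p u + e \<le> h u / max u a + 2 * e" using p(2)[of u] that by auto
    then have "u * (h u / max u a) \<le> u * (p u + e)" "u * (p u + e) \<le> u * (h u / max u a + 2 * e)"
      using that(1) by (simp_all only: mult_left_mono)
    then show ?thesis using hu[OF that(1)] by (simp add: zq algebra_simps)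
  qed
  let ?g = "\<lambda>t :: real. exp (- (pi\<^sup>2 * t\<^sup>2))"
  note gm = gauss_mean_integral[of J q, unfolded has_bochner_integral_iff]
  have g1: "has_bochner_integral lborel ?g (1 / sqrt pi)" using exp_gauss_integral[of 1] by simp
  have ind: "has_bochner_integral lborel (indicator {- r..r} :: real \<Rightarrow> real) (2 * r)" if "r \<ge> 0" for r :: real
    using that by (simp add: has_bochner_integral_iff)
  have gle: "?g t \<le> ?g r" if "r \<ge> 0" "\<bar>t\<bar> \<ge> r" for t r
    using that power_mono[of r "\<bar>t\<bar>" 2] by simp
  have gge: "?g t \<ge> ?g r" if "\<bar>t\<bar> \<le> r" for t r
    using that power_mono[of "\<bar>t\<bar>" r 2] by simp
  have lower: "2 * t1 \<le> gauss_mean J q"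
  proof -
    have "2 * t1 = (\<integral>t. indicator {- t1..t1} t \<partial>lborel)" using ind[of t1] t by (simp add: has_bochner_integral_iff)
    also have "\<dots> \<le> (\<integral>t. zpoly J q (?g t) \<partial>lborel)"
    proof (rule integral_mono)
      fix t :: real
      have "indicator {- t1..t1} t \<le> h (?g t)"
        using gge[of t t1] h1[of "?g t"] h01[of "?g t"] by (auto simp: indicator_def b_def)
      then show "indicator {- t1..t1} t \<le> zpoly J q (?g t)" using bnd[of "?g t"] by simp
    qed (use gm ind[of t1] t in \<open>auto simp: has_bochner_integral_iff\<close>)
    finally show ?thesis using gm by simp
  qed
  have upper: "gauss_mean J q \<le> 2 * t2 + 2 * e"
  proof -
    have i2: "has_bochner_integral lborel (\<lambda>t. indicator {- t2..t2} t + 2 * e * ?g t) (2 * t2 + 2 * e * (1 / sqrt pi))"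
      using t by (intro has_bochner_integral_add has_bochner_integral_mult_right ind g1) auto
    have "gauss_mean J q = (\<integral>t. zpoly J q (?g t) \<partial>lborel)" using gm by simp
    also have "\<dots> \<le> (\<integral>t. indicator {- t2..t2} t + 2 * e * ?g t \<partial>lborel)"
    proof (rule integral_mono)
      fix t :: real
      have "h (?g t) \<le> indicator {- t2..t2} t"
        using gle[of t2 t] h0[of "?g t"] h01[of "?g t"] t by (auto simp: indicator_def a_def)
      then show "zpoly J q (?g t) \<le> indicator {- t2..t2} t + 2 * e * ?g t" using bnd[of "?g t"] by simp
    qed (use gm i2 in \<open>auto simp: has_bochner_integral_iff\<close>)
    also have "\<dots> = 2 * t2 + 2 * e * (1 / sqrt pi)" using i2 by (simp add: has_bochner_integral_iff)
    also have "1 / sqrt pi \<le> 1" using pi_gt3 by simp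
    then have "2 * t2 + 2 * e * (1 / sqrt pi) \<le> 2 * t2 + 2 * e * 1" using e by (intro add_mono mult_left_mono) auto
    finally show ?thesis by simp
  qed
  show ?thesis
    by (rule that[of J h q]) (use bnd h01 h1 h0 lower upper in \<open>auto simp: J_def a_def b_def\<close>)
qed

text \<open>Minorants \<open>c\<close> can be negative, so their product need not lie below the
  product of the \<open>a\<close>. Instead the difference of the products of \<open>b\<close> and
  \<open>a\<close> is telescoped, with b - a enlarged to b - c in one factor and a to b in the
  others.\<close>

lemma prod_diff_le_telescope:
  fixes a b c :: "'l \<Rightarrow> real"
  assumes fin: "finite L" and ab: "\<And>l. l \<in> L \<Longrightarrow> 0 \<le> a l \<and> a l \<le> b l \<and> c l \<le> a l"
  shows "(\<Prod>l\<in>L. b l) - (\<Sum>l\<in>L. \<Prod>l'\<in>L. if l' = l then b l - c l else b l') \<le> (\<Prod>l\<in>L. a l)"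
  using fin ab
proof (induction L)
  case (insert m L)
  let ?S = "\<Sum>l\<in>L. \<Prod>l'\<in>L. if l' = l then b l - c l else b l'"
  have m: "0 \<le> a m" "a m \<le> b m" "c m \<le> a m" using insert.prems by auto
  have pb: "(\<Prod>l\<in>L. b l) \<ge> 0" using insert.prems by (intro prod_nonneg) force
  have pab: "(\<Prod>l\<in>L. a l) \<le> (\<Prod>l\<in>L. b l)" using insert.prems by (intro prod_mono) auto
  have IH: "(\<Prod>l\<in>L. b l) - ?S \<le> (\<Prod>l\<in>L. a l)" using insert by auto
  have "(\<Sum>l\<in>insert m L. \<Prod>l'\<in>insert m L. if l' = l then b l - c l else b l')
      = (\<Prod>l'\<in>insert m L. if l' = m then b m - c m else b l') + (\<Sum>l\<in>L. \<Prod>l'\<in>insert m L. if l' = l then b l - c l else b l')"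
    using insert.hyps by simp
  also have "(\<Prod>l'\<in>insert m L. if l' = m then b m - c m else b l') = (b m - c m) * (\<Prod>l\<in>L. b l)"
  proof -
    have "(\<Prod>l'\<in>L. if l' = m then b m - c m else b l') = (\<Prod>l\<in>L. b l)"
      using insert.hyps by (intro prod.cong) auto
    then show ?thesis using insert.hyps by simp
  qed
  also have "(\<Sum>l\<in>L. \<Prod>l'\<in>insert m L. if l' = l then b l - c l else b l') = b m * ?S"
    unfolding sum_distrib_left
  proof (rule sum.cong[OF refl])
    fix l assume "l \<in> L"
    then have "m \<noteq> l" using insert.hyps by auto
    then show "(\<Prod>l'\<in>insert m L. if l' = l then b l - c l else b l') = b m * (\<Prod>l'\<in>L. if l' = l then b l - c l else b l')"
      using insert.hyps by simp
  qed
  finally have S: "(\<Sum>l\<in>insert m L. \<Prod>l'\<in>insert m L. if l' = l then b l - c l else b l') = (b m - c m) * (\<Prod>l\<in>L. b l) + b m * ?S" .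
  have "b m * ((\<Prod>l\<in>L. b l) - ?S) \<le> b m * (\<Prod>l\<in>L. a l)" using IH m by (intro mult_left_mono) auto
  moreover have "(b m - a m) * (\<Prod>l\<in>L. a l) \<le> (b m - a m) * (\<Prod>l\<in>L. b l)" using pab m by (intro mult_left_mono) auto
  moreover have "(b m - a m) * (\<Prod>l\<in>L. b l) \<le> (b m - c m) * (\<Prod>l\<in>L. b l)" using pb m by (intro mult_right_mono) auto
  moreover have "(\<Prod>l\<in>insert m L. b l) = b m * (\<Prod>l\<in>L. b l)" "(\<Prod>l\<in>insert m L. a l) = a m * (\<Prod>l\<in>L. a l)"
    using insert.hyps by auto
  ultimately show ?case unfolding S by (simp add: algebra_simps)
qed simp

definition near_pairs :: "(nat \<Rightarrow> real^'d) \<Rightarrow> real^'d \<Rightarrow> nat \<Rightarrow> real \<Rightarrow> (nat \<times> nat) set" where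
  "near_pairs x \<alpha> N r = {s \<in> index_pairs N. \<forall>l. int_dist (gap_vec x UNIV s l * \<alpha> $ l) \<le> r}"

lemma finite_near_pairs [simp]: "finite (near_pairs x \<alpha> N r)"
  by (simp add: near_pairs_def)

text \<open>Fractional parts change differences by integers only, and the distance is symmetric, so
  every index pair is counted twice.\<close>

lemma pair_correlation_eq_near_pairs:
  fixes x :: "nat \<Rightarrow> real^'d"
  shows "pair_correlation s (\<lambda>n. \<chi> l. frac (x n $ l * \<alpha> $ l)) N
    = 2 * real (card (near_pairs x \<alpha> N (s / real N powr (1 / real CARD('d))))) / real N"
proof -
  define r where "r = s / real N powr (1 / real CARD('d))"
  define y where "y = (\<lambda>n. \<chi> l. frac (x n $ l * \<alpha> $ l))"
  have dist: "torus_sup_norm (y n - y m) \<le> r \<longleftrightarrow> (\<forall>l. int_dist ((x n $ l - x m $ l) * \<alpha> $ l) \<le> r)" for n m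
  proof -
    have "int_dist ((y n - y m) $ l) = int_dist ((x n $ l - x m $ l) * \<alpha> $ l)" for l
      by (rule int_dist_cong) (simp add: y_def frac_def algebra_simps)
    then show ?thesis by (simp only: torus_sup_norm_le_iff)
  qed
  have sym: "int_dist ((x n $ l - x m $ l) * \<alpha> $ l) = int_dist ((x m $ l - x n $ l) * \<alpha> $ l)" for n m l
    using int_dist_minus[of "(x n $ l - x m $ l) * \<alpha> $ l"] by (simp add: algebra_simps)
  let ?P = "{(n, m). n \<in> {1..N} \<and> m \<in> {1..N} \<and> n \<noteq> m \<and> torus_sup_norm (y n - y m) \<le> r}"
  let ?G = "near_pairs x \<alpha> N r"
  have "?P = ?G \<union> prod.swap ` ?G"
  proof (intro set_eqI iffI)
    fix p assume "p \<in> ?P"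
    then obtain n m where p: "p = (n, m)" "n \<in> {1..N}" "m \<in> {1..N}" "n \<noteq> m"
      "\<forall>l. int_dist ((x n $ l - x m $ l) * \<alpha> $ l) \<le> r" by (auto simp: dist)
    show "p \<in> ?G \<union> prod.swap ` ?G"
    proof (cases "n < m")
      case True
      then have "p \<in> ?G" using p sym[of n _ m] by (auto simp: near_pairs_def index_pairs_def gap_vec_def)
      then show ?thesis by simp
    next
      case False
      then have "prod.swap p \<in> ?G" using p by (auto simp: near_pairs_def index_pairs_def gap_vec_def)
      then have "prod.swap (prod.swap p) \<in> prod.swap ` ?G" by (rule imageI)
      then show ?thesis by simp
    qed
  next
    fix p assume "p \<in> ?G \<union> prod.swap ` ?G"
    then show "p \<in> ?P"
      using sym by (auto simp: near_pairs_def index_pairs_def gap_vec_def dist)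
  qed
  moreover have "?G \<inter> prod.swap ` ?G = {}" by (auto simp: near_pairs_def index_pairs_def)
  ultimately have "card ?P = card ?G + card (prod.swap ` ?G)"
    by (simp add: card_Un_disjoint)
  also have "card (prod.swap ` ?G) = card ?G" by (intro card_image) (auto simp: inj_on_def)
  finally have "card ?P = 2 * card ?G" by simp
  then have "real (card ?P) = 2 * real (card ?G)" by simp
  then show ?thesis unfolding pair_correlation_def r_def [symmetric] y_def [symmetric] by simp
qed

text \<open>Expanding the product gives finitely many monomials, and the monomial with exponents j_l
  is \<open>smooth_corr\<close> with the powers 2 w j_l. Products of cosine powers never leave the
  controlled family.\<close>

lemma polynomial_corr_limit:
  fixes x :: "nat \<Rightarrow> real^'d" and q :: "'d \<Rightarrow> nat \<Rightarrow> real"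
  assumes lim: "\<And>j. (\<And>l. j l \<ge> 1) \<Longrightarrow>
    (\<lambda>i. smooth_corr x (\<lambda>l. width CARD('d) (NN i) * j l) (NN i) \<alpha>) \<longlonglongrightarrow> (\<Prod>l\<in>UNIV. 1 / sqrt (pi * real (j l)))"
  shows "(\<lambda>i. 2 / real (NN i) * (\<Sum>s\<in>index_pairs (NN i). \<Prod>l\<in>UNIV.
      zpoly J (q l) (cos (pi * (gap_vec x UNIV s l * \<alpha> $ l)) ^ (2 * width CARD('d) (NN i)))))
    \<longlonglongrightarrow> (\<Prod>l\<in>UNIV. gauss_mean J (q l))"
proof -
  let ?P = "PiE (UNIV :: 'd set) (\<lambda>_. {1..J})"
  have "(\<lambda>i. \<Sum>j\<in>?P. (\<Prod>l\<in>UNIV. q l (j l)) * smooth_corr x (\<lambda>l. width CARD('d) (NN i) * j l) (NN i) \<alpha>)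
      \<longlonglongrightarrow> (\<Sum>j\<in>?P. (\<Prod>l\<in>UNIV. q l (j l)) * (\<Prod>l\<in>UNIV. 1 / sqrt (pi * real (j l))))"
  proof (intro tendsto_sum tendsto_mult tendsto_const lim)
    fix j l assume "j \<in> ?P"
    then have "j l \<in> {1..J}" by auto
    then show "1 \<le> j l" by simp
  qed
  also have "(\<Sum>j\<in>?P. (\<Prod>l\<in>UNIV. q l (j l)) * (\<Prod>l\<in>UNIV. 1 / sqrt (pi * real (j l)))) = (\<Prod>l\<in>UNIV. gauss_mean J (q l))"
    unfolding gauss_mean_def by (subst prod_sum_PiE) (simp_all flip: prod.distrib)
  also have "(\<lambda>i. \<Sum>j\<in>?P. (\<Prod>l\<in>UNIV. q l (j l)) * smooth_corr x (\<lambda>l. width CARD('d) (NN i) * j l) (NN i) \<alpha>)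
      = (\<lambda>i. 2 / real (NN i) * (\<Sum>s\<in>index_pairs (NN i). \<Prod>l\<in>UNIV.
      zpoly J (q l) (cos (pi * (gap_vec x UNIV s l * \<alpha> $ l)) ^ (2 * width CARD('d) (NN i)))))"
  proof
    fix i
    let ?c = "\<lambda>s l. cos (pi * (gap_vec x UNIV s l * \<alpha> $ l))" and ?w = "width CARD('d) (NN i)"
    have "(\<Prod>l\<in>UNIV. zpoly J (q l) (?c s l ^ (2 * ?w))) = (\<Sum>j\<in>?P. (\<Prod>l\<in>UNIV. q l (j l)) * (\<Prod>l\<in>UNIV. ?c s l ^ (2 * (?w * j l))))" for s
      unfolding zpoly_def by (subst prod_sum_PiE) (auto simp: prod.distrib mult.assoc simp flip: power_mult)
    then have "(\<Sum>s\<in>index_pairs (NN i). \<Prod>l\<in>UNIV. zpoly J (q l) (?c s l ^ (2 * ?w)))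
        = (\<Sum>j\<in>?P. \<Sum>s\<in>index_pairs (NN i). (\<Prod>l\<in>UNIV. q l (j l)) * (\<Prod>l\<in>UNIV. ?c s l ^ (2 * (?w * j l))))"
      by (simp only: sum.swap[of _ "index_pairs (NN i)"])
    then show "(\<Sum>j\<in>?P. (\<Prod>l\<in>UNIV. q l (j l)) * smooth_corr x (\<lambda>l. ?w * j l) (NN i) \<alpha>)
        = 2 / real (NN i) * (\<Sum>s\<in>index_pairs (NN i). \<Prod>l\<in>UNIV. zpoly J (q l) (?c s l ^ (2 * ?w)))"
      by (simp add: smooth_corr_def sum_distrib_left mult.left_commute)
  qed
  finally show ?thesis .
qed

text \<open>From ln cos x ~ -x^2/2 and w ~ N^(2/d): at distance s N^(-1/d) the kernel takes a
  Gaussian value independent of N, which becomes the threshold for u.\<close>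

lemma cos_power_width_limit:
  assumes d: "d \<ge> 1" and s: "s > 0"
  shows "(\<lambda>N. cos (pi * (s / real N powr (1 / real d))) ^ (2 * width d N)) \<longlonglongrightarrow> exp (- (pi\<^sup>2 * s\<^sup>2))"
proof -
  let ?y = "\<lambda>N :: nat. real N powr (1 / real d)"
  have y: "filterlim ?y at_top sequentially" using d by (intro powr_at_top_nat) auto
  have "((\<lambda>t. t\<^sup>2 * ln (cos (pi * (s / t)))) \<longlongrightarrow> - (pi\<^sup>2 * s\<^sup>2 / 2)) at_top"
    using s by (real_asymp simp: power2_eq_square)
  from filterlim_compose[OF this y]
  have l1: "(\<lambda>N. (?y N)\<^sup>2 * ln (cos (pi * (s / ?y N)))) \<longlonglongrightarrow> - (pi\<^sup>2 * s\<^sup>2 / 2)" .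
  have "(\<lambda>N. inverse ((?y N / sqrt (real (width d N)))\<^sup>2)) \<longlonglongrightarrow> inverse (1\<^sup>2)"
    by (intro tendsto_inverse tendsto_power width_asymp d) simp
  then have l2: "(\<lambda>N. real (width d N) / (?y N)\<^sup>2) \<longlonglongrightarrow> 1" by (simp add: power_divide)
  have "(\<lambda>N. exp (2 * (real (width d N) / (?y N)\<^sup>2) * ((?y N)\<^sup>2 * ln (cos (pi * (s / ?y N)))))) \<longlonglongrightarrow> exp (2 * 1 * - (pi\<^sup>2 * s\<^sup>2 / 2))"
    by (intro tendsto_exp tendsto_mult tendsto_const l1 l2)
  moreover have "\<forall>\<^sub>F N in sequentially. exp (2 * (real (width d N) / (?y N)\<^sup>2) * ((?y N)\<^sup>2 * ln (cos (pi * (s / ?y N)))))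
      = cos (pi * (s / ?y N)) ^ (2 * width d N)"
  proof -
    have "((\<lambda>t. cos (pi * (s / t))) \<longlongrightarrow> 1) at_top" using s by real_asymp
    from filterlim_compose[OF this y] have "\<forall>\<^sub>F N in sequentially. cos (pi * (s / ?y N)) > 0"
      by (rule order_tendstoD(1)) simp
    then show ?thesis using eventually_ge_at_top[of 1]
    proof eventually_elim
      case (elim N)
      have "?y N > 0" using elim by simp
      then have "exp (2 * (real (width d N) / (?y N)\<^sup>2) * ((?y N)\<^sup>2 * ln (cos (pi * (s / ?y N))))) = exp (real (2 * width d N) * ln (cos (pi * (s / ?y N))))"
        by simp
      also have "\<dots> = exp (ln (cos (pi * (s / ?y N)))) ^ (2 * width d N)" by (rule exp_of_nat_mult)
      finally show ?case using elim by simp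
    qed
  qed
  ultimately have "(\<lambda>N. cos (pi * (s / ?y N)) ^ (2 * width d N)) \<longlonglongrightarrow> exp (2 * 1 * - (pi\<^sup>2 * s\<^sup>2 / 2))"
    by (rule Lim_transform_eventually)
  then show ?thesis by simp
qed

lemma zpoly_extend:
  assumes "J \<le> J'"
  shows "zpoly J' (\<lambda>j. if j \<le> J then q j else 0) u = zpoly J q u"
    and "gauss_mean J' (\<lambda>j. if j \<le> J then q j else 0) = gauss_mean J q"
proof -
  have *: "(\<Sum>j\<in>{1..J'}. (if j \<le> J then q j else 0) * f j) = (\<Sum>j\<in>{1..J}. q j * f j)" for f :: "nat \<Rightarrow> real"
    using assms by (intro sum.mono_neutral_cong_right) auto
  show "zpoly J' (\<lambda>j. if j \<le> J then q j else 0) u = zpoly J q u"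
    "gauss_mean J' (\<lambda>j. if j \<le> J then q j else 0) = gauss_mean J q"
    unfolding zpoly_def gauss_mean_def by (rule *)+
qed

lemma zpoly_diff: "zpoly J (\<lambda>j. p j - q j) u = zpoly J p u - zpoly J q u"
  by (simp add: zpoly_def left_diff_distrib sum_subtractf)

lemma gauss_mean_diff: "gauss_mean J (\<lambda>j. p j - q j) = gauss_mean J p - gauss_mean J q"
  by (simp only: gauss_mean_def left_diff_distrib sum_subtractf)

lemma zpoly_linear:
  assumes "J \<ge> 1"
  shows "zpoly J (\<lambda>j. if j = 1 then e else 0) u = e * u"
    and "gauss_mean J (\<lambda>j. if j = 1 then e else 0) = e / sqrt pi"
proof -
  have *: "(\<Sum>j\<in>{1..J}. (if j = 1 then e else 0) * f j) = e * f 1" for f :: "nat \<Rightarrow> real"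
    using assms by (subst sum.remove[of _ 1]) (auto intro!: sum.neutral)
  show "zpoly J (\<lambda>j. if j = 1 then e else 0) u = e * u"
    "gauss_mean J (\<lambda>j. if j = 1 then e else 0) = e / sqrt pi"
    unfolding zpoly_def gauss_mean_def by (subst *, simp)+
qed

text \<open>The ramps leave a margin \<eta> on either side of s, because the cosine power at the
  radius only converges to exp(-pi^2 s^2). The ramp approximation already lies above; for
  \<open>q\<close> the term 2 \<eta> u is subtracted to push it below. In both cases 6\<eta> is
  twice the shift 2\<eta> plus the error 2\<eta>.\<close>

lemma sandwich_polynomials:
  fixes s \<eta> :: real
  assumes \<eta>: "0 < \<eta>" "2 * \<eta> < s"
  obtains J p q where
    "\<And>u. 0 \<le> u \<Longrightarrow> u \<le> 1 \<Longrightarrow> 0 \<le> zpoly J p u"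
    "\<And>u. exp (- (pi\<^sup>2 * (s + \<eta>)\<^sup>2)) \<le> u \<Longrightarrow> u \<le> 1 \<Longrightarrow> 1 \<le> zpoly J p u"
    "\<And>u. 0 \<le> u \<Longrightarrow> u \<le> 1 \<Longrightarrow> zpoly J q u \<le> 1"
    "\<And>u. 0 \<le> u \<Longrightarrow> u \<le> exp (- (pi\<^sup>2 * (s - \<eta>)\<^sup>2)) \<Longrightarrow> zpoly J q u \<le> 0"
    "2 * s \<le> gauss_mean J p" "gauss_mean J p \<le> 2 * s + 6 * \<eta>" "2 * s - 6 * \<eta> \<le> gauss_mean J q"
proof -
  obtain J1 q1 h1 where 1: "J1 \<ge> 1"
    "\<And>u. 0 \<le> u \<Longrightarrow> u \<le> 1 \<Longrightarrow> h1 u \<le> zpoly J1 q1 u \<and> zpoly J1 q1 u \<le> h1 u + 2 * \<eta> * u"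
    "\<And>u. 0 \<le> h1 u \<and> h1 u \<le> (1::real)" "\<And>u. u \<ge> exp (- (pi\<^sup>2 * (s + \<eta>)\<^sup>2)) \<Longrightarrow> h1 u = 1"
    "\<And>u. u \<le> exp (- (pi\<^sup>2 * (s + 2 * \<eta>)\<^sup>2)) \<Longrightarrow> h1 u = 0"
    "2 * (s + \<eta>) \<le> gauss_mean J1 q1" "gauss_mean J1 q1 \<le> 2 * (s + 2 * \<eta>) + 2 * \<eta>"
  proof (rule ramp_polynomial[of "s + \<eta>" "s + 2 * \<eta>" \<eta>])
    show "0 < s + \<eta>" "s + \<eta> < s + 2 * \<eta>" "0 < \<eta>" using \<eta> by auto
  qed (rule that)
  obtain J2 q2 h2 where 2: "J2 \<ge> 1"
    "\<And>u. 0 \<le> u \<Longrightarrow> u \<le> 1 \<Longrightarrow> h2 u \<le> zpoly J2 q2 u \<and> zpoly J2 q2 u \<le> h2 u + 2 * \<eta> * u"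
    "\<And>u. 0 \<le> h2 u \<and> h2 u \<le> (1::real)" "\<And>u. u \<ge> exp (- (pi\<^sup>2 * (s - 2 * \<eta>)\<^sup>2)) \<Longrightarrow> h2 u = 1"
    "\<And>u. u \<le> exp (- (pi\<^sup>2 * (s - \<eta>)\<^sup>2)) \<Longrightarrow> h2 u = 0"
    "2 * (s - 2 * \<eta>) \<le> gauss_mean J2 q2" "gauss_mean J2 q2 \<le> 2 * (s - \<eta>) + 2 * \<eta>"
  proof (rule ramp_polynomial[of "s - 2 * \<eta>" "s - \<eta>" \<eta>])
    show "0 < s - 2 * \<eta>" "s - 2 * \<eta> < s - \<eta>" "0 < \<eta>" using \<eta> by auto
  qed (rule that)
  define J where "J = max J1 J2"
  have J: "J1 \<le> J" "J2 \<le> J" "1 \<le> J" using 1(1) by (auto simp: J_def)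
  define p where "p = (\<lambda>j. if j \<le> J1 then q1 j else 0)"
  define q where "q = (\<lambda>j. (if j \<le> J2 then q2 j else 0) - (if j = 1 then 2 * \<eta> else 0))"
  have p: "zpoly J p u = zpoly J1 q1 u" "gauss_mean J p = gauss_mean J1 q1" for u
    unfolding p_def using zpoly_extend[OF J(1)] by auto
  have q: "zpoly J q u = zpoly J2 q2 u - 2 * \<eta> * u" "gauss_mean J q = gauss_mean J2 q2 - 2 * \<eta> / sqrt pi" for u
    unfolding q_def zpoly_diff gauss_mean_diff using zpoly_extend[OF J(2)] zpoly_linear[OF J(3)] by auto
  have le1: "exp (- (pi\<^sup>2 * (s - \<eta>)\<^sup>2)) \<le> 1" by simp
  have "1 / sqrt pi \<le> 1" using pi_gt3 by simp
  then have "2 * \<eta> * (1 / sqrt pi) \<le> 2 * \<eta> * 1" using \<eta> by (intro mult_left_mono) auto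
  then have sp: "2 * \<eta> / sqrt pi \<le> 2 * \<eta>" by simp
  show ?thesis
  proof (rule that[of J p q])
    fix u :: real
    show "0 \<le> zpoly J p u" if "0 \<le> u" "u \<le> 1" using 1(2)[OF that] 1(3)[of u] p(1)[of u] by linarith
    show "1 \<le> zpoly J p u" if "exp (- (pi\<^sup>2 * (s + \<eta>)\<^sup>2)) \<le> u" "u \<le> 1"
      using 1(2)[OF order_trans[OF exp_ge_zero that(1)] that(2)] 1(4)[OF that(1)] p(1)[of u] by linarith
    show "zpoly J q u \<le> 1" if "0 \<le> u" "u \<le> 1" using 2(2)[OF that] 2(3)[of u] q(1)[of u] that mult_nonneg_nonneg[of "2 * \<eta>" u] \<eta> by linarith
    show "zpoly J q u \<le> 0" if "0 \<le> u" "u \<le> exp (- (pi\<^sup>2 * (s - \<eta>)\<^sup>2))"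
      using 2(2)[OF that(1) order_trans[OF that(2) le1]] 2(5)[OF that(2)] q(1)[of u] by linarith
    show "2 * s \<le> gauss_mean J p" unfolding p(2) using 1(6) \<eta> by (simp add: algebra_simps)
    show "gauss_mean J p \<le> 2 * s + 6 * \<eta>" unfolding p(2) using 1(7) by (simp add: algebra_simps)
    show "2 * s - 6 * \<eta> \<le> gauss_mean J q" unfolding q(2) using 2(6) sp by (simp add: algebra_simps)
  qed
qed

lemma near_pairs_limit:
  fixes x :: "nat \<Rightarrow> real^'d"
  assumes lim: "\<And>j. (\<And>l. j l \<ge> 1) \<Longrightarrow>
    (\<lambda>i. smooth_corr x (\<lambda>l. width CARD('d) (NN i) * j l) (NN i) \<alpha>) \<longlonglongrightarrow> (\<Prod>l\<in>UNIV. 1 / sqrt (pi * real (j l)))"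
    and NN: "filterlim NN at_top sequentially" and s: "s > 0"
  shows "(\<lambda>i. 2 * real (card (near_pairs x \<alpha> (NN i) (s / real (NN i) powr (1 / real CARD('d))))) / real (NN i)) \<longlonglongrightarrow> (2 * s) ^ CARD('d)"
proof -
  define d where "d = CARD('d)"
  have d: "d \<ge> 1" by (simp add: d_def Suc_le_eq)
  define r where "r = (\<lambda>i. s / real (NN i) powr (1 / real d))"
  define X where "X = (\<lambda>i. 2 * real (card (near_pairs x \<alpha> (NN i) (r i))) / real (NN i))"
  define u where "u = (\<lambda>i \<sigma> l. cos (pi * (gap_vec x UNIV \<sigma> l * \<alpha> $ l)) ^ (2 * width d (NN i)))"
  have u01: "0 \<le> u i \<sigma> l" "u i \<sigma> l \<le> 1" for i \<sigma> l
    unfolding u_def by (simp_all add: power_mult power_le_one abs_square_le_1)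
  define ind where "ind = (\<lambda>i \<sigma> l. if int_dist (gap_vec x UNIV \<sigma> l * \<alpha> $ l) \<le> r i then 1 else 0 :: real)"
  have ind0: "0 \<le> ind i \<sigma> l" for i \<sigma> l by (simp add: ind_def)
  have Xeq: "X i = 2 / real (NN i) * (\<Sum>\<sigma>\<in>index_pairs (NN i). \<Prod>l\<in>UNIV. ind i \<sigma> l)" for i
  proof -
    have "(\<Prod>l\<in>UNIV. ind i \<sigma> l) = (if \<forall>l. int_dist (gap_vec x UNIV \<sigma> l * \<alpha> $ l) \<le> r i then 1 else 0)" for \<sigma>
      by (auto simp: ind_def)
    then have "(\<Sum>\<sigma>\<in>index_pairs (NN i). \<Prod>l\<in>UNIV. ind i \<sigma> l) = real (card (near_pairs x \<alpha> (NN i) (r i)))"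
      by (simp add: near_pairs_def flip: sum.inter_filter)
    then show ?thesis by (simp add: X_def)
  qed
  have cr: "(\<lambda>i. cos (pi * r i) ^ (2 * width d (NN i))) \<longlonglongrightarrow> exp (- (pi\<^sup>2 * s\<^sup>2))"
    unfolding r_def by (rule filterlim_compose[OF cos_power_width_limit[OF d s] NN])
  have r0: "r \<longlonglongrightarrow> 0"
    unfolding r_def
    by (rule filterlim_compose[OF _ NN])
      (use d in \<open>auto intro!: tendsto_divide_0[OF tendsto_const] filterlim_at_top_imp_at_infinity powr_at_top_nat\<close>)
  \<comment> \<open>The majorant has mean at most 2s + 6\<eta> per coordinate. Below, telescoping
    gives d error terms, each with one factor at most 12\<eta>, the difference of the two
    means.\<close>
  have bounds: "(\<forall>A>(2 * s + 6 * \<eta>) ^ d. \<forall>\<^sub>F i in sequentially. X i < A) \<and>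
      (\<forall>A<(2 * s) ^ d - real d * (12 * \<eta> * (2 * s + 6 * \<eta>) ^ (d - 1)). \<forall>\<^sub>F i in sequentially. A < X i)"
    if \<eta>: "0 < \<eta>" "2 * \<eta> < s" for \<eta>
  proof -
    obtain J p q where pq:
      "\<And>u. 0 \<le> u \<Longrightarrow> u \<le> 1 \<Longrightarrow> 0 \<le> zpoly J p u"
      "\<And>u. exp (- (pi\<^sup>2 * (s + \<eta>)\<^sup>2)) \<le> u \<Longrightarrow> u \<le> 1 \<Longrightarrow> 1 \<le> zpoly J p u"
      "\<And>u. 0 \<le> u \<Longrightarrow> u \<le> 1 \<Longrightarrow> zpoly J q u \<le> 1"
      "\<And>u. 0 \<le> u \<Longrightarrow> u \<le> exp (- (pi\<^sup>2 * (s - \<eta>)\<^sup>2)) \<Longrightarrow> zpoly J q u \<le> 0"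
      "2 * s \<le> gauss_mean J p" "gauss_mean J p \<le> 2 * s + 6 * \<eta>" "2 * s - 6 * \<eta> \<le> gauss_mean J q"
      by (rule sandwich_polynomials[OF \<eta>]) (rule that)
    let ?a = "gauss_mean J p" and ?b = "gauss_mean J q"
    have e1: "exp (- (pi\<^sup>2 * (s + \<eta>)\<^sup>2)) < exp (- (pi\<^sup>2 * s\<^sup>2))"
      using \<eta> s by (simp add: power_strict_mono)
    have e2: "exp (- (pi\<^sup>2 * s\<^sup>2)) < exp (- (pi\<^sup>2 * (s - \<eta>)\<^sup>2))"
      using \<eta> s by (simp add: power_strict_mono)
    have ev: "\<forall>\<^sub>F i in sequentially. \<forall>\<sigma> l. zpoly J q (u i \<sigma> l) \<le> ind i \<sigma> l \<and> ind i \<sigma> l \<le> zpoly J p (u i \<sigma> l)"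
      using order_tendstoD(1)[OF cr e1] order_tendstoD(2)[OF cr e2] order_tendstoD(2)[OF r0, of "1 / 2", simplified]
        eventually_compose_filterlim[OF eventually_ge_at_top[of 1] NN]
    proof eventually_elim
      case (elim i)
      have r: "0 \<le> r i" "r i \<le> 1 / 2" using elim s by (auto simp: r_def)
      show ?case
      proof (intro allI)
        fix \<sigma> l
        let ?\<delta> = "int_dist (gap_vec x UNIV \<sigma> l * \<alpha> $ l)"
        have ue: "u i \<sigma> l = cos (pi * ?\<delta>) ^ (2 * width d (NN i))" unfolding u_def by (rule cos_power_int_dist)
        show "zpoly J q (u i \<sigma> l) \<le> ind i \<sigma> l \<and> ind i \<sigma> l \<le> zpoly J p (u i \<sigma> l)"
        proof (cases "?\<delta> \<le> r i")
          case True
          have "cos (pi * r i) ^ (2 * width d (NN i)) \<le> u i \<sigma> l"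
            unfolding ue using True r int_dist_bounds by (intro cos_power_mono) auto
          then have "1 \<le> zpoly J p (u i \<sigma> l)" using elim u01 by (intro pq(2)) auto
          then show ?thesis using True pq(3)[OF u01] by (simp add: ind_def)
        next
          case False
          have "u i \<sigma> l \<le> cos (pi * r i) ^ (2 * width d (NN i))"
            unfolding ue using False r int_dist_bounds by (intro cos_power_mono) auto
          then have "zpoly J q (u i \<sigma> l) \<le> 0" using elim u01 by (intro pq(4)) auto
          then show ?thesis using False pq(1)[OF u01] by (simp add: ind_def)
        qed
      qed
    qed
    define Y where "Y = (\<lambda>i. 2 / real (NN i) * (\<Sum>\<sigma>\<in>index_pairs (NN i). \<Prod>l\<in>UNIV. zpoly J p (u i \<sigma> l)))"
    \<comment> \<open>The error term in which coordinate l carries p - q, again a polynomial without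
      constant term and hence with a known limit.\<close>
    define Y' where "Y' = (\<lambda>i l. 2 / real (NN i) * (\<Sum>\<sigma>\<in>index_pairs (NN i). \<Prod>l'\<in>UNIV. zpoly J (if l' = l then (\<lambda>j. p j - q j) else p) (u i \<sigma> l')))"
    have Y: "Y \<longlonglongrightarrow> ?a ^ d"
      using polynomial_corr_limit[OF lim, of J "\<lambda>_. p"] by (simp add: Y_def u_def d_def)
    have Y': "(\<lambda>i. Y' i l) \<longlonglongrightarrow> (?a - ?b) * ?a ^ (d - 1)" for l
    proof -
      have "(\<Prod>l'\<in>UNIV. gauss_mean J (if l' = l then (\<lambda>j. p j - q j) else p)) = (?a - ?b) * ?a ^ (d - 1)"
        by (subst prod.remove[of _ l]) (auto simp: gauss_mean_diff d_def)
      then show ?thesis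
        using polynomial_corr_limit[OF lim, of J "\<lambda>l'. if l' = l then (\<lambda>j. p j - q j) else p"] by (simp add: Y'_def u_def d_def)
    qed
    have up: "\<forall>\<^sub>F i in sequentially. X i \<le> Y i" using ev
    proof eventually_elim
      case (elim i)
      then show ?case unfolding Xeq Y_def
        using ind0 by (intro mult_left_mono sum_mono prod_mono) auto
    qed
    have low: "\<forall>\<^sub>F i in sequentially. Y i - (\<Sum>l\<in>UNIV. Y' i l) \<le> X i" using ev
    proof eventually_elim
      case (elim i)
      have "Y i - (\<Sum>l\<in>UNIV. Y' i l) = 2 / real (NN i) * (\<Sum>\<sigma>\<in>index_pairs (NN i). (\<Prod>l\<in>UNIV. zpoly J p (u i \<sigma> l)) -
          (\<Sum>l\<in>UNIV. \<Prod>l'\<in>UNIV. zpoly J (if l' = l then (\<lambda>j. p j - q j) else p) (u i \<sigma> l')))"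
      proof -
        have "(\<Sum>l\<in>UNIV. Y' i l) = 2 / real (NN i) * (\<Sum>\<sigma>\<in>index_pairs (NN i). \<Sum>l\<in>UNIV. \<Prod>l'\<in>UNIV. zpoly J (if l' = l then (\<lambda>j. p j - q j) else p) (u i \<sigma> l'))"
          unfolding Y'_def sum_distrib_left [symmetric] by (subst sum.swap) (rule refl)
        then show ?thesis unfolding Y_def sum_subtractf right_diff_distrib by simp
      qed
      also have "\<dots> \<le> X i" unfolding Xeq
      proof (intro mult_left_mono sum_mono)
        fix \<sigma>
        have z: "zpoly J (if l' = l then (\<lambda>j. p j - q j) else p) (u i \<sigma> l')
            = (if l' = l then zpoly J p (u i \<sigma> l) - zpoly J q (u i \<sigma> l) else zpoly J p (u i \<sigma> l'))" for l l'
          by (simp add: zpoly_diff)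
        show "(\<Prod>l\<in>UNIV. zpoly J p (u i \<sigma> l)) - (\<Sum>l\<in>UNIV. \<Prod>l'\<in>UNIV. zpoly J (if l' = l then (\<lambda>j. p j - q j) else p) (u i \<sigma> l'))
            \<le> (\<Prod>l\<in>UNIV. ind i \<sigma> l)"
          unfolding z
        proof (rule prod_diff_le_telescope)
          show "0 \<le> ind i \<sigma> l \<and> ind i \<sigma> l \<le> zpoly J p (u i \<sigma> l) \<and> zpoly J q (u i \<sigma> l) \<le> ind i \<sigma> l" for l
            using elim ind0 by blast
        qed simp
      qed simp
      finally show ?case .
    qed
    have "\<forall>\<^sub>F i in sequentially. X i < A" if "A > (2 * s + 6 * \<eta>) ^ d" for A
    proof -
      have "?a ^ d \<le> (2 * s + 6 * \<eta>) ^ d" using pq(5,6) s by (intro power_mono) auto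
      then have "\<forall>\<^sub>F i in sequentially. Y i < A" using that by (intro order_tendstoD(2)[OF Y]) auto
      with up show ?thesis by eventually_elim simp
    qed
    moreover have "\<forall>\<^sub>F i in sequentially. A < X i" if A: "A < (2 * s) ^ d - real d * (12 * \<eta> * (2 * s + 6 * \<eta>) ^ (d - 1))" for A
    proof -
      have "(\<lambda>i. Y i - (\<Sum>l\<in>UNIV. Y' i l)) \<longlonglongrightarrow> ?a ^ d - (\<Sum>l\<in>(UNIV :: 'd set). (?a - ?b) * ?a ^ (d - 1))"
        by (intro tendsto_diff tendsto_sum Y Y')
      then have l: "(\<lambda>i. Y i - (\<Sum>l\<in>UNIV. Y' i l)) \<longlonglongrightarrow> ?a ^ d - real d * ((?a - ?b) * ?a ^ (d - 1))"
        by (simp add: d_def)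
      have "(?a - ?b) * ?a ^ (d - 1) \<le> 12 * \<eta> * (2 * s + 6 * \<eta>) ^ (d - 1)"
        using pq(5,6,7) s \<eta> by (intro mult_mono power_mono) auto
      then have "real d * ((?a - ?b) * ?a ^ (d - 1)) \<le> real d * (12 * \<eta> * (2 * s + 6 * \<eta>) ^ (d - 1))"
        by (intro mult_left_mono) auto
      moreover have "(2 * s) ^ d \<le> ?a ^ d" using pq(5) s by (intro power_mono) auto
      ultimately have "A < ?a ^ d - real d * ((?a - ?b) * ?a ^ (d - 1))" using A by linarith
      from order_tendstoD(1)[OF l this] low show ?thesis by eventually_elim simp
    qed
    ultimately show ?thesis by blast
  qed
  have small: "\<forall>\<^sub>F \<eta> in at_right 0. 0 < \<eta> \<and> 2 * \<eta> < s"
    using s by (intro eventually_conj eventually_at_right_less)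
      (auto simp: eventually_at_right_field intro!: exI[of _ "s / 2"])
  have "X \<longlonglongrightarrow> (2 * s) ^ d"
  proof (rule order_tendstoI)
    fix A assume A: "(2 * s) ^ d < A"
    have "((\<lambda>\<eta>. (2 * s + 6 * \<eta>) ^ d) \<longlongrightarrow> (2 * s + 6 * 0) ^ d) (at_right 0)"
      by (intro tendsto_intros)
    then have "\<forall>\<^sub>F \<eta> in at_right 0. (2 * s + 6 * \<eta>) ^ d < A" using A by (intro order_tendstoD(2)) auto
    from eventually_conj[OF this small] obtain \<eta> where "(2 * s + 6 * \<eta>) ^ d < A" "0 < \<eta>" "2 * \<eta> < s"
      by (auto dest!: eventually_happens simp: trivial_limit_at_right_real)
    then show "\<forall>\<^sub>F i in sequentially. X i < A" using bounds[of \<eta>] by blast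
  next
    fix A assume A: "A < (2 * s) ^ d"
    have "((\<lambda>\<eta>. (2 * s) ^ d - real d * (12 * \<eta> * (2 * s + 6 * \<eta>) ^ (d - 1))) \<longlongrightarrow> (2 * s) ^ d - real d * (12 * 0 * (2 * s + 6 * 0) ^ (d - 1))) (at_right 0)"
      by (intro tendsto_intros)
    then have "\<forall>\<^sub>F \<eta> in at_right 0. A < (2 * s) ^ d - real d * (12 * \<eta> * (2 * s + 6 * \<eta>) ^ (d - 1))"
      using A by (intro order_tendstoD(1)) auto
    from eventually_conj[OF this small] obtain \<eta> where "A < (2 * s) ^ d - real d * (12 * \<eta> * (2 * s + 6 * \<eta>) ^ (d - 1))" "0 < \<eta>" "2 * \<eta> < s"
      by (auto dest!: eventually_happens simp: trivial_limit_at_right_real)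
    then show "\<forall>\<^sub>F i in sequentially. A < X i" using bounds[of \<eta>] by blast
  qed
  then show ?thesis by (simp add: X_def r_def d_def)
qed

theorem theorem1p2:
  fixes x :: "nat \<Rightarrow> real^'d"
  assumes "CARD('d) \<ge> 2"
    and "\<And>n l. n \<ge> 1 \<Longrightarrow> x n $ l > 0"
    and "\<exists>c>0. \<forall>l. \<forall>n\<ge>1. x (n + 1) $ l - x n $ l \<ge> c"
    and "\<And>D' :: 'd set. \<exists>lam>0.
      (\<lambda>N. real (joint_additive_energy x D' N)) \<in>
        O(\<lambda>N. real N powr (4 - 1 / real CARD('d) * (2 * real (card D') - 31 / 76) - lam))"
  shows "infinity_MPPC x"
proof -
  let ?d = "CARD('d)"
  obtain c where c: "c > 0" "\<forall>l. \<forall>n\<ge>1. x (n + 1) $ l - x n $ l \<ge> c" using assms(3) by blast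
  have "\<exists>A\<ge>1. \<forall>j. (\<forall>l. j l \<ge> 1) \<longrightarrow> (AE \<alpha> in lborel.
    (\<lambda>i. smooth_corr x (\<lambda>l. width ?d (Suc i ^ A) * j l) (Suc i ^ A) \<alpha>) \<longlonglongrightarrow> (\<Prod>l\<in>UNIV. 1 / sqrt (pi * real (j l))))"
    by (rule smooth_corr_AE[OF assms(1) c(1) _ assms(4)]) (use c(2) in blast)
  then obtain A where A: "A \<ge> 1" "\<And>j. (\<And>l. j l \<ge> 1) \<Longrightarrow> AE \<alpha> in lborel.
    (\<lambda>i. smooth_corr x (\<lambda>l. width ?d (Suc i ^ A) * j l) (Suc i ^ A) \<alpha>) \<longlonglongrightarrow> (\<Prod>l\<in>UNIV. 1 / sqrt (pi * real (j l)))"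
    by blast
  \<comment> \<open>The exponent vectors j are countable, so a single null set serves all of them;
    from here on \<alpha> is fixed and s and \<eta> may vary freely.\<close>
  define G where "G = (\<lambda>\<alpha>. \<forall>j. (\<forall>l. j l \<ge> 1) \<longrightarrow>
    (\<lambda>i. smooth_corr x (\<lambda>l. width ?d (Suc i ^ A) * j l) (Suc i ^ A) \<alpha>) \<longlonglongrightarrow> (\<Prod>l\<in>UNIV. 1 / sqrt (pi * real (j l))))"
  have "countable (UNIV :: ('d \<Rightarrow> nat) set)"
  proof -
    have "countable (PiE (UNIV :: 'd set) (\<lambda>_. UNIV :: nat set))" by (intro countable_PiE) auto
    then show ?thesis by simp
  qed
  then have "countable {j :: 'd \<Rightarrow> nat. \<forall>l. j l \<ge> 1}" by (rule countable_subset[rotated]) simp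
  then have "AE \<alpha> in lborel. \<forall>j\<in>{j. \<forall>l. j l \<ge> 1}.
    (\<lambda>i. smooth_corr x (\<lambda>l. width ?d (Suc i ^ A) * j l) (Suc i ^ A) \<alpha>) \<longlonglongrightarrow> (\<Prod>l\<in>UNIV. 1 / sqrt (pi * real (j l)))"
    using A(2) by (subst AE_ball_countable) auto
  then have "AE \<alpha> in lborel. G \<alpha>" by (simp add: G_def)
  then have "AE \<alpha> in lebesgue. G \<alpha>" by (rule AE_completion)
  then show ?thesis
    unfolding infinity_MPPC_def
  proof (rule AE_mp, intro AE_I2 impI)
    fix \<alpha> assume G: "G \<alpha>"
    have NN: "filterlim (\<lambda>i. Suc i ^ A) at_top sequentially"
    proof (rule filterlim_at_top_mono[OF filterlim_Suc])
      show "\<forall>\<^sub>F i in sequentially. Suc i \<le> Suc i ^ A"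
        using A(1) self_le_power[of "Suc _" A] by (intro always_eventually) auto
    qed
    show "infinity_PPC (\<lambda>n. \<chi> l. frac (x n $ l * \<alpha> $ l))"
      unfolding infinity_PPC_def pair_correlation_eq_near_pairs
    proof (intro allI impI)
      fix s :: real assume s: "s > 0"
      show "(\<lambda>N. 2 * real (card (near_pairs x \<alpha> N (s / real N powr (1 / real ?d)))) / real N) \<longlonglongrightarrow> (2 * s) ^ ?d"
      proof (rule subsequence_interpolation[where A = A and cnt = "\<lambda>N r. 2 * real (card (near_pairs x \<alpha> N r))" and f = "\<lambda>s. (2 * s) ^ ?d"])
        show "2 * real (card (near_pairs x \<alpha> N r)) \<le> 2 * real (card (near_pairs x \<alpha> N' r'))" if "N \<le> N'" "r \<le> r'" for N N' r r'
        proof -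
          have "near_pairs x \<alpha> N r \<subseteq> near_pairs x \<alpha> N' r'"
            using that unfolding near_pairs_def index_pairs_def by (auto intro: order_trans)
          then have "card (near_pairs x \<alpha> N r) \<le> card (near_pairs x \<alpha> N' r')" by (intro card_mono) auto
          then show ?thesis by simp
        qed
        show "(\<lambda>i. 2 * real (card (near_pairs x \<alpha> (Suc i ^ A) (t / real (Suc i ^ A) powr (1 / real ?d)))) / real (Suc i ^ A)) \<longlonglongrightarrow> (2 * t) ^ ?d"
          if "t > 0" for t
          by (rule near_pairs_limit[OF _ NN that]) (use G in \<open>simp add: G_def\<close>)
      qed (use A s in \<open>auto simp: Suc_le_eq intro!: continuous_intros\<close>)
    qed
  qed
qed

end
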